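(* Let $r \ge 5$ be an integer and let $u_0 \in H^r$ be real-valued and $2\pi$-periodic. For every positive integer $N$, the semi-discrete scheme: find $U:[0,\infty)\to S_N$, real-valued, such that for all $\phi\in S_N$ $$(U_t + U U_x + U_{xxx} - U_{xxxxx},\phi)=0,\quad t\ge 0,\qquad U(0)=P_N u_0,$$ has a unique solution $U=U_N$ for $t\ge 0$. Moreover, let $u(x,t)$ be the solution of the periodic Kawahara equation $u_t + u u_x + u_{xxx} - u_{xxxxx}=0$ with $u(\cdot,0)=u_0$. Then there exist a time $T>0$ and a constant $C>0$, independent of $N$, such that $$\max_{0\le t\le T}\|u(\cdot,t)-U_N(\cdot,t)\|\le \frac{C}{N^r}.$$
   Context: All functions are $2\pi$-periodic in $x$; function spaces are on $[-\pi,\pi]$. $(f,g)=\int_{-\pi}^{\pi} f\,\overline{g}\,dx$ is the $L^2$ inner product and $\|\cdot\|$ its norm. With $\hat f(k)=\frac1{2\pi}\int_{-\pi}^{\pi}e^{-ikx}f(x)\,dx$, the periodic Sobolev space $H^r$ has norm $\|f\|_r=\left(\sum_{k\in\mathbb Z}(1+k^2)^r|\hat f(k)|^2\right)^{1/2}$. $S_N=\mathrm{span}\{e^{ikx}: k\in\mathbb Z,\ -N\le k\le N\}$ and $P_N$ is the $L^2$-orthogonal projection onto $S_N$. The solution $u$ of the Kawahara equation with data $u_0\in H^r$, $r\ge 5$, is the (known to exist) unique real-valued, $2\pi$-periodic solution in $C([0,\infty);H^r)\cap C^1([0,\infty);H^{r-5})$. *)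

theory Defs
  imports "HOL-Analysis.Analysis"
begin

text \<open>
  Elements of $L^2$ and $H^r$ are represented by $2\pi$-periodic, Lebesgue measurable functions
  on the real line; equality of elements is equality almost everywhere.
\<close>

abbreviation circ :: "real measure" where
  "circ \<equiv> lebesgue_on {-pi..pi}"

definition real_valued :: "(real \<Rightarrow> complex) \<Rightarrow> bool" where
  "real_valued f \<longleftrightarrow> (\<forall>x. f x \<in> \<real>)"

definition periodic :: "(real \<Rightarrow> complex) \<Rightarrow> bool" where
  "periodic f \<longleftrightarrow> (\<forall>x. f (x + 2 * pi) = f x)"

definition L2 :: "(real \<Rightarrow> complex) set" where
  "L2 = {f. periodic f \<and> f \<in> borel_measurable circ \<and> integrable circ (\<lambda>x. (cmod (f x))\<^sup>2)}"

definition l2_inner :: "(real \<Rightarrow> complex) \<Rightarrow> (real \<Rightarrow> complex) \<Rightarrow> complex" where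
  "l2_inner f g = (\<integral>x. f x * cnj (g x) \<partial>circ)"

definition l2_norm :: "(real \<Rightarrow> complex) \<Rightarrow> real" where
  "l2_norm f = sqrt (Re (l2_inner f f))"

definition fourier :: "(real \<Rightarrow> complex) \<Rightarrow> int \<Rightarrow> complex" where
  "fourier f k = 1 / (2 * complex_of_real pi) *
     (\<integral>x. exp (- (\<i> * of_int k * complex_of_real x)) * f x \<partial>circ)"

definition Hspace :: "nat \<Rightarrow> (real \<Rightarrow> complex) set" where
  "Hspace r = {f \<in> L2.
     (\<lambda>k::int. (1 + (real_of_int k)\<^sup>2) ^ r * (cmod (fourier f k))\<^sup>2) summable_on UNIV}"

definition Hnorm :: "nat \<Rightarrow> (real \<Rightarrow> complex) \<Rightarrow> real" where
  "Hnorm r f = sqrt (\<Sum>\<^sub>\<infinity>k::int. (1 + (real_of_int k)\<^sup>2) ^ r * (cmod (fourier f k))\<^sup>2)"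

definition trig_space :: "nat \<Rightarrow> (real \<Rightarrow> complex) set" where
  "trig_space N = {f. \<exists>c :: int \<Rightarrow> complex.
     f = (\<lambda>x. \<Sum>k = - int N..int N. c k * exp (\<i> * of_int k * complex_of_real x))}"

definition trig_proj :: "nat \<Rightarrow> (real \<Rightarrow> complex) \<Rightarrow> (real \<Rightarrow> complex)" where
  "trig_proj N f =
     (THE g. g \<in> trig_space N \<and> (\<forall>\<phi>\<in>trig_space N. l2_inner (\<lambda>x. f x - g x) \<phi> = 0))"

definition dx :: "(real \<Rightarrow> complex) \<Rightarrow> (real \<Rightarrow> complex)" where
  "dx f = (\<lambda>x. vector_derivative f (at x))"

definition smooth :: "(real \<Rightarrow> complex) \<Rightarrow> bool" where
  "smooth f \<longleftrightarrow> (\<forall>n x. (dx ^^ n) f differentiable (at x))"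

text \<open>The \<open>j\<close>-th distributional derivative on the circle, required to be an \<open>L2\<close> function.\<close>

definition weak_deriv :: "nat \<Rightarrow> (real \<Rightarrow> complex) \<Rightarrow> (real \<Rightarrow> complex) \<Rightarrow> bool" where
  "weak_deriv j f g \<longleftrightarrow> f \<in> L2 \<and> g \<in> L2 \<and>
     (\<forall>\<phi>. smooth \<phi> \<and> periodic \<phi> \<longrightarrow>
        (\<integral>x. g x * \<phi> x \<partial>circ) = (-1) ^ j * (\<integral>x. f x * (dx ^^ j) \<phi> x \<partial>circ))"

text \<open>Membership in $C([0,\infty);H^r)$; values at negative times are irrelevant.\<close>

definition cont_H :: "nat \<Rightarrow> (real \<Rightarrow> real \<Rightarrow> complex) \<Rightarrow> bool" where
  "cont_H r u \<longleftrightarrow> (\<forall>t\<ge>0. u t \<in> Hspace r) \<and>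
     (\<forall>t\<ge>0. ((\<lambda>s. Hnorm r (\<lambda>x. u s x - u t x)) \<longlongrightarrow> 0) (at t within {0..}))"

text \<open>\<open>ut\<close> is the time derivative of \<open>u\<close> on $[0,\infty)$ in the norm of $H^r$ (one-sided at 0).\<close>

definition time_deriv_H ::
  "nat \<Rightarrow> (real \<Rightarrow> real \<Rightarrow> complex) \<Rightarrow> (real \<Rightarrow> real \<Rightarrow> complex) \<Rightarrow> bool" where
  "time_deriv_H r u ut \<longleftrightarrow>
     (\<forall>t\<ge>0. ((\<lambda>s. Hnorm r (\<lambda>x. (u s x - u t x) / complex_of_real (s - t) - ut t x)) \<longlongrightarrow> 0)
        (at t within {0..}))"

text \<open>
  The solution in $C([0,\infty);H^r) \cap C^1([0,\infty);H^{r-5})$, meant for $r \ge 5$.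
  The first argument of \<open>u\<close> is time. The equation is an identity in $H^{r-5}$,
  hence holds almost everywhere in \<open>x\<close> for every \<open>t\<close>.
\<close>

definition kawahara_solution ::
  "nat \<Rightarrow> (real \<Rightarrow> complex) \<Rightarrow> (real \<Rightarrow> real \<Rightarrow> complex) \<Rightarrow> bool" where
  "kawahara_solution r u0 u \<longleftrightarrow>
     (\<forall>t\<ge>0. real_valued (u t)) \<and> cont_H r u \<and> (AE x in circ. u 0 x = u0 x) \<and>
     (\<exists>ut. cont_H (r - 5) ut \<and> time_deriv_H (r - 5) u ut \<and>
        (\<forall>t\<ge>0. \<exists>ux uxxx uxxxxx.
           weak_deriv 1 (u t) ux \<and> weak_deriv 3 (u t) uxxx \<and> weak_deriv 5 (u t) uxxxxx \<and>
           (AE x in circ. ut t x + u t x * ux x + uxxx x - uxxxxx x = 0)))"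

text \<open>
  Since every \<open>U t\<close> lies in the same finite-dimensional space, the time derivative of
  \<open>U\<close> may be taken pointwise in \<open>x\<close>; it is one-sided at time 0.
\<close>

definition galerkin_solution ::
  "nat \<Rightarrow> (real \<Rightarrow> complex) \<Rightarrow> (real \<Rightarrow> real \<Rightarrow> complex) \<Rightarrow> bool" where
  "galerkin_solution N u0 U \<longleftrightarrow>
     (\<forall>t\<ge>0. U t \<in> trig_space N \<and> real_valued (U t)) \<and> U 0 = trig_proj N u0 \<and>
     (\<exists>Ut. (\<forall>t\<ge>0. \<forall>x. ((\<lambda>s. U s x) has_vector_derivative Ut t x) (at t within {0..})) \<and>
        (\<forall>t\<ge>0. \<forall>\<phi>\<in>trig_space N.
           l2_inner (\<lambda>x. Ut t x + U t x * dx (U t) x + (dx ^^ 3) (U t) x - (dx ^^ 5) (U t) x) \<phi> = 0))"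

end

theory Submission
  imports Defs
begin

text \<open>
  On the Fourier side the two equations read
  $c_k' = i \omega_k c_k - \frac{ik}{2} \sum_j c_j c_{k-j}$ with $\omega_k = k^3 + k^5$, the scheme
  being the restriction of all indices to $[-N, N]$. The nonlinearity conserves the $\ell^2$ energy,
  which gives global existence, and the difference of two solutions satisfies an energy inequality
  in which the derivative falls on the smooth factor, which gives uniqueness by Gronwall's inequality.

  Comparing the scheme with the truncated solution directly loses one power of $N$: the forcing
  $\frac{ik}{2} \sum c_j c_{k-j}$ over pairs with a mode beyond $N$ is only of size $N^{1-r}$. It
  oscillates in time, however, because
  $\omega_k - \omega_j - \omega_{k-j} = k j (k-j) (3 + 5 (j^2 + j(k-j) + (k-j)^2))$ is at least
  of size $|k| N^2$ for these pairs. Dividing the forcing by this phase gives a corrector of size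
  $N^{-r-2}$ that absorbs it up to a residual of harmless size, and the energy inequality for the
  corrected error yields the rate $N^{-r}$. To stay within finite sums, the modes of the exact
  solution are cut off at $M = N^4$.
\<close>

section \<open>Trigonometric polynomials and Fourier coefficients\<close>

text \<open>The error inequality uses no bound on the solution of the scheme: the quadratic term in
  the error is neutral, and the remaining advection term costs only the sum of |k| |q_k|, where q is
  the exact solution plus the corrector. Hence T is limited only by how long u stays bounded in H^r,
  and continuity at time 0 provides such a T. Two forms of the H^r bound are carried along.
  Pointwise decay of the coefficients like |k|^(-r) serves the convolution and corrector estimates,
  which have powers of N to spare. It would give only N^(1/2-r) for the part of u beyond mode N, so
  that part is measured by the summed Sobolev norm. The time derivative of the corrector again
  contains the nonlinearity and with it a factor |j|. This is paid for by the factor 1/(|j| |k-j|)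
  that division by the phase supplies besides N^(-2). The exponent in M = N^4 comes from the
  truncation residual M^(3-r), which has to be at most N^(-r-1); for integers, 4(r-3) >= r+1 means r
  >= 5.\<close>

definition expi :: "int \<Rightarrow> real \<Rightarrow> complex" where
  "expi k x = exp (\<i> * of_int k * complex_of_real x)"

definition trig_poly :: "nat \<Rightarrow> (int \<Rightarrow> complex) \<Rightarrow> real \<Rightarrow> complex" where
  "trig_poly N c = (\<lambda>x. \<Sum>k = - int N..int N. c k * expi k x)"

lemma expi_cis: "expi k x = cis (of_int k * x)"
  by (simp add: expi_def cis_conv_exp mult.assoc)

lemma norm_expi [simp]: "cmod (expi k x) = 1"
  by (simp add: expi_cis)

lemma expi_0 [simp]: "expi 0 x = 1"
  by (simp add: expi_def)

lemma expi_add: "expi (j + k) x = expi j x * expi k x"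
  by (simp add: expi_cis cis_mult algebra_simps)

lemma cnj_expi: "cnj (expi k x) = expi (- k) x"
  by (simp add: expi_cis cis_cnj)

lemma expi_periodic: "expi k (x + 2 * pi) = expi k x"
proof -
  have "expi k (x + 2 * pi) = cis (of_int k * x) * cis (2 * pi * of_int k)"
    by (simp add: expi_cis cis_mult algebra_simps)
  then show ?thesis
    by (simp add: expi_cis cis_multiple_2pi)
qed

lemma continuous_on_expi [continuous_intros]: "continuous_on S (expi k)"
  unfolding expi_def by (intro continuous_intros)

lemma expi_has_vector_derivative:
  "(expi k has_vector_derivative (\<i> * of_int k * expi k x)) (at x within S)"
  unfolding expi_def[abs_def]
  by (rule has_vector_derivative_eq_rhs, rule has_vector_derivative_real_field)
     (auto intro!: derivative_eq_intros simp: expi_def)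

lemma trig_space_eq: "trig_space N = range (trig_poly N)"
  by (auto simp: trig_space_def trig_poly_def expi_def)

lemma trig_poly_in_trig_space [simp]: "trig_poly N c \<in> trig_space N"
  by (simp add: trig_space_eq)

lemma continuous_on_trig_poly [continuous_intros]: "continuous_on S (trig_poly N c)"
  unfolding trig_poly_def by (intro continuous_intros)

lemma trig_poly_cong: "(\<And>k. \<bar>k\<bar> \<le> int N \<Longrightarrow> c k = d k) \<Longrightarrow> trig_poly N c = trig_poly N d"
  unfolding trig_poly_def by (intro ext sum.cong) auto

lemma trig_poly_diff: "trig_poly N c x - trig_poly N d x = trig_poly N (\<lambda>k. c k - d k) x"
  by (simp add: trig_poly_def sum_subtractf left_diff_distrib)

lemma trig_poly_extend:
  assumes "N \<le> M"
  shows "trig_poly N c = trig_poly M (\<lambda>k. if \<bar>k\<bar> \<le> int N then c k else 0)"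
  unfolding trig_poly_def
  using assms by (intro ext sum.mono_neutral_cong_left) auto

lemma trig_poly_periodic: "periodic (trig_poly N c)"
  by (simp add: periodic_def trig_poly_def expi_periodic)

lemma trig_poly_has_vector_derivative:
  "(trig_poly N c has_vector_derivative trig_poly N (\<lambda>k. \<i> * of_int k * c k) x) (at x)"
proof -
  have "((\<lambda>x. \<Sum>k = - int N..int N. c k * expi k x) has_vector_derivative
     (\<Sum>k = - int N..int N. c k * (\<i> * of_int k * expi k x))) (at x)"
    by (intro derivative_intros has_vector_derivative_mult_right expi_has_vector_derivative)
  then show ?thesis by (simp add: trig_poly_def mult_ac)
qed

lemma dx_trig_poly: "dx (trig_poly N c) = trig_poly N (\<lambda>k. \<i> * of_int k * c k)"
  unfolding dx_def by (intro ext vector_derivative_at trig_poly_has_vector_derivative)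

lemma dx_power_trig_poly: "(dx ^^ n) (trig_poly N c) = trig_poly N (\<lambda>k. (\<i> * of_int k) ^ n * c k)"
  by (induction n) (auto simp: dx_trig_poly mult_ac)

lemma dx_power_expi: "(dx ^^ n) (expi k) = (\<lambda>x. (\<i> * of_int k) ^ n * expi k x)"
proof (induction n)
  case (Suc n)
  have "((\<lambda>x. (\<i> * of_int k) ^ n * expi k x) has_vector_derivative
     (\<i> * of_int k) ^ n * (\<i> * of_int k * expi k x)) (at x)" for x
    by (intro has_vector_derivative_mult_right expi_has_vector_derivative)
  then have "dx (\<lambda>x. (\<i> * of_int k) ^ n * expi k x) = (\<lambda>x. (\<i> * of_int k) ^ n * (\<i> * of_int k * expi k x))"
    unfolding dx_def by (intro ext vector_derivative_at)
  then show ?case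
    by (simp add: Suc mult_ac)
qed simp

lemma smooth_expi: "smooth (expi k)"
  unfolding smooth_def dx_power_expi
  by (blast intro: differentiableI_vector has_vector_derivative_mult_right expi_has_vector_derivative)

lemma finite_measure_circ: "finite_measure circ"
  by (intro finite_measure_lebesgue_on) auto

lemma measure_circ: "measure circ (space circ) = 2 * pi"
  by (subst measure_restrict_space) auto

lemma integrable_circ_continuous:
  fixes f :: "real \<Rightarrow> 'a::euclidean_space"
  assumes "continuous_on {-pi..pi} f"
  shows "integrable circ f"
  using absolutely_integrable_continuous_real[OF assms]
  by (simp add: absolutely_integrable_on_def set_integrable_def integrable_restrict_space)

lemma integral_expi: "(\<integral>x. expi k x \<partial>circ) = (if k = 0 then 2 * complex_of_real pi else 0)"
proof (cases "k = 0")
  case True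
  have "(\<integral>x. (1::complex) \<partial>circ) = measure circ (space circ) *\<^sub>R 1"
    by (rule lebesgue_integral_const)
  with True show ?thesis
    by (simp only: measure_circ expi_0 if_True) (simp add: scaleR_conv_of_real)
next
  case False
  have "((\<lambda>x. expi k x / (\<i> * of_int k)) has_vector_derivative expi k x) (at x within {-pi..pi})" for x
    by (rule has_vector_derivative_eq_rhs[OF has_vector_derivative_divide[OF expi_has_vector_derivative]])
       (use False in simp)
  then have "(expi k has_integral (expi k pi / (\<i> * of_int k) - expi k (-pi) / (\<i> * of_int k))) {-pi..pi}"
    by (intro fundamental_theorem_of_calculus) auto
  moreover have "expi k pi = expi k (- pi)"
    using expi_periodic[of k "- pi"] by simp
  ultimately have "(expi k has_integral 0) {-pi..pi}" by simp
  then have "integral {-pi..pi} (expi k) = 0" by (rule integral_unique)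
  moreover have "(\<integral>x. expi k x \<partial>circ) = integral {-pi..pi} (expi k)"
    by (intro lebesgue_integral_eq_integral integrable_circ_continuous continuous_intros) auto
  ultimately show ?thesis using False by simp
qed

lemma fourier_altdef: "fourier f k = (\<integral>x. expi (- k) x * f x \<partial>circ) / (2 * complex_of_real pi)"
  by (simp add: fourier_def expi_def)

lemma integrable_expi_mult:
  fixes f :: "real \<Rightarrow> complex"
  assumes "integrable circ f"
  shows "integrable circ (\<lambda>x. expi k x * f x)"
proof (rule Bochner_Integration.integrable_bound[OF assms])
  have "expi k \<in> borel_measurable circ"
    by (intro borel_measurable_integrable integrable_circ_continuous continuous_intros)
  then show "(\<lambda>x. expi k x * f x) \<in> borel_measurable circ"
    using assms by measurable
qed (simp add: norm_mult)

lemma fourier_add: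
  assumes "integrable circ f" "integrable circ g"
  shows "fourier (\<lambda>x. f x + g x) k = fourier f k + fourier g k"
  by (simp add: fourier_altdef distrib_left add_divide_distrib integrable_expi_mult assms)

lemma fourier_diff:
  assumes "integrable circ f" "integrable circ g"
  shows "fourier (\<lambda>x. f x - g x) k = fourier f k - fourier g k"
  by (simp add: fourier_altdef right_diff_distrib diff_divide_distrib integrable_expi_mult assms)

lemma fourier_divide:
  shows "fourier (\<lambda>x. f x / c) k = fourier f k / c"
  by (simp add: fourier_altdef)

lemma fourier_cmult:
  shows "fourier (\<lambda>x. c * f x) k = c * fourier f k"
  by (simp add: fourier_altdef mult.left_commute)

lemma fourier_cong_AE:
  assumes "AE x in circ. f x = g x" "f \<in> borel_measurable circ" "g \<in> borel_measurable circ"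
  shows "fourier f k = fourier g k"
proof -
  have "expi (-k) \<in> borel_measurable circ"
    by (intro borel_measurable_integrable integrable_circ_continuous continuous_intros)
  then show ?thesis
    unfolding fourier_altdef using assms
    by (intro arg_cong2[where f = "(/)"] integral_cong_AE) auto
qed

lemma norm_fourier_le:
  assumes "AE x in circ. cmod (f x) \<le> B" "f \<in> borel_measurable circ" "0 \<le> B"
  shows "cmod (fourier f k) \<le> B"
proof -
  interpret finite_measure circ by (rule finite_measure_circ)
  have int: "integrable circ f"
    by (rule integrable_const_bound[of _ B]) (use assms in auto)
  have "cmod (\<integral>x. expi (- k) x * f x \<partial>circ) \<le> (\<integral>x. cmod (expi (- k) x * f x) \<partial>circ)"
    by simp
  also have "\<dots> \<le> (\<integral>x. B \<partial>circ)"
    using assms int integrable_norm[OF integrable_expi_mult[OF int, of "-k"]]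
    by (intro integral_mono_AE) (auto simp: norm_mult)
  also have "\<dots> = 2 * pi * B"
    by (simp only: lebesgue_integral_const measure_circ) simp
  finally show ?thesis
    by (simp add: fourier_altdef norm_divide norm_mult field_simps)
qed

lemma integrable_trig_poly [simp]: "integrable circ (trig_poly N c)"
  by (intro integrable_circ_continuous continuous_intros)

lemma fourier_trig_poly: "fourier (trig_poly N c) k = (if \<bar>k\<bar> \<le> int N then c k else 0)"
proof -
  have "(\<integral>x. expi (- k) x * trig_poly N c x \<partial>circ)
      = (\<integral>x. (\<Sum>j = - int N..int N. c j * expi (j - k) x) \<partial>circ)"
    by (simp add: trig_poly_def sum_distrib_left mult_ac flip: expi_add)
  also have "\<dots> = (\<Sum>j = - int N..int N. c j * (if j = k then 2 * complex_of_real pi else 0))"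
    by (subst Bochner_Integration.integral_sum)
       (auto intro!: integrable_circ_continuous continuous_intros sum.cong simp: integral_expi)
  also have "\<dots> = 2 * complex_of_real pi * (if \<bar>k\<bar> \<le> int N then c k else 0)"
    by (auto simp: if_distrib[of "\<lambda>x. c _ * x"] cong: if_cong)
  finally show ?thesis by (simp add: fourier_altdef)
qed

lemma trig_space_cases:
  assumes "f \<in> trig_space N"
  shows "f = trig_poly N (fourier f)"
proof -
  obtain c where f: "f = trig_poly N c"
    using assms by (auto simp: trig_space_eq)
  have "trig_poly N (fourier f) = trig_poly N c"
    by (intro trig_poly_cong) (simp add: f fourier_trig_poly)
  then show ?thesis using f by simp
qed

lemma l2_inner_trig_poly:
  assumes "integrable circ f"
  shows "l2_inner f (trig_poly N c) = 2 * complex_of_real pi * (\<Sum>k = - int N..int N. cnj (c k) * fourier f k)"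
proof -
  have "l2_inner f (trig_poly N c)
      = (\<integral>x. (\<Sum>k = - int N..int N. cnj (c k) * (expi (- k) x * f x)) \<partial>circ)"
    by (simp add: l2_inner_def trig_poly_def sum_distrib_left cnj_expi mult_ac)
  also have "\<dots> = (\<Sum>k = - int N..int N. cnj (c k) * (\<integral>x. expi (- k) x * f x \<partial>circ))"
    by (subst Bochner_Integration.integral_sum) (auto intro!: integrable_mult_right integrable_expi_mult assms)
  finally show ?thesis
    by (simp add: fourier_altdef sum_distrib_left)
qed

text \<open>Orthogonality to \<open>trig_space N\<close> is tested on single modes. This turns both
  the definition of the projection and the weak form of the scheme into equations for
  coefficients.\<close>

lemma l2_inner_trig_space_eq_0_iff:
  assumes "integrable circ f"
  shows "(\<forall>\<phi>\<in>trig_space N. l2_inner f \<phi> = 0) \<longleftrightarrow> (\<forall>k. \<bar>k\<bar> \<le> int N \<longrightarrow> fourier f k = 0)"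
proof safe
  fix k assume 0: "\<forall>\<phi>\<in>trig_space N. l2_inner f \<phi> = 0" and k: "\<bar>k\<bar> \<le> int N"
  have "0 = l2_inner f (trig_poly N (\<lambda>j. if j = k then 1 else 0))"
    using 0 by simp
  also have "\<dots> = 2 * complex_of_real pi * (\<Sum>j = - int N..int N. if j = k then fourier f j else 0)"
    unfolding l2_inner_trig_poly[OF assms]
    by (intro arg_cong2[where f = "(*)"] sum.cong) auto
  finally show "fourier f k = 0" using k by (auto simp: abs_le_iff)
next
  fix \<phi> assume "\<forall>k. \<bar>k\<bar> \<le> int N \<longrightarrow> fourier f k = 0" "\<phi> \<in> trig_space N"
  then show "l2_inner f \<phi> = 0"
    by (auto simp: trig_space_eq l2_inner_trig_poly assms intro!: sum.neutral)
qed

lemma trig_proj_eq: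
  assumes "integrable circ f"
  shows "trig_proj N f = trig_poly N (fourier f)"
  unfolding trig_proj_def
proof (rule the_equality, goal_cases)
  case 1
  then show ?case
    by (subst l2_inner_trig_space_eq_0_iff)
       (auto simp: assms fourier_diff fourier_trig_poly)
next
  case (2 g)
  then have g: "g = trig_poly N (fourier g)" by (blast intro: trig_space_cases)
  then have int: "integrable circ g" using integrable_trig_poly by metis
  have "\<forall>k. \<bar>k\<bar> \<le> int N \<longrightarrow> fourier f k - fourier g k = 0"
    using 2 assms int by (subst (asm) l2_inner_trig_space_eq_0_iff) (auto simp: fourier_diff)
  then have "trig_poly N (fourier g) = trig_poly N (fourier f)"
    by (intro trig_poly_cong) auto
  with g show ?case by simp
qed

lemma fourier_cnj: "fourier (\<lambda>x. cnj (f x)) k = cnj (fourier f (- k))"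
proof -
  have "(\<integral>x. expi (- k) x * cnj (f x) \<partial>circ) = (\<integral>x. cnj (expi k x * f x) \<partial>circ)"
    by (simp add: cnj_expi)
  also have "\<dots> = cnj (\<integral>x. expi k x * f x \<partial>circ)"
    by (rule Bochner_Integration.integral_cnj)
  finally show ?thesis by (simp add: fourier_altdef)
qed

lemma fourier_real_valued:
  assumes "real_valued f"
  shows "fourier f (- k) = cnj (fourier f k)"
proof -
  have "(\<lambda>x. cnj (f x)) = f"
    using assms by (auto simp: real_valued_def Reals_cnj_iff)
  then show ?thesis using fourier_cnj[of f "- k"] by simp
qed

lemma real_valued_trig_poly:
  assumes "\<And>k. c (- k) = cnj (c k)"
  shows "real_valued (trig_poly N c)"
proof -
  have "cnj (trig_poly N c x) = trig_poly N c x" for x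
  proof -
    have "cnj (trig_poly N c x) = (\<Sum>k = - int N..int N. c (- k) * expi (- k) x)"
      by (simp add: trig_poly_def cnj_expi assms)
    also have "\<dots> = trig_poly N c x"
      unfolding trig_poly_def
      by (rule sum.reindex_bij_witness[of _ uminus uminus]) auto
    finally show ?thesis .
  qed
  then show ?thesis by (auto simp: real_valued_def Reals_cnj_iff)
qed

lemma integral_norm_trig_poly:
  "(\<integral>x. (cmod (trig_poly N c x))\<^sup>2 \<partial>circ) = 2 * pi * (\<Sum>k = - int N..int N. (cmod (c k))\<^sup>2)"
proof -
  have "complex_of_real (\<integral>x. (cmod (trig_poly N c x))\<^sup>2 \<partial>circ) = l2_inner (trig_poly N c) (trig_poly N c)"
    unfolding l2_inner_def integral_complex_of_real[symmetric] complex_norm_square ..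
  also have "\<dots> = 2 * complex_of_real pi * (\<Sum>k = - int N..int N. cnj (c k) * c k)"
    by (subst l2_inner_trig_poly)
       (auto intro!: arg_cong2[where f = "(*)"] sum.cong simp: fourier_trig_poly)
  also have "\<dots> = complex_of_real (2 * pi * (\<Sum>k = - int N..int N. (cmod (c k))\<^sup>2))"
    by (simp add: mult.commute flip: complex_norm_square)
  finally show ?thesis by (simp only: of_real_eq_iff)
qed

section \<open>Completeness of the trigonometric system\<close>

text \<open>The kernel of the Fourier transform on integrable functions, to be shown trivial.
  Integrability is part of the notion so that it is carried through the multiplications
  below.\<close>

definition no_modes :: "(real \<Rightarrow> complex) \<Rightarrow> bool" where
  "no_modes f \<longleftrightarrow> integrable circ f \<and> (\<forall>k. fourier f k = 0)"

lemma no_modes_add: "no_modes f \<Longrightarrow> no_modes g \<Longrightarrow> no_modes (\<lambda>x. f x + g x)"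
  by (simp add: no_modes_def fourier_add)

lemma no_modes_cmult: "no_modes f \<Longrightarrow> no_modes (\<lambda>x. c * f x)"
  by (simp add: no_modes_def fourier_cmult)

lemma fourier_expi_mult: "fourier (\<lambda>x. expi j x * f x) k = fourier f (k - j)"
  by (simp add: fourier_altdef algebra_simps flip: expi_add mult.assoc)

lemma no_modes_expi_mult: "no_modes f \<Longrightarrow> no_modes (\<lambda>x. expi j x * f x)"
  by (simp add: no_modes_def fourier_expi_mult integrable_expi_mult)

text \<open>On the unit circle a real-linear functional is a combination of cos and sin, hence of
  \<open>expi 1\<close> and \<open>expi (-1)\<close>, and these only shift the coefficients.
  Quantifying over \<open>f\<close> in the induction makes the product case an iterated
  application.\<close>

lemma no_modes_polynomial_mult:
  fixes p :: "complex \<Rightarrow> real"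
  assumes "real_polynomial_function p" "no_modes f"
  shows "no_modes (\<lambda>x. complex_of_real (p (cis x)) * f x)"
  using assms
proof (induction arbitrary: f rule: real_polynomial_function.induct)
  case (linear p)
  then have p: "bounded_linear p" and f: "no_modes f" by auto
  interpret bounded_linear p by (rule p)
  define a where "a = complex_of_real (p 1)"
  define b where "b = complex_of_real (p \<i>)"
  have "complex_of_real (p (cis x)) = (a - \<i> * b) / 2 * expi 1 x + (a + \<i> * b) / 2 * expi (-1) x" for x
  proof -
    have "cis x = cos x *\<^sub>R 1 + sin x *\<^sub>R \<i>"
      by (simp add: complex_eq_iff)
    then have "p (cis x) = cos x * p 1 + sin x * p \<i>"
      by (simp only: add scaleR) simp
    then show ?thesis
      by (simp add: a_def b_def expi_cis complex_eq_iff field_simps)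
  qed
  moreover have "no_modes (\<lambda>x. (a - \<i> * b) / 2 * (expi 1 x * f x) + (a + \<i> * b) / 2 * (expi (-1) x * f x))"
    by (intro no_modes_add no_modes_cmult no_modes_expi_mult f)
  ultimately show ?case by (simp add: algebra_simps)
next
  case (const c)
  then show ?case by (simp add: no_modes_cmult)
next
  case (add p q)
  then show ?case using no_modes_add by (simp add: distrib_right)
next
  case (mult p q)
  then show ?case by (simp add: mult.assoc)
qed

text \<open>\<open>Arg\<close> jumps at -1, so continuity of \<open>g \<circ> Arg\<close> does not
  follow by composition. Instead, the preimage of a closed set is the image under \<open>cis\<close>
  of a compact part of the interval. The condition on the end values enters because
  \<open>Arg\<close> sends \<open>cis (-pi)\<close> to \<open>pi\<close>.\<close>

lemma continuous_factor_through_circle: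
  fixes g :: "real \<Rightarrow> real"
  assumes "continuous_on {-pi..pi} g" "g (-pi) = g pi"
  obtains h where "continuous_on (sphere 0 1) h" "\<And>x. x \<in> {-pi..pi} \<Longrightarrow> h (cis x) = g x"
proof -
  have hg: "g (Arg (cis x)) = g x" if "x \<in> {-pi..pi}" for x
  proof (cases "x = -pi")
    case True
    have "cis x = cis pi" using True by (simp add: complex_eq_iff)
    moreover have "Arg (cis pi) = pi" by (rule Arg_cis) auto
    ultimately have "Arg (cis x) = pi" by metis
    then show ?thesis using True assms by simp
  next
    case False
    then have "Arg (cis x) = x" using that by (intro Arg_cis) auto
    then show ?thesis by simp
  qed
  have "continuous_on (sphere 0 1) (g \<circ> Arg)"
    unfolding continuous_on_closed_vimage[OF closed_sphere]
  proof safe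
    fix B :: "real set" assume "closed B"
    have "(g \<circ> Arg) -` B \<inter> sphere 0 1 = cis ` ({-pi..pi} \<inter> g -` B)"
    proof (intro equalityI subsetI)
      fix z assume z: "z \<in> (g \<circ> Arg) -` B \<inter> sphere 0 1"
      then have "z = cis (Arg z)"
        by (subst cis_Arg) (auto simp: sgn_div_norm)
      moreover have "Arg z \<in> {-pi..pi} \<inter> g -` B"
        using z Arg_bounded[of z] by auto
      ultimately show "z \<in> cis ` ({-pi..pi} \<inter> g -` B)" by blast
    next
      fix z assume "z \<in> cis ` ({-pi..pi} \<inter> g -` B)"
      then show "z \<in> (g \<circ> Arg) -` B \<inter> sphere 0 1"
        using hg by auto
    qed
    moreover have "compact ({-pi..pi} \<inter> g -` B)"
    proof -
      have "closed ({-pi..pi} \<inter> g -` B)"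
        using \<open>closed B\<close> assms(1) by (intro continuous_closed_preimage) auto
      then show ?thesis
        by (meson bounded_closed_interval bounded_subset compact_eq_bounded_closed inf_le1)
    qed
    then have "compact (cis ` ({-pi..pi} \<inter> g -` B))"
      by (intro compact_continuous_image continuous_intros) (auto simp: cis_conv_exp intro!: continuous_intros)
    ultimately show "closed ((g \<circ> Arg) -` B \<inter> sphere 0 1)"
      by (simp add: compact_imp_closed)
  qed
  with hg show ?thesis by (intro that[of "g \<circ> Arg"]) auto
qed

lemma continuous_on_Icc_bounded:
  fixes g :: "real \<Rightarrow> real"
  assumes "continuous_on {a..b} g"
  obtains B where "\<And>x. x \<in> {a..b} \<Longrightarrow> norm (g x) \<le> B"
proof -
  have "bounded (g ` {a..b})"
    by (intro compact_imp_bounded compact_continuous_image assms compact_Icc)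
  then obtain B where "\<forall>y\<in>g ` {a..b}. norm y \<le> B"
    unfolding bounded_iff by blast
  then show ?thesis by (intro that[of B]) blast
qed

lemma borel_measurable_circ_continuous:
  fixes f :: "real \<Rightarrow> 'a::euclidean_space"
  assumes "continuous_on {-pi..pi} f"
  shows "f \<in> borel_measurable circ"
  using assms by (intro borel_measurable_integrable integrable_circ_continuous)

lemma integrable_circ_bounded_mult:
  fixes f :: "real \<Rightarrow> complex"
  assumes "integrable circ f" "g \<in> borel_measurable circ" "\<And>x. x \<in> {-pi..pi} \<Longrightarrow> cmod (g x) \<le> B"
  shows "integrable circ (\<lambda>x. g x * f x)"
proof (rule Bochner_Integration.integrable_bound)
  show "integrable circ (\<lambda>x. B * cmod (f x))"
    using assms(1) by simp
  show "(\<lambda>x. g x * f x) \<in> borel_measurable circ"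
    using assms by (intro borel_measurable_times) auto
  show "AE x in circ. cmod (g x * f x) \<le> norm (B * cmod (f x))"
    using assms(3) by (intro AE_I2)
      (auto simp: norm_mult intro!: mult_right_mono intro: order_trans[OF _ abs_ge_self])
qed

text \<open>Stone-Weierstrass on the circle: \<open>g\<close> is uniformly within \<open>e\<close>
  of a polynomial in \<open>cis x\<close>, which integrates to 0 against \<open>f\<close> because
  the product has no mode 0. What remains is at most \<open>e\<close> times the L1 norm of
  \<open>f\<close>.\<close>

lemma no_modes_continuous_mult:
  fixes g :: "real \<Rightarrow> real"
  assumes f: "no_modes f" and g: "continuous_on {-pi..pi} g" "g (-pi) = g pi"
  shows "(\<integral>x. complex_of_real (g x) * f x \<partial>circ) = 0"
proof -
  obtain h where h: "continuous_on (sphere 0 1) h" "\<And>x. x \<in> {-pi..pi} \<Longrightarrow> h (cis x) = g x"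
    using continuous_factor_through_circle[OF g] by blast
  have int: "integrable circ f" using f by (simp add: no_modes_def)
  define K where "K = (\<integral>x. cmod (f x) \<partial>circ)"
  have le: "cmod (\<integral>x. complex_of_real (g x) * f x \<partial>circ) \<le> e * K" if "e > 0" for e
  proof -
    obtain p where p: "real_polynomial_function p" "\<And>z. z \<in> sphere 0 1 \<Longrightarrow> \<bar>h z - p z\<bar> < e"
      using Stone_Weierstrass_real_polynomial_function[OF compact_sphere h(1) \<open>e > 0\<close>] by blast
    define q where "q x = complex_of_real (p (cis x))" for x
    have nm: "no_modes (\<lambda>x. q x * f x)"
      unfolding q_def by (rule no_modes_polynomial_mult[OF p(1) f])
    then have "fourier (\<lambda>x. q x * f x) 0 = 0" by (simp add: no_modes_def)
    then have q0: "(\<integral>x. q x * f x \<partial>circ) = 0" by (simp add: fourier_altdef)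
    have gint: "integrable circ (\<lambda>x. complex_of_real (g x) * f x)"
    proof -
      obtain B where "\<And>x. x \<in> {-pi..pi} \<Longrightarrow> norm (g x) \<le> B"
        using continuous_on_Icc_bounded[OF g(1)] by blast
      then show ?thesis
        using g(1) by (intro integrable_circ_bounded_mult[OF int, where B = B]
            borel_measurable_circ_continuous continuous_intros) auto
    qed
    have "(\<integral>x. complex_of_real (g x) * f x \<partial>circ) = (\<integral>x. (complex_of_real (g x) - q x) * f x \<partial>circ)"
      using gint nm by (simp add: left_diff_distrib q0 no_modes_def)
    also have "cmod \<dots> \<le> (\<integral>x. cmod ((complex_of_real (g x) - q x) * f x) \<partial>circ)"
      by simp
    also have "\<dots> \<le> (\<integral>x. e * cmod (f x) \<partial>circ)"
    proof (rule integral_mono)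
      show "integrable circ (\<lambda>x. cmod ((complex_of_real (g x) - q x) * f x))"
        using gint nm by (auto simp: left_diff_distrib no_modes_def)
      show "integrable circ (\<lambda>x. e * cmod (f x))" using int by simp
    next
      fix x assume "x \<in> space circ"
      then have x: "x \<in> {-pi..pi}" by simp
      have "cmod (complex_of_real (g x) - q x) = \<bar>h (cis x) - p (cis x)\<bar>"
        using h(2)[OF x] by (simp add: q_def flip: of_real_diff)
      also have "\<dots> \<le> e" using p(2)[of "cis x"] by simp
      finally show "cmod ((complex_of_real (g x) - q x) * f x) \<le> e * cmod (f x)"
        by (simp add: norm_mult mult_right_mono)
    qed
    finally show ?thesis by (simp add: K_def)
  qed
  have "cmod (\<integral>x. complex_of_real (g x) * f x \<partial>circ) \<le> 0"
  proof (rule field_le_epsilon)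
    fix e :: real assume "e > 0"
    have "K \<ge> 0" by (simp add: K_def)
    have "cmod (\<integral>x. complex_of_real (g x) * f x \<partial>circ) \<le> e / (K + 1) * K"
      using \<open>e > 0\<close> \<open>K \<ge> 0\<close> by (intro le) auto
    also have "\<dots> \<le> e"
      using \<open>e > 0\<close> \<open>K \<ge> 0\<close> by (simp add: field_simps)
    finally show "cmod (\<integral>x. complex_of_real (g x) * f x \<partial>circ) \<le> 0 + e" by simp
  qed
  then show ?thesis by simp
qed

text \<open>The function \<open>sgn \<circ> f\<close> is an almost everywhere limit of bounded continuous functions
  vanishing at the end points, so testing against these computes the integral of \<open>\<bar>f\<bar>\<close>.\<close>

lemma AE_zero_if_orthogonal_continuous:
  fixes f :: "real \<Rightarrow> real"
  assumes f: "integrable circ f"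
    and orth: "\<And>g. continuous_on {-pi..pi} g \<Longrightarrow> g (-pi) = g pi \<Longrightarrow> (\<integral>x. g x * f x \<partial>circ) = 0"
  shows "AE x in circ. f x = 0"
proof -
  have f_meas [measurable]: "f \<in> borel_measurable circ"
    using f by auto
  have sgn_meas [measurable]: "(\<lambda>x. sgn (f x)) \<in> borel_measurable circ"
    unfolding sgn_if by measurable
  have "(\<lambda>x. sgn (f x)) measurable_on {-pi..pi}"
    using sgn_meas by (subst measurable_on_iff_borel_measurable) auto
  then obtain N g where N: "negligible N" and g: "\<And>n::nat. continuous_on UNIV (g n)"
    and lim: "\<And>x. x \<notin> N \<Longrightarrow> (\<lambda>n. g n x) \<longlonglongrightarrow> (if x \<in> {-pi..pi} then sgn (f x) else 0)"
    unfolding measurable_on_def by blast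
  \<comment> \<open>The clamp to [-1, 1] provides domination. The second factor vanishes at the end
    points, so that \<open>orth\<close> applies, and is eventually 1 at every interior
    point.\<close>
  define G where "G n x = max (-1) (min 1 (g n x)) * min 1 (real n * (pi - \<bar>x\<bar>))" for n x
  have contG: "continuous_on {-pi..pi} (G n)" for n
    unfolding G_def by (intro continuous_intros continuous_on_subset[OF g]) auto
  have G_le: "\<bar>G n x\<bar> \<le> 1" if "x \<in> {-pi..pi}" for n x
  proof -
    have "\<bar>min 1 (real n * (pi - \<bar>x\<bar>))\<bar> \<le> 1"
      using that by (auto simp: min_def)
    moreover have "\<bar>max (-1) (min 1 (g n x))\<bar> \<le> 1" by auto
    ultimately have "\<bar>max (-1) (min 1 (g n x))\<bar> * \<bar>min 1 (real n * (pi - \<bar>x\<bar>))\<bar> \<le> 1 * 1"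
      by (intro mult_mono) auto
    then show ?thesis by (simp add: G_def abs_mult)
  qed
  have limG: "(\<lambda>n. G n x) \<longlonglongrightarrow> sgn (f x)" if "x \<in> {-pi<..<pi}" "x \<notin> N" for x
  proof -
    have "(\<lambda>n. min 1 (real n * (pi - \<bar>x\<bar>))) \<longlonglongrightarrow> 1"
    proof (rule tendsto_eventually)
      have "\<forall>\<^sub>F n in sequentially. 1 / (pi - \<bar>x\<bar>) \<le> real n"
        using filterlim_real_sequentially by (auto simp: filterlim_at_top)
      then show "\<forall>\<^sub>F n in sequentially. min 1 (real n * (pi - \<bar>x\<bar>)) = 1"
        by eventually_elim (use that in \<open>auto simp: field_simps\<close>)
    qed
    moreover have "(\<lambda>n. g n x) \<longlonglongrightarrow> sgn (f x)"
      using lim[OF that(2)] that(1) by auto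
    then have "(\<lambda>n. max (-1) (min 1 (g n x))) \<longlonglongrightarrow> max (-1) (min 1 (sgn (f x)))"
      by (intro tendsto_intros)
    ultimately have "(\<lambda>n. G n x) \<longlonglongrightarrow> max (-1) (min 1 (sgn (f x))) * 1"
      unfolding G_def by (rule tendsto_mult[rotated])
    then show ?thesis by (auto simp: sgn_if split: if_splits)
  qed
  have "AE x in circ. x \<notin> N \<union> {-pi, pi}"
  proof -
    have "N \<union> {-pi, pi} \<in> null_sets lebesgue"
      using N by (simp add: negligible_iff_null_sets[symmetric])
    then have "AE x in lebesgue. x \<notin> N \<union> {-pi, pi}"
      by (rule AE_not_in)
    then show ?thesis
      by (subst AE_restrict_space_iff) auto
  qed
  then have ae: "AE x in circ. (\<lambda>n. G n x * f x) \<longlonglongrightarrow> sgn (f x) * f x"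
    using AE_space
  proof eventually_elim
    case (elim x)
    then show ?case by (intro tendsto_mult limG tendsto_const) auto
  qed
  have "(\<lambda>n. \<integral>x. G n x * f x \<partial>circ) \<longlonglongrightarrow> (\<integral>x. sgn (f x) * f x \<partial>circ)"
  proof (rule integral_dominated_convergence[OF _ _ _ ae])
    show "(\<lambda>x. sgn (f x) * f x) \<in> borel_measurable circ"
      by (intro borel_measurable_times sgn_meas f_meas)
    show "integrable circ (\<lambda>x. \<bar>f x\<bar>)" using f by simp
    show "(\<lambda>x. G n x * f x) \<in> borel_measurable circ" for n
      by (intro borel_measurable_times borel_measurable_circ_continuous contG f_meas)
    show "AE x in circ. norm (G n x * f x) \<le> \<bar>f x\<bar>" for n
      using G_le by (intro AE_I2) (auto simp: abs_mult intro!: mult_left_le_one_le)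
  qed
  moreover have "(\<integral>x. G n x * f x \<partial>circ) = 0" for n
    by (rule orth[OF contG]) (simp add: G_def)
  ultimately have "(\<integral>x. sgn (f x) * f x \<partial>circ) = 0"
    by (simp add: LIMSEQ_const_iff)
  then have "(\<integral>x. \<bar>f x\<bar> \<partial>circ) = 0"
    by (simp add: abs_sgn mult.commute)
  then show ?thesis
    using integral_nonneg_eq_0_iff_AE[of circ "\<lambda>x. \<bar>f x\<bar>"] f by simp
qed

text \<open>Real multipliers commute with taking real and imaginary parts, so the real-valued
  criterion applies to both parts of \<open>f\<close> separately.\<close>

theorem no_modes_imp_AE_zero:
  assumes "no_modes f"
  shows "AE x in circ. f x = 0"
proof -
  have f: "integrable circ f" using assms by (simp add: no_modes_def)
  have int: "integrable circ (\<lambda>x. complex_of_real (g x) * f x)" if g: "continuous_on {-pi..pi} g" for g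
  proof -
    obtain B where "\<And>x. x \<in> {-pi..pi} \<Longrightarrow> norm (g x) \<le> B"
      using continuous_on_Icc_bounded[OF g] by blast
    then show ?thesis
      using g by (intro integrable_circ_bounded_mult[OF f, where B = B]
          borel_measurable_circ_continuous continuous_intros) auto
  qed
  have "AE x in circ. Re (f x) = 0"
  proof (rule AE_zero_if_orthogonal_continuous)
    fix g :: "real \<Rightarrow> real" assume g: "continuous_on {-pi..pi} g" "g (-pi) = g pi"
    have "(\<integral>x. Re (complex_of_real (g x) * f x) \<partial>circ) = Re (\<integral>x. complex_of_real (g x) * f x \<partial>circ)"
      by (intro integral_Re int g)
    then show "(\<integral>x. g x * Re (f x) \<partial>circ) = 0"
      using no_modes_continuous_mult[OF assms g] by simp
  qed (use f in simp)
  moreover have "AE x in circ. Im (f x) = 0"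
  proof (rule AE_zero_if_orthogonal_continuous)
    fix g :: "real \<Rightarrow> real" assume g: "continuous_on {-pi..pi} g" "g (-pi) = g pi"
    have "(\<integral>x. Im (complex_of_real (g x) * f x) \<partial>circ) = Im (\<integral>x. complex_of_real (g x) * f x \<partial>circ)"
      by (intro integral_Im int g)
    then show "(\<integral>x. g x * Im (f x) \<partial>circ) = 0"
      using no_modes_continuous_mult[OF assms g] by simp
  qed (use f in simp)
  ultimately show ?thesis
    by eventually_elim (simp add: complex_eq_iff)
qed

section \<open>Decay weights and uniform approximation by partial Fourier sums\<close>

definition wt :: "int \<Rightarrow> real" where "wt k = 1 / (1 + \<bar>of_int k\<bar>)"

lemma wt_pos [simp]: "wt k > 0" and wt_nonneg [simp]: "wt k \<ge> 0" and wt_le_1 [simp]: "wt k \<le> 1"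
  and wt_neg [simp]: "wt (- k) = wt k"
  by (auto simp: wt_def field_simps)

lemma wt_antimono: "\<bar>j\<bar> \<le> \<bar>k\<bar> \<Longrightarrow> wt k \<le> wt j"
  by (auto simp: wt_def field_simps)

text \<open>\<open>wt k\<close> stands in for (1+k^2)^(-1/2), to which it is comparable. The
  constant is 1 from k = 0 plus a telescoping bound 1 for each of the two sides.\<close>

lemma sum_wt_square: 
  assumes "finite F"
  shows "(\<Sum>k\<in>F. (wt k)\<^sup>2) \<le> 3"
proof -
  \<comment> \<open>The subtracted term is the room needed for the induction, which uses 1/(K+2)^2
    <= 1/(K+1) - 1/(K+2) twice.\<close>
  have *: "(\<Sum>k = - int K..int K. (wt k)\<^sup>2) \<le> 3 - 2 / (real K + 1)" for K
  proof (induction K)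
    case (Suc K)
    have "{- int (Suc K)..int (Suc K)} = insert (- int (Suc K)) (insert (int (Suc K)) {- int K..int K})"
      by auto
    then have "(\<Sum>k = - int (Suc K)..int (Suc K). (wt k)\<^sup>2)
       = 2 * (wt (int (Suc K)))\<^sup>2 + (\<Sum>k = - int K..int K. (wt k)\<^sup>2)"
      using wt_neg[of "int (Suc K)"] by (simp del: of_nat_Suc wt_neg)
    also have "\<dots> \<le> 2 * (wt (int (Suc K)))\<^sup>2 + (3 - 2 / (real K + 1))"
      using Suc by simp
    also have "(wt (int (Suc K)))\<^sup>2 \<le> 1 / (real K + 1) - 1 / (real K + 2)"
    proof -
      have "(wt (int (Suc K)))\<^sup>2 = 1 / ((real K + 2) * (real K + 2))"
        by (simp add: wt_def power2_eq_square add_ac)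
      also have "\<dots> \<le> 1 / ((real K + 1) * (real K + 2))"
        by (intro divide_left_mono mult_right_mono) auto
      also have "\<dots> = 1 / (real K + 1) - 1 / (real K + 2)"
        by (simp add: field_simps)
      finally show ?thesis .
    qed
    finally show ?case by (simp add: add_ac)
  qed (simp add: wt_def)
  obtain K where K: "F \<subseteq> {- int K..int K}"
  proof -
    define K where "K = nat (Max (insert 0 (abs ` F)))"
    have "\<bar>k\<bar> \<le> int K" if "k \<in> F" for k
      using assms that Max_ge[of "insert 0 (abs ` F)" "\<bar>k\<bar>"] Max_ge[of "insert 0 (abs ` F)" 0]
      by (auto simp: K_def)
    then show ?thesis by (intro that[of K]) (auto simp: abs_le_iff minus_le_iff)
  qed
  have "(\<Sum>k\<in>F. (wt k)\<^sup>2) \<le> (\<Sum>k = - int K..int K. (wt k)\<^sup>2)"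
    using K by (intro sum_mono2) auto
  also have "\<dots> \<le> 3" using *[of K] by (smt (verit) divide_nonneg_nonneg of_nat_0_le_iff)
  finally show ?thesis .
qed

text \<open>Two of the \<open>s + 2\<close> powers make the sum converge; the other \<open>s\<close>
  are frozen at the cutoff, since \<open>wt\<close> decreases in |k|.\<close>

lemma trig_poly_tail:
  assumes c: "\<And>k. cmod (c k) \<le> B * wt k ^ (s + 2)" and "M \<le> K" "0 \<le> B"
  shows "cmod (trig_poly K c x - trig_poly M c x) \<le> 3 * B * wt (int M) ^ s"
proof -
  define D where "D = {- int K..int K} - {- int M..int M}"
  have "trig_poly K c x = (\<Sum>k\<in>D. c k * expi k x) + trig_poly M c x"
    unfolding trig_poly_def D_def using \<open>M \<le> K\<close>
    by (subst sum.subset_diff[of "{- int M..int M}"]) auto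
  then have "cmod (trig_poly K c x - trig_poly M c x) = cmod (\<Sum>k\<in>D. c k * expi k x)"
    by simp
  also have "\<dots> \<le> (\<Sum>k\<in>D. B * wt (int M) ^ s * (wt k)\<^sup>2)"
  proof (rule sum_norm_le)
    fix k assume "k \<in> D"
    then have "wt k ^ s \<le> wt (int M) ^ s"
      by (intro power_mono wt_antimono) (auto simp: D_def)
    have "cmod (c k * expi k x) \<le> B * (wt k ^ s * (wt k)\<^sup>2)"
      using c[of k] by (simp add: norm_mult power_add power2_eq_square mult_ac)
    also have "\<dots> \<le> B * (wt (int M) ^ s * (wt k)\<^sup>2)"
      using \<open>0 \<le> B\<close> \<open>wt k ^ s \<le> wt (int M) ^ s\<close> by (intro mult_left_mono mult_right_mono) auto
    finally show "cmod (c k * expi k x) \<le> B * wt (int M) ^ s * (wt k)\<^sup>2" by (simp add: mult_ac)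
  qed
  also have "\<dots> = B * wt (int M) ^ s * (\<Sum>k\<in>D. (wt k)\<^sup>2)"
    by (simp add: sum_distrib_left)
  also have "\<dots> \<le> B * wt (int M) ^ s * 3"
    using \<open>0 \<le> B\<close> by (intro mult_left_mono sum_wt_square) (auto simp: D_def)
  finally show ?thesis by simp
qed

text \<open>The partial sums converge uniformly to some \<open>F\<close> with the same coefficients
  as \<open>f\<close>, and since \<open>no_modes\<close> functions vanish almost everywhere,
  \<open>F\<close> agrees with \<open>f\<close> there.\<close>

theorem trig_poly_approx:
  assumes f: "integrable circ f" and c: "\<And>k. cmod (fourier f k) \<le> B * wt k ^ (s + 2)" and "s \<ge> 1"
  shows "AE x in circ. cmod (f x - trig_poly M (fourier f) x) \<le> 3 * B * wt (int M) ^ s"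
proof -
  have "0 \<le> cmod (fourier f 0)" by simp
  also have "\<dots> \<le> B" using c[of 0] by (simp add: wt_def)
  finally have B: "B \<ge> 0" .
  define p where "p M = trig_poly M (fourier f)" for M
  have tail: "cmod (p K x - p M x) \<le> 3 * B * wt (int M) ^ s" if "M \<le> K" for K M x
    unfolding p_def by (rule trig_poly_tail) (use that B c in auto)
  have lim0: "(\<lambda>M. 3 * B * wt (int M) ^ s) \<longlonglongrightarrow> 0"
  proof -
    have "(\<lambda>M. 1 / (1 + real M)) \<longlonglongrightarrow> 0"
      using LIMSEQ_inverse_real_of_nat by (simp add: inverse_eq_divide)
    then have "(\<lambda>M. 3 * B * (1 / (1 + real M)) ^ s) \<longlonglongrightarrow> 3 * B * 0 ^ s"
      by (intro tendsto_intros)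
    then show ?thesis using \<open>s \<ge> 1\<close> by (simp add: wt_def power_0_left)
  qed
  have "convergent (\<lambda>M. p M x)" for x
  proof (rule Cauchy_convergent, rule CauchyI')
    fix e :: real assume "e > 0"
    then obtain M0 where M0: "\<And>M. M \<ge> M0 \<Longrightarrow> 3 * B * wt (int M) ^ s < e"
      using order_tendstoD(2)[OF lim0] by (auto simp: eventually_sequentially)
    have "dist (p m x) (p n x) < e" if "m \<ge> M0" "n > m" for m n
      using tail[of m n x] M0[of m] that by (simp add: dist_norm norm_minus_commute)
    then show "\<exists>M. \<forall>m\<ge>M. \<forall>n>m. dist (p m x) (p n x) < e" by blast
  qed
  then obtain F where F: "\<And>x. (\<lambda>M. p M x) \<longlonglongrightarrow> F x"
    unfolding convergent_def by metis
  have F_le: "cmod (F x - p M x) \<le> 3 * B * wt (int M) ^ s" for x M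
  proof (rule Lim_bounded)
    show "(\<lambda>K. cmod (p K x - p M x)) \<longlonglongrightarrow> cmod (F x - p M x)"
      by (intro tendsto_intros F)
    show "\<forall>K\<ge>M. cmod (p K x - p M x) \<le> 3 * B * wt (int M) ^ s"
      using tail by blast
  qed
  have meas_p: "p M \<in> borel_measurable circ" for M
    unfolding p_def by (intro borel_measurable_circ_continuous continuous_intros)
  have meas_F: "F \<in> borel_measurable circ"
    by (rule borel_measurable_LIMSEQ_metric[OF meas_p F])
  interpret finite_measure circ by (rule finite_measure_circ)
  have int_d: "integrable circ (\<lambda>x. F x - p M x)" for M
    using F_le meas_F meas_p
    by (intro integrable_const_bound[where B = "3 * B * wt (int M) ^ s"] AE_I2 borel_measurable_diff) auto
  have int_p: "integrable circ (p M)" for M by (simp add: p_def)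
  have int_F: "integrable circ F"
    using Bochner_Integration.integrable_add[OF int_d[of 0] int_p[of 0]] by simp
  have "fourier F k = fourier f k" for k
  proof -
    \<comment> \<open>Once \<open>M\<close> reaches |k|, the partial sum has the k-th coefficient of
      \<open>f\<close>, and its uniform distance to \<open>F\<close> bounds the difference. That
      distance tends to 0 because \<open>s \<ge> 1\<close>.\<close>
    have "\<forall>\<^sub>F M in sequentially. cmod (fourier F k - fourier f k) \<le> 3 * B * wt (int M) ^ s"
      using eventually_ge_at_top[of "nat \<bar>k\<bar>"]
    proof eventually_elim
      case (elim M)
      then have "fourier F k - fourier f k = fourier F k - fourier (p M) k"
        by (auto simp: p_def fourier_trig_poly)
      also have "\<dots> = fourier (\<lambda>x. F x - p M x) k"
        by (rule fourier_diff[OF int_F int_p, symmetric])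
      finally show ?case
        using norm_fourier_le[of "\<lambda>x. F x - p M x" "3 * B * wt (int M) ^ s" k] F_le B int_d
        by (auto dest: borel_measurable_integrable)
    qed
    then have "cmod (fourier F k - fourier f k) \<le> 0"
      by (intro tendsto_lowerbound[OF lim0]) auto
    then show ?thesis by simp
  qed
  then have "no_modes (\<lambda>x. f x - F x)"
    using f int_F by (simp add: no_modes_def fourier_diff)
  then have "AE x in circ. f x - F x = 0"
    by (rule no_modes_imp_AE_zero)
  then show ?thesis
    by eventually_elim (use F_le in \<open>simp add: p_def\<close>)
qed

section \<open>A global existence theorem and Gronwall's inequality\<close>

lemma at_within_atLeastAtMost_atLeast:
  fixes t b :: real
  assumes "t < b"
  shows "at t within {a..b} = at t within {a..}"
proof (rule at_within_nhd[of t "{..<b}"])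
  show "{a..b} \<inter> {..<b} - {t} = {a..} \<inter> {..<b} - {t}" by auto
qed (use assms in auto)

lemma indefinite_integral_has_vector_derivative:
  fixes g :: "real \<Rightarrow> 'a::banach"
  assumes "continuous_on {0..} g" "t \<ge> 0"
  shows "((\<lambda>t. integral {0..t} g) has_vector_derivative g t) (at t within {0..})"
proof -
  have "continuous_on {0..t+1} g"
    by (rule continuous_on_subset[OF assms(1)]) auto
  then have "((\<lambda>t. integral {0..t} g) has_vector_derivative g t) (at t within {0..t+1})"
    by (rule integral_has_vector_derivative) (use assms in auto)
  then show ?thesis
    by (subst (asm) at_within_atLeastAtMost_atLeast) auto
qed

text \<open>The gain is the division by \<open>c\<close>: it compensates a Lipschitz constant
  proportional to \<open>c\<close> and leaves a contraction factor.\<close>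

lemma norm_integral_exp_le:
  fixes g :: "real \<Rightarrow> 'a::banach"
  assumes "continuous_on {0..t} g" "\<And>s. 0 \<le> s \<Longrightarrow> s \<le> t \<Longrightarrow> norm (g s) \<le> K * exp (c * s)"
    and "c > 0" "K \<ge> 0" "t \<ge> 0"
  shows "norm (integral {0..t} g) \<le> K * exp (c * t) / c"
proof -
  have "((\<lambda>s. K * exp (c * s) / c) has_vector_derivative K * exp (c * s)) (at s within {0..t})" for s
    unfolding has_real_derivative_iff_has_vector_derivative[symmetric]
    using \<open>c > 0\<close> by (auto intro!: derivative_eq_intros)
  then have int: "((\<lambda>s. K * exp (c * s)) has_integral K * exp (c * t) / c - K * exp (c * 0) / c) {0..t}"
    using assms by (intro fundamental_theorem_of_calculus) auto
  have "norm (integral {0..t} g) \<le> integral {0..t} (\<lambda>s. K * exp (c * s))"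
    using assms by (intro integral_norm_bound_integral[OF integrable_continuous_real
          has_integral_integrable[OF int]]) auto
  also have "\<dots> \<le> K * exp (c * t) / c"
    using integral_unique[OF int] assms by simp
  finally show ?thesis .
qed

text \<open>An exponential weight turns the integral operator into a contraction on all of
  \<open>[0, \<infinity>)\<close> at once, so no continuation argument is needed.\<close>

theorem lipschitz_ode_global_solution:
  fixes F :: "'a::banach \<Rightarrow> 'a"
  assumes Lip: "\<And>x y. norm (F x - F y) \<le> L * norm (x - y)"
  obtains x where "x 0 = x0" "\<And>t. t \<ge> 0 \<Longrightarrow> (x has_vector_derivative F (x t)) (at t within {0..})"
proof -
  \<comment> \<open>With this choice the integral operator contracts by the factor 1/2; the summand
    1 keeps \<open>c\<close> positive for every \<open>L\<close>.\<close>
  define c where "c = 2 * (\<bar>L\<bar> + 1)"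
  have c: "c > 0" "2 * \<bar>L\<bar> \<le> c" by (auto simp: c_def)
  have Lip': "norm (F x - F y) \<le> c / 2 * norm (x - y)" for x y
  proof -
    have "L * norm (x - y) \<le> c / 2 * norm (x - y)"
      using c by (intro mult_right_mono) auto
    then show ?thesis using Lip[of x y] by linarith
  qed
  have contF: "continuous_on UNIV F"
    by (rule lipschitz_on_continuous_on[of "c / 2"], rule lipschitz_onI)
       (use Lip' c in \<open>auto simp: dist_norm\<close>)
  \<comment> \<open>The unknown \<open>y\<close> is the solution times exp(-c t), bounded even when
    the solution grows; \<open>G\<close> undoes the weight before applying \<open>F\<close>.\<close>
  define G :: "(real \<Rightarrow>\<^sub>C 'a) \<Rightarrow> real \<Rightarrow> 'a" where "G y s = F (exp (c * s) *\<^sub>R apply_bcontfun y s)" for y s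
  have contG: "continuous_on S (G y)" for y S
    unfolding G_def by (intro continuous_on_compose2[OF contF] continuous_intros) auto
  \<comment> \<open>\<open>max 0 t\<close> extends the operator constantly to negative times, since
    \<open>y\<close> ranges over functions on the whole line.\<close>
  define P where "P y t = exp (- c * max 0 t) *\<^sub>R (x0 + integral {0..max 0 t} (G y))" for y t
  have G_diff: "norm (G y s - G z s) \<le> c / 2 * norm (y - z) * exp (c * s)" for y z s
  proof -
    have "norm (G y s - G z s) \<le> c / 2 * norm (exp (c * s) *\<^sub>R (apply_bcontfun y s - apply_bcontfun z s))"
      using Lip' unfolding G_def by (metis scaleR_diff_right)
    also have "\<dots> \<le> c / 2 * (exp (c * s) * norm (y - z))"
      using c norm_bounded[of "y - z" s] by (intro mult_left_mono) (auto simp: minus_bcontfun.rep_eq)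
    finally show ?thesis by (simp add: mult_ac)
  qed
  have P_diff: "norm (P y t - P z t) \<le> norm (y - z) / 2" for y z t
  proof -
    define u where "u = max 0 t"
    have u: "u \<ge> 0" by (simp add: u_def)
    have "integral {0..u} (G y) - integral {0..u} (G z) = integral {0..u} (\<lambda>s. G y s - G z s)"
      by (intro Henstock_Kurzweil_Integration.integral_diff[symmetric] integrable_continuous_real contG)
    then have "P y t - P z t = exp (- c * u) *\<^sub>R integral {0..u} (\<lambda>s. G y s - G z s)"
      by (simp add: P_def u_def flip: scaleR_diff_right)
    then have "norm (P y t - P z t) = exp (- c * u) * norm (integral {0..u} (\<lambda>s. G y s - G z s))"
      by simp
    also have "\<dots> \<le> exp (- c * u) * (c / 2 * norm (y - z) * exp (c * u) / c)"
      using c u G_diff by (intro mult_left_mono norm_integral_exp_le continuous_intros contG) auto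
    also have "\<dots> = norm (y - z) / 2"
      using c by (simp flip: exp_add)
    finally show ?thesis .
  qed
  have cont_int: "continuous_on {0..} (\<lambda>t. integral {0..t} (G y))" for y
    unfolding continuous_on_eq_continuous_within
    by (auto intro!: has_vector_derivative_continuous indefinite_integral_has_vector_derivative contG)
  have contP: "continuous_on UNIV (P y)" for y
    unfolding P_def
    by (intro continuous_intros continuous_on_compose2[OF cont_int]) auto
  have "P y \<in> bcontfun" for y
  proof (rule bcontfun_normI[OF contP])
    fix t
    have "norm (P 0 t) \<le> norm x0 + norm (F 0) / c"
    proof -
      define u where "u = max 0 t"
      have u: "u \<ge> 0" by (simp add: u_def)
      have "norm (integral {0..u} (G 0)) \<le> norm (F 0) * exp (c * u) / c"
        using c u by (intro norm_integral_exp_le contG) (auto simp: G_def zero_bcontfun.rep_eq mult_le_cancel_left1)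
      then have "exp (- c * u) * norm (x0 + integral {0..u} (G 0))
          \<le> exp (- c * u) * (norm x0 + norm (F 0) * exp (c * u) / c)"
        by (intro mult_left_mono) (auto intro: norm_triangle_le)
      also have "\<dots> = exp (- c * u) * norm x0 + norm (F 0) / c"
        by (simp add: distrib_left flip: exp_add)
      also have "\<dots> \<le> norm x0 + norm (F 0) / c"
        using c u by (simp add: mult_left_le_one_le)
      finally show ?thesis by (simp add: P_def u_def)
    qed
    then show "norm (P y t) \<le> norm x0 + norm (F 0) / c + norm y / 2"
      using P_diff[of y t 0] norm_triangle_ineq2[of "P y t" "P 0 t"] by simp
  qed
  then have app: "apply_bcontfun (Bcontfun (P y)) = P y" for y
    by (simp add: Bcontfun_inverse)
  have "\<exists>!y. Bcontfun (P y) = y"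
  proof (rule banach_fix_type[of "1/2"], safe)
    fix y z :: "real \<Rightarrow>\<^sub>C 'a"
    show "dist (Bcontfun (P y)) (Bcontfun (P z)) \<le> 1 / 2 * dist y z"
      using P_diff[of y _ z] by (intro dist_bound) (simp add: app dist_norm)
  qed auto
  then obtain y where "Bcontfun (P y) = y" by blast
  then have y: "apply_bcontfun y t = P y t" for t by (metis app)
  define x where "x t = exp (c * t) *\<^sub>R apply_bcontfun y t" for t
  have x: "x t = x0 + integral {0..t} (G y)" if "t \<ge> 0" for t
    using that by (simp add: x_def y P_def flip: exp_add)
  show ?thesis
  proof (rule that)
    show "x 0 = x0" by (simp add: x)
    fix t :: real assume t: "t \<ge> 0"
    have "((\<lambda>t. x0 + integral {0..t} (G y)) has_vector_derivative 0 + G y t) (at t within {0..})"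
      by (intro derivative_intros indefinite_integral_has_vector_derivative contG t)
    then have "(x has_vector_derivative 0 + G y t) (at t within {0..})"
      by (rule has_vector_derivative_transform[rotated -1]) (use t x in auto)
    then show "(x has_vector_derivative F (x t)) (at t within {0..})"
      by (simp add: G_def x_def)
  qed
qed

text \<open>The difference splits into a part with the common factor R / m x <= 1 and a part from
  the change of the factor, which is controlled because max R (norm z) is 1-Lipschitz. Each
  contributes at most norm (x - y).\<close>

lemma radial_retraction_lipschitz:
  fixes x y :: "'a::real_normed_vector"
  assumes "R > 0"
  shows "norm ((R / max R (norm x)) *\<^sub>R x - (R / max R (norm y)) *\<^sub>R y) \<le> 2 * norm (x - y)"
proof -
  define m where "m z = max R (norm z)" for z :: 'a
  have m: "m z > 0" "R \<le> m z" "norm z \<le> m z" for z using assms by (auto simp: m_def)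
  have "(R / m x) *\<^sub>R x - (R / m y) *\<^sub>R y = (R / m x) *\<^sub>R (x - y) + (R / m x - R / m y) *\<^sub>R y"
    by (simp add: algebra_simps)
  also have "norm \<dots> \<le> (R / m x) * norm (x - y) + \<bar>R / m x - R / m y\<bar> * norm y"
    using assms m[of x] by (intro norm_triangle_le) simp
  also have "(R / m x) * norm (x - y) \<le> 1 * norm (x - y)"
    using m[of x] assms by (intro mult_right_mono) auto
  also have "\<bar>R / m x - R / m y\<bar> * norm y = (R / m x) * (norm y / m y) * \<bar>m y - m x\<bar>"
  proof -
    have "R / m x - R / m y = R * (m y - m x) / (m x * m y)"
      using m(1)[of x] m(1)[of y] by (simp add: field_simps)
    then show ?thesis using m(1)[of x] m(1)[of y] assms by (simp add: abs_mult abs_divide)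
  qed
  also have "(R / m x) * (norm y / m y) * \<bar>m y - m x\<bar> \<le> 1 * 1 * norm (x - y)"
  proof (intro mult_mono)
    show "\<bar>m y - m x\<bar> \<le> norm (x - y)"
      using norm_triangle_ineq3[of x y] unfolding m_def by (auto simp: max_def)
    show "R / m x \<le> 1" "norm y / m y \<le> 1"
      using m[of x] m[of y] by auto
  qed (use m[of x] m[of y] assms in auto)
  finally show ?thesis by (simp add: m_def)
qed

lemma gronwall:
  fixes E E' :: "real \<Rightarrow> real"
  assumes der: "\<And>t. t \<in> {0..T} \<Longrightarrow> (E has_real_derivative E' t) (at t within {0..})"
    and le: "\<And>t. t \<in> {0..T} \<Longrightarrow> E' t \<le> K * E t + B" and "K \<ge> 0" "B \<ge> 0" and t: "t \<in> {0..T}"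
  shows "E t \<le> (E 0 + B * t) * exp (K * t)"
proof (cases "t = 0")
  case False
  \<comment> \<open>The linear term \<open>B * s\<close> in place of the exact integral avoids
    dividing by \<open>K\<close>, so that \<open>K = 0\<close> is covered; the energy bounds use
    that case.\<close>
  define h where "h s = exp (- K * s) * E s - B * s" for s
  have h': "(h has_real_derivative (exp (- K * s) * (E' s - K * E s) - B)) (at s within {0..})"
    if "s \<in> {0..T}" for s
    unfolding h_def using der[OF that]
    by (auto intro!: derivative_eq_intros simp: algebra_simps)
  have "h t \<le> h 0"
  proof (rule DERIV_nonpos_imp_decreasing_open[of 0 t h])
    show "0 \<le> t" using t False by simp
    show "continuous_on {0..t} h"
    proof (rule continuous_on_subset[of "{0..T}"])
      show "continuous_on {0..T} h"
        unfolding continuous_on_eq_continuous_within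
        by (auto intro!: continuous_within_subset[OF DERIV_continuous[OF h']])
    qed (use t in auto)
    fix s assume s: "0 < s" "s < t"
    then have "at s within {0..} = at s"
      by (intro at_within_interior) auto
    then have "(h has_real_derivative (exp (- K * s) * (E' s - K * E s) - B)) (at s)"
      using h'[of s] s t by auto
    moreover have "exp (- K * s) * (E' s - K * E s) - B \<le> 0"
    proof -
      have "exp (- K * s) * (E' s - K * E s) \<le> exp (- K * s) * B"
        using le[of s] s t by (intro mult_left_mono) auto
      also have "\<dots> \<le> B" using s \<open>K \<ge> 0\<close> \<open>B \<ge> 0\<close> by (intro mult_left_le_one_le) auto
      finally show ?thesis by simp
    qed
    ultimately show "\<exists>y. DERIV h s :> y \<and> y \<le> 0" by blast
  qed
  then have "exp (- K * t) * E t \<le> E 0 + B * t" by (simp add: h_def)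
  then have "exp (K * t) * (exp (- K * t) * E t) \<le> exp (K * t) * (E 0 + B * t)"
    by (intro mult_left_mono) auto
  then show ?thesis by (simp add: mult_ac flip: exp_add mult.assoc)
qed simp

section \<open>Convolution and the energy balance\<close>

text \<open>The symbol arises from -(ik)^3 + (ik)^5 = i (k^3 + k^5). Both dispersive terms have the
  same sign, which keeps the last factor of the phase positive.\<close>

definition omega :: "int \<Rightarrow> real" where
  "omega k = of_int (k ^ 3 + k ^ 5)"

text \<open>Coefficients of \<open>a\<close> and \<open>b\<close> beyond degree \<open>N\<close> are ignored, whatever their values.\<close>

definition conv :: "nat \<Rightarrow> (int \<Rightarrow> complex) \<Rightarrow> (int \<Rightarrow> complex) \<Rightarrow> int \<Rightarrow> complex" where
  "conv N a b k = (\<Sum>j = - int N..int N. if \<bar>k - j\<bar> \<le> int N then a j * b (k - j) else 0)"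

definition hermitian :: "(int \<Rightarrow> complex) \<Rightarrow> bool" where
  "hermitian a \<longleftrightarrow> (\<forall>k. a (- k) = cnj (a k))"

lemma hermitianD: "hermitian a \<Longrightarrow> a (- k) = cnj (a k)"
  by (simp add: hermitian_def)

definition modes :: "nat \<Rightarrow> int \<Rightarrow> int set" where
  "modes N k = {j. \<bar>j\<bar> \<le> int N \<and> \<bar>k - j\<bar> \<le> int N}"

lemma modes_subset: "modes N k \<subseteq> {- int N..int N}"
  by (auto simp: modes_def)

lemma finite_modes [simp]: "finite (modes N k)"
  by (rule finite_subset[OF modes_subset]) simp

lemma conv_modes: "conv N a b k = (\<Sum>j\<in>modes N k. a j * b (k - j))"
  unfolding conv_def
  by (rule sum.mono_neutral_cong_right) (auto simp: modes_def)

lemma sum_modes_flip: "(\<Sum>j\<in>modes N k. f (k - j)) = (\<Sum>j\<in>modes N k. f j)"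
  by (rule sum.reindex_bij_witness[of _ "\<lambda>j. k - j" "\<lambda>j. k - j"]) (auto simp: modes_def)

lemma conv_commute: "conv N a b k = conv N b a k"
  unfolding conv_modes using sum_modes_flip[of "\<lambda>j. b j * a (k - j)" k N] by (simp add: mult.commute)

lemma conv_add_left: "conv N (\<lambda>k. a k + b k) c k = conv N a c k + conv N b c k"
  by (simp add: conv_modes distrib_right sum.distrib)

lemma conv_add_right: "conv N c (\<lambda>k. a k + b k) k = conv N c a k + conv N c b k"
  by (simp add: conv_modes distrib_left sum.distrib)

lemma conv_scale: "conv N (\<lambda>k. s * a k) (\<lambda>k. s * b k) k = s\<^sup>2 * conv N a b k"
  by (simp add: conv_modes sum_distrib_left power2_eq_square mult_ac)

lemma conv_hermitian:
  assumes "hermitian a" "hermitian b"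
  shows "conv N a b (- k) = cnj (conv N a b k)"
proof -
  have "conv N a b (- k) = (\<Sum>j\<in>modes N (- k). a j * b (- k - j))"
    by (rule conv_modes)
  also have "\<dots> = (\<Sum>j\<in>modes N k. a (- j) * b (- (k - j)))"
    by (rule sum.reindex_bij_witness[of _ uminus uminus]) (auto simp: modes_def)
  also have "\<dots> = cnj (conv N a b k)"
    unfolding conv_modes by (simp only: hermitianD[OF assms(1)] hermitianD[OF assms(2)]) simp
  finally show ?thesis .
qed

lemma fourier_product_trig_poly:
  "fourier (\<lambda>x. trig_poly N a x * trig_poly N b x) k = conv N a b k"
proof -
  have "fourier (\<lambda>x. trig_poly N a x * trig_poly N b x) k
     = fourier (\<lambda>x. \<Sum>j = - int N..int N. a j * (expi j x * trig_poly N b x)) k"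
    by (simp add: trig_poly_def[of N a] sum_distrib_right mult.assoc)
  also have "\<dots> = (\<Sum>j = - int N..int N. a j * fourier (\<lambda>x. expi j x * trig_poly N b x) k)"
  proof -
    have "(\<integral>x. expi (- k) x * (\<Sum>j = - int N..int N. a j * (expi j x * trig_poly N b x)) \<partial>circ)
      = (\<integral>x. (\<Sum>j = - int N..int N. a j * (expi (- k) x * (expi j x * trig_poly N b x))) \<partial>circ)"
      by (simp add: sum_distrib_left mult_ac)
    also have "\<dots> = (\<Sum>j = - int N..int N. a j * (\<integral>x. expi (- k) x * (expi j x * trig_poly N b x) \<partial>circ))"
      by (subst Bochner_Integration.integral_sum)
         (auto intro!: integrable_mult_right integrable_expi_mult)
    finally show ?thesis by (simp add: fourier_altdef sum_divide_distrib)
  qed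
  also have "\<dots> = conv N a b k"
    unfolding conv_def by (intro sum.cong) (auto simp: fourier_expi_mult fourier_trig_poly)
  finally show ?thesis .
qed

text \<open>The advection term is half the derivative of the square: symmetrising under j -> k - j
  replaces the factor j by k/2.\<close>

lemma conv_derivative:
  "conv N a (\<lambda>j. \<i> * of_int j * a j) k = \<i> * of_int k / 2 * conv N a a k"
proof -
  let ?b = "\<lambda>j. \<i> * of_int j * a j"
  have "2 * conv N a ?b k = conv N a ?b k + conv N ?b a k"
    by (simp add: conv_commute[of N ?b])
  also have "\<dots> = \<i> * of_int k * conv N a a k"
    by (simp add: conv_modes sum_distrib_left algebra_simps flip: sum.distrib)
  finally show ?thesis by (simp add: field_simps)
qed

lemma fourier_advection_trig_poly:
  "fourier (\<lambda>x. trig_poly N a x * dx (trig_poly N a) x) k = \<i> * of_int k / 2 * conv N a a k"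
  by (simp add: dx_trig_poly fourier_product_trig_poly conv_derivative)

text \<open>Index set of the trilinear sums in the energy balance. Truncating all of k, l and k - l
  makes it invariant under exchanging k and l and under l -> k - l, so the scheme inherits the
  cancellations of the continuous equation.\<close>

definition pairs :: "nat \<Rightarrow> (int \<times> int) set" where
  "pairs N = {(k, l). \<bar>k\<bar> \<le> int N \<and> \<bar>l\<bar> \<le> int N \<and> \<bar>k - l\<bar> \<le> int N}"

lemma finite_pairs [simp]: "finite (pairs N)"
  by (rule finite_subset[of _ "{- int N..int N} \<times> {- int N..int N}"]) (auto simp: pairs_def)

lemma sum_conv_pairs:
  "(\<Sum>k = - int N..int N. f k * conv N q a k) = (\<Sum>(k, l)\<in>pairs N. f k * (q (k - l) * a l))"
proof -
  have "conv N q a k = (\<Sum>l\<in>modes N k. q (k - l) * a l)" for k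
    unfolding conv_modes using sum_modes_flip[of "\<lambda>j. q j * a (k - j)" k N] by simp
  then have "(\<Sum>k = - int N..int N. f k * conv N q a k)
     = (\<Sum>(k, l)\<in>Sigma {- int N..int N} (modes N). f k * (q (k - l) * a l))"
    by (simp add: sum_distrib_left sum.Sigma)
  also have "Sigma {- int N..int N} (modes N) = pairs N"
    by (auto simp: pairs_def modes_def)
  finally show ?thesis .
qed

lemma sum_pairs_swap: "(\<Sum>(k, l)\<in>pairs N. f k l) = (\<Sum>(k, l)\<in>pairs N. f l k)"
  by (rule sum.reindex_bij_witness[of _ prod.swap prod.swap]) (auto simp: pairs_def)

lemma sum_pairs_shift: "(\<Sum>(k, l)\<in>pairs N. f k l) = (\<Sum>(k, l)\<in>pairs N. f k (k - l))"
  by (rule sum.reindex_bij_witness[of _ "\<lambda>(k, l). (k, k - l)" "\<lambda>(k, l). (k, k - l)"]) (auto simp: pairs_def)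

text \<open>Exchanging \<open>k\<close> and \<open>l\<close> and conjugating leaves only the commutator, in which the
  derivative falls on \<open>q\<close>.\<close>

lemma advection_commutator:
  assumes "hermitian q"
  shows "2 * \<i> * of_real (Im (\<Sum>k = - int N..int N. of_int k * cnj (a k) * conv N q a k))
     = (\<Sum>(k, l)\<in>pairs N. of_int (k - l) * (cnj (a k) * q (k - l) * a l))"
proof -
  let ?X = "\<Sum>k = - int N..int N. of_int k * cnj (a k) * conv N q a k"
  have X: "?X = (\<Sum>(k, l)\<in>pairs N. of_int k * (cnj (a k) * q (k - l) * a l))"
    by (subst sum_conv_pairs) (simp add: mult.assoc)
  have "cnj ?X = (\<Sum>(k, l)\<in>pairs N. of_int k * (a k * cnj (q (k - l)) * cnj (a l)))"
    unfolding X cnj_sum by (intro sum.cong) (auto simp: mult_ac)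
  also have "\<dots> = (\<Sum>(k, l)\<in>pairs N. of_int k * (a k * q (l - k) * cnj (a l)))"
    using hermitianD[OF assms] by (intro sum.cong) (auto, metis minus_diff_eq)
  also have "\<dots> = (\<Sum>(k, l)\<in>pairs N. of_int l * (cnj (a k) * q (k - l) * a l))"
    by (subst sum_pairs_swap) (simp add: mult_ac)
  finally have "?X - cnj ?X = (\<Sum>(k, l)\<in>pairs N. of_int (k - l) * (cnj (a k) * q (k - l) * a l))"
    unfolding X by (simp add: sum_subtractf[symmetric] case_prod_unfold left_diff_distrib)
  moreover have "2 * \<i> * of_real (Im z) = z - cnj z" for z
    by (simp add: complex_diff_cnj mult_ac)
  ultimately show ?thesis by presburger
qed

text \<open>With \<open>q = a\<close> there is one more symmetry: renaming l to k - l turns the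
  commutator sum \<open>?C\<close> into \<open>?L\<close>, so \<open>?X\<close> is twice
  \<open>?C\<close>. The commutator identity then reads X = 4 i Im X, and comparing imaginary parts
  forces Im X = 0.\<close>

lemma advection_self_neutral:
  assumes "hermitian a"
  shows "Im (\<Sum>k = - int N..int N. of_int k * cnj (a k) * conv N a a k) = 0"
proof -
  let ?X = "\<Sum>k = - int N..int N. of_int k * cnj (a k) * conv N a a k"
  let ?C = "\<Sum>(k, l)\<in>pairs N. of_int (k - l) * (cnj (a k) * a (k - l) * a l)"
  let ?L = "\<Sum>(k, l)\<in>pairs N. of_int l * (cnj (a k) * a (k - l) * a l)"
  have "?C = (\<Sum>(k, l)\<in>pairs N. of_int l * (cnj (a k) * a l * a (k - l)))"
    by (subst sum_pairs_shift) simp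
  also have "\<dots> = ?L" by (simp add: mult_ac)
  finally have 1: "?C = ?L" .
  have "?X = (\<Sum>(k, l)\<in>pairs N. of_int k * (cnj (a k) * a (k - l) * a l))"
    by (subst sum_conv_pairs) (simp add: mult.assoc)
  then have "?C = ?X - ?L"
    by (simp add: sum_subtractf[symmetric] case_prod_unfold left_diff_distrib)
  with 1 have "?X = ?C + ?C" by simp
  then have "?X = 4 * \<i> * of_real (Im ?X)"
    using advection_commutator[OF assms, where N = N and a = a] by simp
  then have "Im ?X = Im (4 * \<i> * of_real (Im ?X))" by (rule arg_cong)
  then show ?thesis by simp
qed

text \<open>Young's inequality for convolutions. Since \<open>q\<close> is hermitian the weight is
  even, so after |a_k| |a_l| <= (|a_k|^2 + |a_l|^2) / 2 both halves give the same sum.\<close>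

lemma advection_commutator_bound:
  assumes "hermitian q"
  shows "\<bar>2 * Im (\<Sum>k = - int N..int N. of_int k * cnj (a k) * conv N q a k)\<bar>
    \<le> (\<Sum>k = - int N..int N. \<bar>of_int k\<bar> * cmod (q k)) * (\<Sum>k = - int N..int N. (cmod (a k))\<^sup>2)"
proof -
  let ?X = "\<Sum>k = - int N..int N. of_int k * cnj (a k) * conv N q a k"
  let ?g = "\<lambda>m. \<bar>of_int m\<bar> * cmod (q m)"
  let ?S = "\<Sum>(k, l)\<in>pairs N. ?g (k - l) * (cmod (a k))\<^sup>2"
  have g_neg: "?g (- m) = ?g m" for m using hermitianD[OF assms, of m] by simp
  have swap: "?S = (\<Sum>(k, l)\<in>pairs N. ?g (k - l) * (cmod (a l))\<^sup>2)"
    by (subst sum_pairs_swap) (use g_neg[of "_ - _"] in \<open>simp add: case_prod_unfold\<close>)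
  have "\<bar>2 * r\<bar> = cmod (2 * \<i> * of_real r)" for r
    by (simp add: norm_mult)
  then have "\<bar>2 * Im ?X\<bar> = cmod (2 * \<i> * of_real (Im ?X))" .
  also have "\<dots> \<le> (\<Sum>(k, l)\<in>pairs N. ?g (k - l) * (cmod (a k) * cmod (a l)))"
    unfolding advection_commutator[OF assms]
    by (rule sum_norm_le) (auto simp: norm_mult simp flip: of_int_diff)
  also have "\<dots> \<le> (\<Sum>(k, l)\<in>pairs N. ?g (k - l) * (((cmod (a k))\<^sup>2 + (cmod (a l))\<^sup>2) / 2))"
  proof (intro sum_mono, clarify)
    fix k l
    show "?g (k - l) * (cmod (a k) * cmod (a l)) \<le> ?g (k - l) * (((cmod (a k))\<^sup>2 + (cmod (a l))\<^sup>2) / 2)"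
      using sum_squares_bound[of "cmod (a k)" "cmod (a l)"] by (intro mult_left_mono) auto
  qed
  also have "\<dots> = (?S + ?S) / 2"
    by (subst (2) swap) (simp add: case_prod_unfold sum.distrib sum_divide_distrib distrib_left add_divide_distrib)
  also have "\<dots> = ?S" by simp
  also have "?S = (\<Sum>(k, m)\<in>pairs N. ?g m * (cmod (a k))\<^sup>2)"
    by (subst sum_pairs_shift) simp
  also have "\<dots> \<le> (\<Sum>(k, m)\<in>{- int N..int N} \<times> {- int N..int N}. ?g m * (cmod (a k))\<^sup>2)"
    by (rule sum_mono2) (auto simp: pairs_def)
  also have "\<dots> = (\<Sum>k = - int N..int N. \<bar>of_int k\<bar> * cmod (q k)) * (\<Sum>k = - int N..int N. (cmod (a k))\<^sup>2)"
    unfolding sum.cartesian_product[symmetric] sum_product by (rule sum.swap)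
  finally show ?thesis .
qed

section \<open>Rate of change of the energy\<close>

lemma norm_square_has_real_derivative:
  fixes a :: "real \<Rightarrow> complex"
  assumes "(a has_vector_derivative a') (at t within S)"
  shows "((\<lambda>t. (cmod (a t))\<^sup>2) has_real_derivative 2 * Re (cnj (a t) * a')) (at t within S)"
proof -
  define R I where "R = (\<lambda>t. Re (a t))" and "I = (\<lambda>t. Im (a t))"
  have "(R has_real_derivative Re a') (at t within S)" "(I has_real_derivative Im a') (at t within S)"
    unfolding R_def I_def has_real_derivative_iff_has_vector_derivative
    by (intro bounded_linear.has_vector_derivative[OF bounded_linear_Re assms]
        bounded_linear.has_vector_derivative[OF bounded_linear_Im assms])+
  then have "((\<lambda>t. (R t)\<^sup>2 + (I t)\<^sup>2) has_real_derivative
      2 * R t * Re a' + 2 * I t * Im a') (at t within S)"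
    by (auto intro!: derivative_eq_intros)
  then show ?thesis by (simp add: cmod_power2 algebra_simps R_def I_def)
qed

definition energy :: "nat \<Rightarrow> (int \<Rightarrow> complex) \<Rightarrow> real" where
  "energy N a = (\<Sum>k = - int N..int N. (cmod (a k))\<^sup>2)"

lemma energy_nonneg [simp]: "energy N a \<ge> 0"
  by (simp add: energy_def sum_nonneg)

lemma energy_eq_0D: "energy N a = 0 \<Longrightarrow> \<bar>k\<bar> \<le> int N \<Longrightarrow> a k = 0"
  by (simp add: energy_def sum_nonneg_eq_0_iff abs_le_iff minus_le_iff)

lemma norm_le_energy: "\<bar>k\<bar> \<le> int N \<Longrightarrow> (cmod (a k))\<^sup>2 \<le> energy N a"
  unfolding energy_def by (rule member_le_sum) auto

lemma energy_has_real_derivative: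
  assumes "\<And>k. \<bar>k\<bar> \<le> int N \<Longrightarrow> ((\<lambda>t. a t k) has_vector_derivative a' k) (at t within S)"
  shows "((\<lambda>t. energy N (a t)) has_real_derivative (\<Sum>k = - int N..int N. 2 * Re (cnj (a t k) * a' k))) (at t within S)"
  unfolding energy_def
  by (intro DERIV_sum norm_square_has_real_derivative assms) auto

text \<open>The factors \<alpha> and \<beta> cover the radially truncated system: scaling the
  argument by \<rho> multiplies the linear part by \<rho> and the quadratic part by \<rho>^2. The
  scheme itself has both equal to 1.\<close>

lemma energy_rate_neutral:
  assumes "hermitian a"
  shows "(\<Sum>k = - int N..int N. Re (cnj (a k) * (\<i> * omega k * a k * of_real \<alpha> - \<i> * of_int k / 2 * conv N a a k * of_real \<beta>))) = 0"
proof -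
  have "Re (cnj (a k) * (\<i> * omega k * a k * of_real \<alpha> - \<i> * of_int k / 2 * conv N a a k * of_real \<beta>))
     = \<beta> / 2 * Im (of_int k * cnj (a k) * conv N a a k)" for k
    by (simp add: field_simps)
  then have "(\<Sum>k = - int N..int N. Re (cnj (a k) * (\<i> * omega k * a k * of_real \<alpha> - \<i> * of_int k / 2 * conv N a a k * of_real \<beta>)))
     = \<beta> / 2 * Im (\<Sum>k = - int N..int N. of_int k * cnj (a k) * conv N a a k)"
    by (simp only: Im_sum sum_distrib_left)
  then show ?thesis
    using advection_self_neutral[OF assms, where N = N] by simp
qed

text \<open>The linear term is skew and the quadratic one neutral, so only the commutator with
  \<open>q\<close> and the forcing remain, for \<open>a\<close> of any size. The 1 in
  \<open>Q + 1\<close> comes from 2 Re (cnj a f) <= |a|^2 + |f|^2.\<close>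

lemma energy_rate_bound:
  assumes a: "hermitian a" and q: "hermitian q" and Q: "(\<Sum>k = - int N..int N. \<bar>of_int k\<bar> * cmod (q k)) \<le> Q"
  shows "(\<Sum>k = - int N..int N. 2 * Re (cnj (a k) *
      (\<i> * omega k * a k - \<i> * of_int k / 2 * (conv N a a k + 2 * conv N q a k) + f k)))
    \<le> (Q + 1) * energy N a + energy N f"
proof -
  have "2 * Re (cnj (a k) * (\<i> * omega k * a k - \<i> * of_int k / 2 * (conv N a a k + 2 * conv N q a k) + f k))
     = Im (of_int k * cnj (a k) * conv N a a k) + 2 * Im (of_int k * cnj (a k) * conv N q a k)
       + 2 * Re (cnj (a k) * f k)" for k
    by (simp add: field_simps)
  then have "(\<Sum>k = - int N..int N. 2 * Re (cnj (a k) *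
      (\<i> * omega k * a k - \<i> * of_int k / 2 * (conv N a a k + 2 * conv N q a k) + f k)))
    = Im (\<Sum>k = - int N..int N. of_int k * cnj (a k) * conv N a a k)
      + 2 * Im (\<Sum>k = - int N..int N. of_int k * cnj (a k) * conv N q a k)
      + (\<Sum>k = - int N..int N. 2 * Re (cnj (a k) * f k))"
    by (simp add: sum.distrib sum_distrib_left)
  also have "\<dots> \<le> 0 + Q * energy N a + (\<Sum>k = - int N..int N. (cmod (a k))\<^sup>2 + (cmod (f k))\<^sup>2)"
  proof (intro add_mono sum_mono)
    show "2 * Im (\<Sum>k = - int N..int N. of_int k * cnj (a k) * conv N q a k) \<le> Q * energy N a"
      using advection_commutator_bound[OF q, where N = N and a = a] mult_right_mono[OF Q energy_nonneg[of N a]]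
      by (simp add: energy_def)
    fix k
    have "2 * Re (cnj (a k) * f k) \<le> 2 * (cmod (a k) * cmod (f k))"
      using complex_Re_le_cmod[of "cnj (a k) * f k"] by (simp add: norm_mult)
    also have "\<dots> \<le> (cmod (a k))\<^sup>2 + (cmod (f k))\<^sup>2"
      using sum_squares_bound[of "cmod (a k)" "cmod (f k)"] by simp
    finally show "2 * Re (cnj (a k) * f k) \<le> (cmod (a k))\<^sup>2 + (cmod (f k))\<^sup>2" .
  qed (use advection_self_neutral[OF a] in simp)
  finally show ?thesis by (simp add: energy_def sum.distrib algebra_simps)
qed

section \<open>The semi-discrete system\<close>

definition kaw :: "nat \<Rightarrow> (int \<Rightarrow> complex) \<Rightarrow> int \<Rightarrow> complex" where
  "kaw N a k = \<i> * omega k * a k - \<i> * of_int k / 2 * conv N a a k"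

lemma omega_minus [simp]: "omega (- k) = - omega k"
  by (simp add: omega_def)

lemma at_within_atLeast_neq_bot:
  fixes t :: real
  assumes "t \<ge> 0"
  shows "at t within {0..} \<noteq> bot"
proof -
  have "at_right t \<le> at t within {0..}"
    using assms by (intro at_le) auto
  then show ?thesis
    using trivial_limit_at_right_real[of t] by (metis bot.extremum_uniqueI)
qed

section \<open>The scheme as a system for its Fourier coefficients\<close>

lemma sum_expi_equidistant:
  assumes "0 < n" "\<bar>m\<bar> < int n"
  shows "(\<Sum>j<n. expi m (2 * pi * real j / real n)) = (if m = 0 then of_nat n else 0)"
proof (cases "m = 0")
  case False
  define z where "z = cis (2 * pi * of_int m / real n)"
  have pow: "expi m (2 * pi * real j / real n) = z ^ j" for j
    by (simp add: z_def expi_cis Complex.DeMoivre mult_ac)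
  have "z ^ n = cis (2 * pi * of_int m)"
    using assms by (simp add: z_def Complex.DeMoivre)
  then have "z ^ n = 1" by (simp add: cis_multiple_2pi)
  moreover have "z \<noteq> 1"
  proof
    assume "z = 1"
    then have "cos (2 * pi * of_int m / real n) = 1" by (simp add: z_def complex_eq_iff)
    then obtain i :: int where i: "2 * pi * of_int m / real n = of_int i * 2 * pi"
      unfolding cos_one_2pi_int by blast
    then have "real_of_int m = of_int (i * int n)"
      using assms by (simp add: field_simps)
    then have "m = i * int n" by (simp only: of_int_eq_iff)
    then show False using assms False
      by (metis abs_mult abs_of_nat dual_order.strict_iff_not mult_cancel_right1 mult_le_cancel_right1
          mult_zero_left not_le of_nat_0_less_iff zero_less_abs_iff zless_imp_add1_zle add_0)
  qed
  ultimately show ?thesis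
    using False by (simp add: pow geometric_sum)
qed simp

text \<open>On 2N + 1 nodes the trapezoidal rule is exact here, all frequency differences being at
  most 2N. It expresses a coefficient by finitely many point values, which lets the pointwise time
  derivative of \<open>U\<close> pass to the coefficients.\<close>

lemma fourier_quadrature:
  assumes "f \<in> trig_space N" "\<bar>k\<bar> \<le> int N"
  defines "n \<equiv> 2 * N + 1"
  shows "fourier f k = (\<Sum>j<n. f (2 * pi * real j / real n) * expi (- k) (2 * pi * real j / real n)) / of_nat n"
proof -
  define c where "c = fourier f"
  have f: "f = trig_poly N c"
    unfolding c_def by (rule trig_space_cases) fact
  let ?x = "\<lambda>j. 2 * pi * real j / real n"
  have "(\<Sum>j<n. f (?x j) * expi (- k) (?x j)) = (\<Sum>j<n. \<Sum>l = - int N..int N. c l * expi (l - k) (?x j))"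
    by (simp add: f trig_poly_def sum_distrib_right mult.assoc flip: expi_add)
  also have "\<dots> = (\<Sum>l = - int N..int N. c l * (\<Sum>j<n. expi (l - k) (?x j)))"
    by (subst sum.swap) (simp add: sum_distrib_left)
  also have "\<dots> = (\<Sum>l = - int N..int N. c l * (if l - k = 0 then of_nat n else 0))"
    using assms(2) by (intro sum.cong refl arg_cong2[where f = "(*)"] sum_expi_equidistant)
      (auto simp: n_def)
  also have "\<dots> = c k * of_nat n"
    using assms(2) by (auto simp: if_distrib[of "\<lambda>x. c _ * x"] abs_le_iff minus_le_iff cong: if_cong)
  finally show ?thesis by (simp add: c_def n_def del: of_nat_Suc of_nat_add)
qed

lemma fourier_galerkin_residual:
  assumes "\<bar>k\<bar> \<le> int N"
  shows "fourier (\<lambda>x. trig_poly N b x + trig_poly N a x * dx (trig_poly N a) x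
       + (dx ^^ 3) (trig_poly N a) x - (dx ^^ 5) (trig_poly N a) x) k = b k - kaw N a k"
proof -
  have int: "integrable circ (\<lambda>x. trig_poly N a x * dx (trig_poly N a) x)"
    by (intro integrable_circ_continuous continuous_intros)
       (simp add: dx_trig_poly continuous_on_trig_poly)
  have "(\<i> * of_int k) ^ 3 = - (\<i> * of_int (k ^ 3))" "(\<i> * of_int k) ^ 5 = \<i> * of_int (k ^ 5)"
  proof -
    have "\<i> ^ 3 = - \<i>" "\<i> ^ 5 = \<i>" by (simp_all add: eval_nat_numeral)
    then show "(\<i> * of_int k) ^ 3 = - (\<i> * of_int (k ^ 3))" "(\<i> * of_int k) ^ 5 = \<i> * of_int (k ^ 5)"
      by (simp_all add: power_mult_distrib)
  qed
  then show ?thesis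
    using assms
    by (simp add: fourier_add fourier_diff int dx_power_trig_poly fourier_trig_poly
        fourier_advection_trig_poly kaw_def omega_def algebra_simps del: of_int_power)
qed

lemma integrable_galerkin_residual:
  "integrable circ (\<lambda>x. trig_poly N b x + trig_poly N a x * dx (trig_poly N a) x
       + (dx ^^ 3) (trig_poly N a) x - (dx ^^ 5) (trig_poly N a) x)"
  unfolding dx_power_trig_poly dx_trig_poly
  by (intro integrable_circ_continuous continuous_intros)

lemma trig_poly_time_derivative:
  assumes "\<And>k. \<bar>k\<bar> \<le> int N \<Longrightarrow> ((\<lambda>s. a s k) has_vector_derivative b k) F"
  shows "((\<lambda>s. trig_poly N (a s) x) has_vector_derivative trig_poly N b x) F"
  unfolding trig_poly_def
  by (intro has_vector_derivative_sum has_vector_derivative_mult_left assms) auto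

lemma galerkin_solution_coeffs:
  assumes gal: "galerkin_solution N u0 U" and u0: "integrable circ u0"
  obtains a where "\<And>t. t \<ge> 0 \<Longrightarrow> U t = trig_poly N (a t)"
    and "\<And>t. t \<ge> 0 \<Longrightarrow> hermitian (a t)"
    and "\<And>k. \<bar>k\<bar> \<le> int N \<Longrightarrow> a 0 k = fourier u0 k"
    and "\<And>t k. t \<ge> 0 \<Longrightarrow> \<bar>k\<bar> \<le> int N \<Longrightarrow>
      ((\<lambda>t. a t k) has_vector_derivative kaw N (a t) k) (at t within {0..})"
proof -
  obtain Ut where U: "\<And>t. t \<ge> 0 \<Longrightarrow> U t \<in> trig_space N" "\<And>t. t \<ge> 0 \<Longrightarrow> real_valued (U t)"
    and U0: "U 0 = trig_proj N u0"
    and Ut: "\<And>t x. t \<ge> 0 \<Longrightarrow> ((\<lambda>s. U s x) has_vector_derivative Ut t x) (at t within {0..})"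
    and eq: "\<And>t \<phi>. t \<ge> 0 \<Longrightarrow> \<phi> \<in> trig_space N \<Longrightarrow>
       l2_inner (\<lambda>x. Ut t x + U t x * dx (U t) x + (dx ^^ 3) (U t) x - (dx ^^ 5) (U t) x) \<phi> = 0"
    using gal unfolding galerkin_solution_def by blast
  define a where "a t = fourier (U t)" for t
  have Ua: "U t = trig_poly N (a t)" if "t \<ge> 0" for t
    unfolding a_def by (intro trig_space_cases U that)
  have herm: "hermitian (a t)" if "t \<ge> 0" for t
    unfolding a_def hermitian_def using fourier_real_valued U(2)[OF that] by blast
  have init: "a 0 k = fourier u0 k" if "\<bar>k\<bar> \<le> int N" for k
    using that by (simp add: a_def U0 trig_proj_eq[OF u0] fourier_trig_poly)
  have deriv: "((\<lambda>t. a t k) has_vector_derivative kaw N (a t) k) (at t within {0..})"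
    if t: "t \<ge> 0" and k: "\<bar>k\<bar> \<le> int N" for t k
  proof -
    define n where "n = 2 * N + 1"
    \<comment> \<open>\<open>Ut t\<close> is not assumed to be a trigonometric polynomial; these are
      the coefficients that quadrature dictates.\<close>
    define b where "b k = (\<Sum>j<n. Ut t (2 * pi * real j / real n) * expi (- k) (2 * pi * real j / real n)) / of_nat n" for k
    have der: "((\<lambda>s. a s k) has_vector_derivative b k) (at t within {0..})" if "\<bar>k\<bar> \<le> int N" for k
    proof (rule has_vector_derivative_transform[where f = "\<lambda>s.
        (\<Sum>j<n. U s (2 * pi * real j / real n) * expi (- k) (2 * pi * real j / real n)) / of_nat n"])
      show "((\<lambda>s. (\<Sum>j<n. U s (2 * pi * real j / real n) * expi (- k) (2 * pi * real j / real n)) / of_nat n)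
         has_vector_derivative b k) (at t within {0..})"
        unfolding b_def
        by (intro has_vector_derivative_divide has_vector_derivative_sum has_vector_derivative_mult_left Ut t)
      show "a s k = (\<Sum>j<n. U s (2 * pi * real j / real n) * expi (- k) (2 * pi * real j / real n)) / of_nat n"
        if "s \<in> {0..}" for s
        using fourier_quadrature[OF U(1) \<open>\<bar>k\<bar> \<le> int N\<close>, of s] that by (simp only: a_def n_def atLeast_iff)
    qed (use t in auto)
    \<comment> \<open>Uniqueness of one-sided derivatives places \<open>Ut t\<close> in the
      trigonometric space.\<close>
    have "Ut t x = trig_poly N b x" for x
    proof (rule vector_derivative_unique_within[OF at_within_atLeast_neq_bot[OF t]])
      show "((\<lambda>s. U s x) has_vector_derivative Ut t x) (at t within {0..})" by (rule Ut[OF t])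
      have "((\<lambda>s. trig_poly N (a s) x) has_vector_derivative trig_poly N b x) (at t within {0..})"
        by (rule trig_poly_time_derivative[OF der])
      then show "((\<lambda>s. U s x) has_vector_derivative trig_poly N b x) (at t within {0..})"
        by (rule has_vector_derivative_transform[rotated -1]) (use t Ua in auto)
    qed
    then have "\<forall>\<phi>\<in>trig_space N. l2_inner (\<lambda>x. trig_poly N b x + trig_poly N (a t) x * dx (trig_poly N (a t)) x
         + (dx ^^ 3) (trig_poly N (a t)) x - (dx ^^ 5) (trig_poly N (a t)) x) \<phi> = 0"
      using eq[OF t] by (simp add: Ua[OF t])
    then have "b k = kaw N (a t) k"
      using k by (simp add: l2_inner_trig_space_eq_0_iff integrable_galerkin_residual fourier_galerkin_residual)
    then show "((\<lambda>t. a t k) has_vector_derivative kaw N (a t) k) (at t within {0..})"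
      using der[OF k] by simp
  qed
  from Ua herm init deriv show ?thesis by (rule that)
qed

lemma galerkin_solutionI:
  assumes herm: "\<And>t. t \<ge> 0 \<Longrightarrow> hermitian (a t)"
    and init: "\<And>k. \<bar>k\<bar> \<le> int N \<Longrightarrow> a 0 k = fourier u0 k"
    and der: "\<And>t k. t \<ge> 0 \<Longrightarrow> \<bar>k\<bar> \<le> int N \<Longrightarrow>
      ((\<lambda>t. a t k) has_vector_derivative kaw N (a t) k) (at t within {0..})"
    and u0: "integrable circ u0"
  shows "galerkin_solution N u0 (\<lambda>t. trig_poly N (a t))"
  unfolding galerkin_solution_def
proof (intro conjI exI[of _ "\<lambda>t. trig_poly N (kaw N (a t))"] allI impI)
  fix t :: real assume t: "t \<ge> 0"
  show "real_valued (trig_poly N (a t))"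
    using herm[OF t] by (intro real_valued_trig_poly hermitianD)
  show "((\<lambda>s. trig_poly N (a s) x) has_vector_derivative trig_poly N (kaw N (a t)) x) (at t within {0..})" for x
    using der[OF t] by (rule trig_poly_time_derivative)
  show "\<forall>\<phi>\<in>trig_space N. l2_inner (\<lambda>x. trig_poly N (kaw N (a t)) x
       + trig_poly N (a t) x * dx (trig_poly N (a t)) x
       + (dx ^^ 3) (trig_poly N (a t)) x - (dx ^^ 5) (trig_poly N (a t)) x) \<phi> = 0"
    by (simp add: l2_inner_trig_space_eq_0_iff integrable_galerkin_residual fourier_galerkin_residual)
next
  show "trig_poly N (a 0) = trig_proj N u0"
    unfolding trig_proj_eq[OF u0] by (rule trig_poly_cong) (rule init)
qed simp

section \<open>Energy bound and uniqueness for the scheme\<close>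

lemma galerkin_energy_conserved:
  assumes herm: "\<And>t. t \<ge> 0 \<Longrightarrow> hermitian (a t)"
    and der: "\<And>t k. t \<ge> 0 \<Longrightarrow> \<bar>k\<bar> \<le> int N \<Longrightarrow>
      ((\<lambda>t. a t k) has_vector_derivative kaw N (a t) k) (at t within {0..})"
    and t: "t \<ge> 0"
  shows "energy N (a t) \<le> energy N (a 0)"
proof -
  have "energy N (a t) \<le> (energy N (a 0) + 0 * t) * exp (0 * t)"
  proof (rule gronwall)
    show "((\<lambda>t. energy N (a t)) has_real_derivative
        (\<Sum>k = - int N..int N. 2 * Re (cnj (a s k) * kaw N (a s) k))) (at s within {0..})"
      if "s \<in> {0..t}" for s
      using that by (intro energy_has_real_derivative der) auto
    show "(\<Sum>k = - int N..int N. 2 * Re (cnj (a s k) * kaw N (a s) k)) \<le> 0 * energy N (a s) + 0"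
      if "s \<in> {0..t}" for s
      using energy_rate_neutral[OF herm, where N = N and \<alpha> = 1 and \<beta> = 1, of s] that
      by (simp add: kaw_def sum_distrib_left[symmetric] del: times_complex.sel minus_complex.sel)
  qed (use t in auto)
  then show ?thesis by simp
qed

text \<open>An exact expansion around \<open>b\<close>. The quadratic term \<open>conv N e e\<close>
  is kept separate because it drops out of the energy balance of \<open>e\<close>.\<close>

lemma kaw_diff:
  "kaw N (\<lambda>k. b k + e k) k - kaw N b k
     = \<i> * omega k * e k - \<i> * of_int k / 2 * (conv N e e k + 2 * conv N b e k)"
  unfolding kaw_def conv_add_left conv_add_right conv_commute[of N e b]
  by (simp add: algebra_simps)

theorem galerkin_unique:
  assumes V: "galerkin_solution N u0 V" and W: "galerkin_solution N u0 W"
    and u0: "integrable circ u0" and t: "t \<ge> 0"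
  shows "V t = W t"
proof -
  obtain a where a: "\<And>t. t \<ge> 0 \<Longrightarrow> V t = trig_poly N (a t)" "\<And>t. t \<ge> 0 \<Longrightarrow> hermitian (a t)"
      "\<And>k. \<bar>k\<bar> \<le> int N \<Longrightarrow> a 0 k = fourier u0 k"
      "\<And>t k. t \<ge> 0 \<Longrightarrow> \<bar>k\<bar> \<le> int N \<Longrightarrow>
        ((\<lambda>t. a t k) has_vector_derivative kaw N (a t) k) (at t within {0..})"
    using galerkin_solution_coeffs[OF V u0] by blast
  obtain b where b: "\<And>t. t \<ge> 0 \<Longrightarrow> W t = trig_poly N (b t)" "\<And>t. t \<ge> 0 \<Longrightarrow> hermitian (b t)"
      "\<And>k. \<bar>k\<bar> \<le> int N \<Longrightarrow> b 0 k = fourier u0 k"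
      "\<And>t k. t \<ge> 0 \<Longrightarrow> \<bar>k\<bar> \<le> int N \<Longrightarrow>
        ((\<lambda>t. b t k) has_vector_derivative kaw N (b t) k) (at t within {0..})"
    using galerkin_solution_coeffs[OF W u0] by blast
  define e where "e t k = a t k - b t k" for t k
  have e_herm: "hermitian (e t)" if "t \<ge> 0" for t
    using a(2)[OF that] b(2)[OF that] by (simp add: hermitian_def e_def)
  \<comment> \<open>A crude bound depending on \<open>N\<close>, obtained from the energy bound on
    each coefficient of \<open>b\<close>; at fixed \<open>N\<close> it is enough.\<close>
  define Q where "Q = (\<Sum>k = - int N..int N. \<bar>of_int k\<bar> * sqrt (energy N (b 0)))"
  have Q: "(\<Sum>k = - int N..int N. \<bar>of_int k\<bar> * cmod (b s k)) \<le> Q" if s: "s \<ge> 0" for s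
    unfolding Q_def
  proof (intro sum_mono mult_left_mono)
    fix k assume k: "k \<in> {- int N..int N}"
    have "(cmod (b s k))\<^sup>2 \<le> energy N (b s)"
      using k by (intro norm_le_energy) auto
    also have "\<dots> \<le> energy N (b 0)"
      by (rule galerkin_energy_conserved) (use b s in auto)
    finally show "cmod (b s k) \<le> sqrt (energy N (b 0))"
      by (simp add: real_le_rsqrt)
  qed simp
  have "0 \<le> Q" by (auto simp: Q_def intro!: sum_nonneg)
  define e' where "e' s k = \<i> * omega k * e s k - \<i> * of_int k / 2 * (conv N (e s) (e s) k + 2 * conv N (b s) (e s) k)" for s k
  have der: "((\<lambda>t. e t k) has_vector_derivative e' s k) (at s within {0..})"
    if "s \<ge> 0" "\<bar>k\<bar> \<le> int N" for s k
  proof -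
    have "((\<lambda>t. e t k) has_vector_derivative kaw N (a s) k - kaw N (b s) k) (at s within {0..})"
      unfolding e_def using that by (intro has_vector_derivative_diff a b)
    moreover have "kaw N (a s) k - kaw N (b s) k = e' s k"
      using kaw_diff[of N "b s" "e s" k] by (simp add: e_def e'_def)
    ultimately show ?thesis by simp
  qed
  have "energy N (e t) \<le> (energy N (e 0) + 0 * t) * exp ((Q + 1) * t)"
  proof (rule gronwall)
    show "((\<lambda>t. energy N (e t)) has_real_derivative
        (\<Sum>k = - int N..int N. 2 * Re (cnj (e s k) * e' s k))) (at s within {0..})" if "s \<in> {0..t}" for s
      using that by (intro energy_has_real_derivative der) auto
    show "(\<Sum>k = - int N..int N. 2 * Re (cnj (e s k) * e' s k)) \<le> (Q + 1) * energy N (e s) + 0"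
      if "s \<in> {0..t}" for s
    proof -
      have s: "s \<ge> 0" using that by simp
      show ?thesis
        using energy_rate_bound[OF e_herm[OF s] b(2)[OF s] Q[OF s], where f = "\<lambda>_. 0"]
        by (simp add: e'_def energy_def[of N "\<lambda>_. 0"])
    qed
  qed (use t \<open>0 \<le> Q\<close> in auto)
  moreover have "energy N (e 0) = 0"
    using a(3) b(3) by (auto simp: energy_def e_def intro!: sum.neutral)
  ultimately have "energy N (e t) = 0"
    using energy_nonneg[of N "e t"] by simp
  then have "a t k = b t k" if "\<bar>k\<bar> \<le> int N" for k
    using energy_eq_0D[OF _ that, of "e t"] by (simp add: e_def)
  then have "trig_poly N (a t) = trig_poly N (b t)"
    by (rule trig_poly_cong)
  then show ?thesis using a(1)[OF t] b(1)[OF t] by simp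
qed

section \<open>Global existence for the scheme\<close>

text \<open>Bounded sequences indexed by \<^typ>\<open>int\<close> serve as a Banach space containing the coefficient
  vectors for every \<open>N\<close>; the library proves completeness of the space of bounded continuous
  functions for metric domains only.\<close>

instantiation int :: metric_space
begin

definition dist_int :: "int \<Rightarrow> int \<Rightarrow> real" where
  "dist_int m n = \<bar>of_int m - of_int n\<bar>"

definition uniformity_int :: "(int \<times> int) filter" where
  "uniformity_int = (INF e\<in>{0 <..}. principal {(x, y). dist x y < e})"

instance
proof
  show "uniformity = (INF e\<in>{0 <..}. principal {(x::int, y). dist x y < e})"
    by (rule uniformity_int_def)
  show "open U \<longleftrightarrow> (\<forall>x\<in>U. \<forall>\<^sub>F (x', y) in uniformity. x' = x \<longrightarrow> y \<in> U)" for U :: "int set"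
  proof -
    have "\<forall>\<^sub>F (x', y) in uniformity. x' = x \<longrightarrow> y \<in> U" if "x \<in> U" for x
      unfolding uniformity_int_def
      by (rule eventually_INF1[of 1]) (use that in \<open>auto simp: eventually_principal dist_int_def simp flip: of_int_diff of_int_abs\<close>)
    then show ?thesis by (simp add: open_discrete)
  qed
qed (auto simp: dist_int_def)

end

instance bcontfun :: (metric_space, banach) banach ..

lemma conv_self_diff_bound:
  assumes "\<And>j. \<bar>j\<bar> \<le> int N \<Longrightarrow> cmod (a j) \<le> R" "\<And>j. \<bar>j\<bar> \<le> int N \<Longrightarrow> cmod (b j) \<le> R"
    and "\<And>j. \<bar>j\<bar> \<le> int N \<Longrightarrow> cmod (a j - b j) \<le> \<delta>"
  shows "cmod (conv N a a k - conv N b b k) \<le> (2 * real N + 1) * (2 * R * \<delta>)"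
proof -
  have R: "0 \<le> R" and \<delta>: "0 \<le> \<delta>"
    using assms(1)[of 0] assms(3)[of 0] by (auto intro: order_trans[OF norm_ge_zero])
  have "conv N a a k - conv N b b k = (\<Sum>j\<in>modes N k. (a j - b j) * a (k - j) + b j * (a (k - j) - b (k - j)))"
    by (simp add: conv_modes algebra_simps flip: sum_subtractf)
  also have "cmod \<dots> \<le> (\<Sum>j\<in>modes N k. 2 * R * \<delta>)"
  proof (rule sum_norm_le)
    fix j assume "j \<in> modes N k"
    then have "\<bar>j\<bar> \<le> int N" "\<bar>k - j\<bar> \<le> int N" by (auto simp: modes_def)
    then have "cmod ((a j - b j) * a (k - j)) \<le> \<delta> * R" "cmod (b j * (a (k - j) - b (k - j))) \<le> R * \<delta>"
      unfolding norm_mult using assms R \<delta> by (auto intro!: mult_mono)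
    then have "cmod ((a j - b j) * a (k - j) + b j * (a (k - j) - b (k - j))) \<le> \<delta> * R + R * \<delta>"
      by (rule norm_triangle_mono)
    then show "cmod ((a j - b j) * a (k - j) + b j * (a (k - j) - b (k - j))) \<le> 2 * R * \<delta>"
      by (simp only: mult.commute[of \<delta> R] mult.assoc mult_2 distrib_right)
  qed
  also have "\<dots> = real (card (modes N k)) * (2 * R * \<delta>)" by simp
  also have "\<dots> \<le> (2 * real N + 1) * (2 * R * \<delta>)"
  proof (intro mult_right_mono)
    have "card (modes N k) \<le> card {- int N..int N}"
      by (intro card_mono modes_subset) simp
    then show "real (card (modes N k)) \<le> 2 * real N + 1"
      by (simp add: nat_add_distrib)
  qed (use R \<delta> in auto)
  finally show ?thesis .
qed

text \<open>The vector field is made globally Lipschitz by radial truncation. Multiplying the argument by a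
  positive scalar does not affect the conservation of energy, so solutions of the truncated system
  never leave the ball on which it agrees with the original one.\<close>

theorem galerkin_exists:
  assumes u0: "integrable circ u0" "real_valued u0"
  obtains U where "galerkin_solution N u0 U"
proof -
  define x0 where "x0 k = (if \<bar>k\<bar> \<le> int N then fourier u0 k else 0)" for k
  \<comment> \<open>The summand 1 makes \<open>R\<close> positive when the initial energy
    vanishes.\<close>
  define R where "R = sqrt (energy N x0) + 1"
  have R: "R > 0" by (simp add: R_def add_nonneg_pos)
  \<comment> \<open>Retraction to the ball of radius \<open>R\<close>, followed by projection onto
    hermitian sequences. The projection makes the vector field hermitian at every point of the
    space.\<close>
  define sat :: "(int \<Rightarrow>\<^sub>C complex) \<Rightarrow> int \<Rightarrow> complex" where
    "sat x k = (let y = (R / max R (norm x)) *\<^sub>R x in (apply_bcontfun y k + cnj (apply_bcontfun y (- k))) / 2)" for x k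
  have herm: "hermitian (sat x)" for x
    by (simp add: hermitian_def sat_def Let_def add.commute)
  have avg: "cmod ((z + cnj w) / 2) \<le> c" if "cmod z \<le> c" "cmod w \<le> c" for z w c
    using norm_triangle_ineq[of z "cnj w"] that by simp
  have sat_le: "cmod (sat x k) \<le> R" for x k
  proof -
    have "norm ((R / max R (norm x)) *\<^sub>R x) = R / max R (norm x) * norm x"
      using R by simp
    also have "\<dots> \<le> R" using R by (simp add: field_simps)
    finally show ?thesis
      unfolding sat_def Let_def
      by (intro avg order_trans[OF norm_bounded])
  qed
  have sat_diff: "cmod (sat x k - sat y k) \<le> 2 * norm (x - y)" for x y k
  proof -
    define p q where "p = (R / max R (norm x)) *\<^sub>R x" and "q = (R / max R (norm y)) *\<^sub>R y"
    have "norm (p - q) \<le> 2 * norm (x - y)"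
      unfolding p_def q_def by (rule radial_retraction_lipschitz[OF R])
    moreover have "sat x k - sat y k = (apply_bcontfun (p - q) k + cnj (apply_bcontfun (p - q) (- k))) / 2"
      by (simp add: sat_def Let_def p_def q_def minus_bcontfun.rep_eq diff_divide_distrib add_divide_distrib)
    moreover have "cmod ((apply_bcontfun (p - q) k + cnj (apply_bcontfun (p - q) (- k))) / 2) \<le> norm (p - q)"
      by (intro avg norm_bounded)
    ultimately show ?thesis by (metis order.trans)
  qed
  \<comment> \<open>The cutoff freezes the modes beyond \<open>N\<close> at their initial value 0
    and makes the field a bounded sequence.\<close>
  define f where "f x k = (if \<bar>k\<bar> \<le> int N then kaw N (sat x) k else 0)" for x k
  define L where "L = (\<Sum>k = - int N..int N. \<bar>omega k\<bar> + \<bar>of_int k\<bar> * ((2 * real N + 1) * R))"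
  have f_diff: "cmod (f x k - f y k) \<le> L * (2 * norm (x - y))" for x y k
  proof (cases "\<bar>k\<bar> \<le> int N")
    case True
    have "kaw N (sat x) k - kaw N (sat y) k = \<i> * omega k * (sat x k - sat y k)
        - \<i> * of_int k / 2 * (conv N (sat x) (sat x) k - conv N (sat y) (sat y) k)"
      by (simp add: kaw_def algebra_simps)
    also have "cmod \<dots> \<le> \<bar>omega k\<bar> * (2 * norm (x - y))
        + \<bar>of_int k\<bar> / 2 * ((2 * real N + 1) * (2 * R * (2 * norm (x - y))))"
    proof (intro order_trans[OF norm_triangle_ineq4] add_mono)
      show "cmod (\<i> * omega k * (sat x k - sat y k)) \<le> \<bar>omega k\<bar> * (2 * norm (x - y))"
        using sat_diff[of x k y] by (simp add: norm_mult mult_left_mono)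
      have "cmod (\<i> * of_int k / 2 * z) = \<bar>of_int k\<bar> / 2 * cmod z" for z
        by (simp add: norm_mult norm_divide)
      then show "cmod (\<i> * of_int k / 2 * (conv N (sat x) (sat x) k - conv N (sat y) (sat y) k))
          \<le> \<bar>of_int k\<bar> / 2 * ((2 * real N + 1) * (2 * R * (2 * norm (x - y))))"
        using conv_self_diff_bound[of N "sat x" R "sat y" "2 * norm (x - y)" k, OF sat_le sat_le sat_diff]
        by (simp only:) (intro mult_left_mono, auto)
    qed
    also have "\<dots> = (\<bar>omega k\<bar> + \<bar>of_int k\<bar> * ((2 * real N + 1) * R)) * (2 * norm (x - y))"
      by (simp add: algebra_simps)
    also have "\<dots> \<le> L * (2 * norm (x - y))"
    proof (rule mult_right_mono)
      show "\<bar>omega k\<bar> + \<bar>of_int k\<bar> * ((2 * real N + 1) * R) \<le> L"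
        unfolding L_def using True R
        by (intro member_le_sum[where f = "\<lambda>k. \<bar>omega k\<bar> + \<bar>of_int k\<bar> * ((2 * real N + 1) * R)"]) auto
    qed simp
    finally show ?thesis using True by (simp add: f_def)
  next
    case False
    have "0 \<le> L" using R by (auto simp: L_def intro!: sum_nonneg)
    with False show ?thesis by (simp add: f_def)
  qed
  have f_bcontfun: "f x \<in> bcontfun" for x
  proof (rule bcontfun_normI)
    fix k
    have "cmod (f 0 k) = 0"
      by (simp add: f_def kaw_def sat_def conv_modes zero_bcontfun.rep_eq)
    then show "norm (f x k) \<le> L * (2 * norm (x - 0))"
      using f_diff[of x k 0] by simp
  qed simp
  define F where "F x = Bcontfun (f x)" for x
  have F: "apply_bcontfun (F x) = f x" for x
    by (simp add: F_def Bcontfun_inverse f_bcontfun)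
  have "norm (F x - F y) \<le> (2 * L) * norm (x - y)" for x y
    using f_diff[of x _ y] by (intro norm_bound) (simp add: minus_bcontfun.rep_eq F mult_ac)
  then obtain x where x_0: "x 0 = Bcontfun x0"
    and x: "\<And>t. t \<ge> 0 \<Longrightarrow> (x has_vector_derivative F (x t)) (at t within {0..})"
    using lipschitz_ode_global_solution[of F "2 * L" "Bcontfun x0"] by blast
  define a where "a t = apply_bcontfun (x t)" for t
  have x0: "x0 \<in> bcontfun"
  proof (rule bcontfun_normI)
    show "norm (x0 k) \<le> R" for k
    proof (cases "\<bar>k\<bar> \<le> int N")
      case True
      then have "cmod (x0 k) \<le> sqrt (energy N x0)"
        using norm_le_energy by (intro real_le_rsqrt) auto
      then show ?thesis by (simp add: R_def)
    qed (use R in \<open>simp add: x0_def\<close>)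
  qed simp
  have a_0: "a 0 = x0" by (simp add: a_def x_0 Bcontfun_inverse x0)
  have a_der: "((\<lambda>t. a t k) has_vector_derivative f (x t) k) (at t within {0..})" if "t \<ge> 0" for t k
  proof -
    have "bounded_linear (\<lambda>y::int \<Rightarrow>\<^sub>C complex. apply_bcontfun y k)"
      by (rule bounded_linear_intro[of _ 1])
         (auto simp: plus_bcontfun.rep_eq scaleR_bcontfun.rep_eq norm_bounded)
    from bounded_linear.has_vector_derivative[OF this x[OF that]] show ?thesis
      by (simp add: a_def F)
  qed
  have f_herm: "hermitian (f y)" for y
    using hermitianD[OF herm] conv_hermitian[OF herm herm]
    by (simp add: hermitian_def f_def kaw_def)
  have x0_herm: "hermitian x0"
    using fourier_real_valued[OF u0(2)] by (simp add: hermitian_def x0_def)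
  have a_herm: "hermitian (a t)" if t: "t \<ge> 0" for t
    unfolding hermitian_def
  proof
    fix k
    \<comment> \<open>As the field is hermitian everywhere, the defect of symmetry is constant along
      any solution.\<close>
    have "((\<lambda>t. a t (- k) - cnj (a t k)) has_vector_derivative 0) (at s within {0..})" if s: "s \<in> {0..}" for s
    proof -
      have "((\<lambda>t. a t (- k) - cnj (a t k)) has_vector_derivative f (x s) (- k) - cnj (f (x s) k)) (at s within {0..})"
        using s by (intro has_vector_derivative_diff has_vector_derivative_cnj a_der) auto
      then show ?thesis by (simp add: hermitianD[OF f_herm])
    qed
    then obtain c where c: "\<And>t. t \<in> {0..} \<Longrightarrow> a t (- k) - cnj (a t k) = c"
      using has_vector_derivative_zero_constant[of "{0..}" "\<lambda>t. a t (- k) - cnj (a t k)"] by auto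
    have "c = 0" using c[of 0] by (simp add: a_0 hermitianD[OF x0_herm])
    then show "a t (- k) = cnj (a t k)" using c[of t] t by simp
  qed
  have a_outside: "a t k = 0" if t: "t \<ge> 0" and k: "\<not> \<bar>k\<bar> \<le> int N" for t k
  proof -
    have "((\<lambda>t. a t k) has_vector_derivative 0) (at s within {0..})" if "s \<in> {0..}" for s
      using a_der[of s k] that k by (simp add: f_def)
    then obtain c where c: "\<And>t. t \<in> {0..} \<Longrightarrow> a t k = c"
      using has_vector_derivative_zero_constant[of "{0..}" "\<lambda>t. a t k"] by auto
    show ?thesis using c[of 0] c[of t] t k by (simp add: a_0 x0_def)
  qed
  \<comment> \<open>On hermitian sequences the projection in \<open>sat\<close> is the identity, so
    truncation is multiplication by this scalar.\<close>
  define \<rho> where "\<rho> t = R / max R (norm (x t))" for t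
  have sat_a: "sat (x t) k = of_real (\<rho> t) * a t k" if "t \<ge> 0" for t k
    using hermitianD[OF a_herm[OF that], of k]
    by (simp add: sat_def Let_def \<rho>_def a_def scaleR_bcontfun.rep_eq scaleR_conv_of_real)
  have energy_le: "energy N (a t) \<le> energy N x0" if t: "t \<ge> 0" for t
  proof -
    have "energy N (a t) \<le> (energy N (a 0) + 0 * t) * exp (0 * t)"
    proof (rule gronwall)
      show "((\<lambda>t. energy N (a t)) has_real_derivative
          (\<Sum>k = - int N..int N. 2 * Re (cnj (a s k) * f (x s) k))) (at s within {0..})"
        if "s \<in> {0..t}" for s
        using that by (intro energy_has_real_derivative a_der) auto
      show "(\<Sum>k = - int N..int N. 2 * Re (cnj (a s k) * f (x s) k)) \<le> 0 * energy N (a s) + 0"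
        if "s \<in> {0..t}" for s
      proof -
        have s: "s \<ge> 0" using that by simp
        have "sat (x s) = (\<lambda>k. of_real (\<rho> s) * a s k)"
          using sat_a[OF s] by auto
        then have "f (x s) k = \<i> * omega k * a s k * of_real (\<rho> s)
            - \<i> * of_int k / 2 * conv N (a s) (a s) k * of_real ((\<rho> s)\<^sup>2)" if "k \<in> {- int N..int N}" for k
          using that by (auto simp: f_def kaw_def conv_scale)
        then have "(\<Sum>k = - int N..int N. 2 * Re (cnj (a s k) * f (x s) k))
          = 2 * (\<Sum>k = - int N..int N. Re (cnj (a s k) * (\<i> * omega k * a s k * of_real (\<rho> s)
            - \<i> * of_int k / 2 * conv N (a s) (a s) k * of_real ((\<rho> s)\<^sup>2))))"
          unfolding sum_distrib_left by (intro sum.cong refl) simp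
        then show ?thesis
          using energy_rate_neutral[OF a_herm[OF s], where N = N and \<alpha> = "\<rho> s" and \<beta> = "(\<rho> s)\<^sup>2"] by simp
      qed
    qed (use t in auto)
    then show ?thesis by (simp add: a_0)
  qed
  \<comment> \<open>The supremum norm is at most the square root of the energy, so the truncation
    never acts on this solution.\<close>
  have x_le: "norm (x t) \<le> R" if t: "t \<ge> 0" for t
  proof (rule norm_bound)
    fix k
    show "norm (apply_bcontfun (x t) k) \<le> R"
    proof (cases "\<bar>k\<bar> \<le> int N")
      case True
      then have "(cmod (a t k))\<^sup>2 \<le> energy N x0"
        using norm_le_energy[of k N "a t"] energy_le[OF t] by simp
      then have "cmod (a t k) \<le> sqrt (energy N x0)"
        by (rule real_le_rsqrt)
      then show ?thesis by (simp add: R_def a_def)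
    qed (use a_outside[OF t, of k] R in \<open>simp add: a_def\<close>)
  qed
  have "galerkin_solution N u0 (\<lambda>t. trig_poly N (a t))"
  proof (rule galerkin_solutionI[OF a_herm _ _ u0(1)])
    show "((\<lambda>t. a t k) has_vector_derivative kaw N (a t) k) (at t within {0..})"
      if "t \<ge> 0" "\<bar>k\<bar> \<le> int N" for t k
    proof -
      have "\<rho> t = 1" using x_le[OF that(1)] R by (simp add: \<rho>_def)
      then have "sat (x t) = a t" using sat_a[OF that(1)] by auto
      then show ?thesis using a_der[OF that(1), of k] that(2) by (simp add: f_def)
    qed
  qed (simp_all add: a_0 x0_def)
  then show ?thesis by (rule that)
qed

section \<open>Fourier coefficients of the Kawahara solution\<close>

lemma integrable_L2:
  assumes "f \<in> L2"
  shows "integrable circ f"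
proof -
  interpret finite_measure circ by (rule finite_measure_circ)
  have "integrable circ (\<lambda>x. 1 + (cmod (f x))\<^sup>2)"
    using assms by (simp add: L2_def)
  then show ?thesis
  proof (rule Bochner_Integration.integrable_bound)
    show "AE x in circ. norm (f x) \<le> norm (1 + (cmod (f x))\<^sup>2)"
    proof (rule AE_I2)
      fix x
      have "0 \<le> (cmod (f x) - 1)\<^sup>2 + (cmod (f x))\<^sup>2 + 1" by (intro add_nonneg_nonneg) auto
      then show "norm (f x) \<le> norm (1 + (cmod (f x))\<^sup>2)"
        by (simp add: power2_diff algebra_simps)
    qed
  qed (use assms in \<open>simp add: L2_def\<close>)
qed

lemma L2_imp_measurable: "f \<in> L2 \<Longrightarrow> f \<in> borel_measurable circ"
  by (simp add: L2_def)

lemma integrable_L2_mult: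
  assumes "f \<in> L2" "g \<in> L2"
  shows "integrable circ (\<lambda>x. f x * g x)"
proof (rule Bochner_Integration.integrable_bound)
  show "integrable circ (\<lambda>x. (cmod (f x))\<^sup>2 + (cmod (g x))\<^sup>2)"
    using assms by (simp add: L2_def)
  show "(\<lambda>x. f x * g x) \<in> borel_measurable circ"
    using assms by (intro borel_measurable_times L2_imp_measurable)
  have "cmod (f x) * cmod (g x) \<le> (cmod (f x))\<^sup>2 + (cmod (g x))\<^sup>2" for x
    using sum_squares_bound[of "cmod (f x)" "cmod (g x)"]
      mult_nonneg_nonneg[OF norm_ge_zero[of "f x"] norm_ge_zero[of "g x"]]
    unfolding mult.assoc by linarith
  then show "AE x in circ. norm (f x * g x) \<le> norm ((cmod (f x))\<^sup>2 + (cmod (g x))\<^sup>2)"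
    by (intro AE_I2) (simp add: norm_mult)
qed

lemma norm_diff_square_le: "(cmod (a - b))\<^sup>2 \<le> 2 * (cmod a)\<^sup>2 + 2 * (cmod b)\<^sup>2"
proof -
  have "(cmod (a - b))\<^sup>2 \<le> (cmod a + cmod b)\<^sup>2"
    by (intro power_mono norm_triangle_ineq4) simp
  also have "\<dots> \<le> 2 * (cmod a)\<^sup>2 + 2 * (cmod b)\<^sup>2"
    using sum_squares_bound[of "cmod a" "cmod b"] by (simp add: power2_sum)
  finally show ?thesis .
qed

lemma norm_add_square_le: "(cmod (a + b))\<^sup>2 \<le> 2 * (cmod a)\<^sup>2 + 2 * (cmod b)\<^sup>2"
  using norm_diff_square_le[of a "- b"] by simp

lemma L2_diff:
  assumes "f \<in> L2" "g \<in> L2"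
  shows "(\<lambda>x. f x - g x) \<in> L2"
proof -
  have "integrable circ (\<lambda>x. (cmod (f x - g x))\<^sup>2)"
  proof (rule Bochner_Integration.integrable_bound)
    show "integrable circ (\<lambda>x. 2 * (cmod (f x))\<^sup>2 + 2 * (cmod (g x))\<^sup>2)"
      using assms by (simp add: L2_def)
    show "(\<lambda>x. (cmod (f x - g x))\<^sup>2) \<in> borel_measurable circ"
      using assms[THEN L2_imp_measurable] by measurable
    show "AE x in circ. norm ((cmod (f x - g x))\<^sup>2) \<le> norm (2 * (cmod (f x))\<^sup>2 + 2 * (cmod (g x))\<^sup>2)"
      using norm_diff_square_le by (intro AE_I2) simp
  qed
  then show ?thesis
    using assms by (auto simp: L2_def periodic_def)
qed

lemma L2_divide:
  assumes "f \<in> L2"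
  shows "(\<lambda>x. f x / c) \<in> L2"
proof -
  have [measurable]: "f \<in> borel_measurable circ" using assms by (rule L2_imp_measurable)
  have "(\<lambda>x. f x / c) \<in> borel_measurable circ" by measurable
  then show ?thesis
    using assms by (simp add: L2_def periodic_def norm_divide power_divide)
qed

lemma trig_poly_L2: "trig_poly N c \<in> L2"
proof -
  have "integrable circ (\<lambda>x. (cmod (trig_poly N c x))\<^sup>2)"
    by (intro integrable_circ_continuous continuous_intros)
  moreover have "trig_poly N c \<in> borel_measurable circ"
    by (intro borel_measurable_circ_continuous continuous_intros)
  ultimately show ?thesis
    using trig_poly_periodic by (simp add: L2_def)
qed

abbreviation Hweight :: "nat \<Rightarrow> int \<Rightarrow> real" where
  "Hweight r k \<equiv> (1 + (real_of_int k)\<^sup>2) ^ r"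

lemma Hspace_imp_L2: "f \<in> Hspace r \<Longrightarrow> f \<in> L2"
  by (simp add: Hspace_def)

lemma Hspace_diff:
  assumes "f \<in> Hspace r" "g \<in> Hspace r"
  shows "(\<lambda>x. f x - g x) \<in> Hspace r"
proof -
  have "(\<lambda>k. Hweight r k * (cmod (fourier (\<lambda>x. f x - g x) k))\<^sup>2) summable_on UNIV"
  proof (rule summable_on_comparison_test)
    show "(\<lambda>k. 2 * (Hweight r k * (cmod (fourier f k))\<^sup>2) + 2 * (Hweight r k * (cmod (fourier g k))\<^sup>2)) summable_on UNIV"
      using assms by (intro summable_on_add summable_on_cmult_right) (auto simp: Hspace_def)
    fix k
    have "Hweight r k * (cmod (fourier f k - fourier g k))\<^sup>2
        \<le> Hweight r k * (2 * (cmod (fourier f k))\<^sup>2 + 2 * (cmod (fourier g k))\<^sup>2)"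
      by (intro mult_left_mono norm_diff_square_le) simp
    then show "Hweight r k * (cmod (fourier (\<lambda>x. f x - g x) k))\<^sup>2
        \<le> 2 * (Hweight r k * (cmod (fourier f k))\<^sup>2) + 2 * (Hweight r k * (cmod (fourier g k))\<^sup>2)"
      using assms by (simp add: fourier_diff integrable_L2 Hspace_imp_L2 algebra_simps)
  qed auto
  then show ?thesis
    using assms by (auto simp: Hspace_def L2_diff)
qed

lemma Hspace_divide:
  assumes "f \<in> Hspace r"
  shows "(\<lambda>x. f x / c) \<in> Hspace r"
proof -
  have "(\<lambda>k. (1 / (cmod c)\<^sup>2) * (Hweight r k * (cmod (fourier f k))\<^sup>2)) summable_on UNIV"
    using assms by (intro summable_on_cmult_right) (auto simp: Hspace_def)
  then show ?thesis
    using assms by (auto simp: Hspace_def L2_divide fourier_divide norm_divide power_divide)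
qed

lemma Hspace_antimono:
  assumes "f \<in> Hspace r" "s \<le> r"
  shows "f \<in> Hspace s"
proof -
  have "(\<lambda>k. Hweight s k * (cmod (fourier f k))\<^sup>2) summable_on UNIV"
  proof (rule summable_on_comparison_test)
    show "(\<lambda>k. Hweight r k * (cmod (fourier f k))\<^sup>2) summable_on UNIV"
      using assms by (simp add: Hspace_def)
    show "Hweight s k * (cmod (fourier f k))\<^sup>2 \<le> Hweight r k * (cmod (fourier f k))\<^sup>2" for k
      using assms(2) by (intro mult_right_mono power_increasing) auto
  qed auto
  then show ?thesis using assms by (simp add: Hspace_def)
qed

lemma sum_le_Hnorm:
  assumes "f \<in> Hspace r" "finite D"
  shows "(\<Sum>k\<in>D. Hweight r k * (cmod (fourier f k))\<^sup>2) \<le> (Hnorm r f)\<^sup>2"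
proof -
  have s: "(\<lambda>k. Hweight r k * (cmod (fourier f k))\<^sup>2) summable_on UNIV"
    using assms by (simp add: Hspace_def)
  have "(\<Sum>k\<in>D. Hweight r k * (cmod (fourier f k))\<^sup>2) \<le> (\<Sum>\<^sub>\<infinity>k. Hweight r k * (cmod (fourier f k))\<^sup>2)"
    by (rule finite_sum_le_infsum[OF s assms(2)]) auto
  moreover have "0 \<le> (\<Sum>\<^sub>\<infinity>k. Hweight r k * (cmod (fourier f k))\<^sup>2)"
    by (rule infsum_nonneg) simp
  ultimately show ?thesis by (simp add: Hnorm_def)
qed

lemma Hnorm_nonneg [simp]: "Hnorm r f \<ge> 0"
  by (simp add: Hnorm_def infsum_nonneg)

lemma norm_fourier_le_Hnorm:
  assumes "f \<in> Hspace r"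
  shows "cmod (fourier f k) \<le> Hnorm r f"
proof -
  have "1 * (cmod (fourier f k))\<^sup>2 \<le> Hweight r k * (cmod (fourier f k))\<^sup>2"
    by (intro mult_right_mono one_le_power) auto
  also have "\<dots> \<le> (Hnorm r f)\<^sup>2"
    using sum_le_Hnorm[OF assms, of "{k}"] by simp
  finally have "(cmod (fourier f k))\<^sup>2 \<le> (Hnorm r f)\<^sup>2" by simp
  then show ?thesis by (rule power2_le_imp_le) simp
qed

text \<open>Each Fourier coefficient is bounded by \<open>Hnorm s\<close>, so convergence of the
  difference quotients in that norm passes to the coefficients.\<close>

lemma fourier_time_derivative:
  assumes der: "time_deriv_H s u ut" and u: "\<And>t. t \<ge> 0 \<Longrightarrow> u t \<in> Hspace s"
    and ut: "\<And>t. t \<ge> 0 \<Longrightarrow> ut t \<in> Hspace s" and t: "t \<ge> 0"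
  shows "((\<lambda>t. fourier (u t) k) has_vector_derivative fourier (ut t) k) (at t within {0..})"
  unfolding has_vector_derivative_def has_derivative_within
proof
  show "bounded_linear (\<lambda>h. h *\<^sub>R fourier (ut t) k)" by (rule bounded_linear_scaleR_left)
  let ?q = "\<lambda>s' x. (u s' x - u t x) / complex_of_real (s' - t) - ut t x"
  have lim: "((\<lambda>s'. Hnorm s (?q s')) \<longlongrightarrow> 0) (at t within {0..})"
    using der t by (simp add: time_deriv_H_def)
  show "((\<lambda>s'. (1 / norm (s' - t)) *\<^sub>R (fourier (u s') k - (fourier (u t) k + (s' - t) *\<^sub>R fourier (ut t) k))) \<longlongrightarrow> 0)
     (at t within {0..})"
  proof (rule Lim_null_comparison[OF _ lim])
    have "\<forall>\<^sub>F s' in at t within {0..}. s' \<in> {0..} \<and> s' \<noteq> t"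
      by (simp add: eventually_at_filter)
    then show "\<forall>\<^sub>F s' in at t within {0..}. norm ((1 / norm (s' - t)) *\<^sub>R
        (fourier (u s') k - (fourier (u t) k + (s' - t) *\<^sub>R fourier (ut t) k))) \<le> Hnorm s (?q s')"
    proof eventually_elim
      case (elim s')
      then have s': "s' \<ge> 0" "s' \<noteq> t" by auto
      have H: "(\<lambda>x. (u s' x - u t x) / complex_of_real (s' - t)) \<in> Hspace s" "ut t \<in> Hspace s"
        "u s' \<in> Hspace s" "u t \<in> Hspace s"
        using u ut s' t by (auto intro!: Hspace_divide Hspace_diff)
      then have int: "integrable circ (\<lambda>x. (u s' x - u t x) / complex_of_real (s' - t))" "integrable circ (ut t)"
        "integrable circ (u s')" "integrable circ (u t)"
        by (auto intro!: integrable_L2 Hspace_imp_L2)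
      have "(1 / norm (s' - t)) * cmod (fourier (u s') k - (fourier (u t) k + (s' - t) *\<^sub>R fourier (ut t) k))
          = cmod ((fourier (u s') k - (fourier (u t) k + (s' - t) *\<^sub>R fourier (ut t) k)) / complex_of_real (s' - t))"
        by (simp only: norm_divide norm_of_real real_norm_def) simp
      also have "\<dots> = cmod ((fourier (u s') k - fourier (u t) k) / complex_of_real (s' - t) - fourier (ut t) k)"
        using s' by (intro arg_cong[where f = cmod]) (simp add: scaleR_conv_of_real field_simps)
      also have "\<dots> = cmod (fourier (?q s') k)"
        using int by (simp add: fourier_diff fourier_divide)
      also have "\<dots> \<le> Hnorm s (?q s')"
        by (intro norm_fourier_le_Hnorm Hspace_diff H)
      finally show ?case by simp
    qed
  qed
qed

text \<open>The test function is the mode \<open>expi (- k)\<close>; the sign (-1)^j cancels against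
  the one in (-ik)^j.\<close>

lemma fourier_weak_deriv:
  assumes "weak_deriv j f g"
  shows "fourier g k = (\<i> * of_int k) ^ j * fourier f k"
proof -
  have "(\<integral>x. g x * expi (- k) x \<partial>circ) = (-1) ^ j * (\<integral>x. f x * (dx ^^ j) (expi (- k)) x \<partial>circ)"
    using assms smooth_expi[of "- k"] expi_periodic unfolding weak_deriv_def periodic_def by blast
  also have "(\<integral>x. f x * (dx ^^ j) (expi (- k)) x \<partial>circ) = (\<integral>x. (\<i> * of_int (- k)) ^ j * (f x * expi (- k) x) \<partial>circ)"
    by (simp only: dx_power_expi mult_ac)
  also have "\<dots> = (\<i> * of_int (- k)) ^ j * (\<integral>x. f x * expi (- k) x \<partial>circ)"
    by (rule Bochner_Integration.integral_mult_right_zero)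
  also have "(-1) ^ j * ((\<i> * of_int (- k)) ^ j * (\<integral>x. f x * expi (- k) x \<partial>circ))
      = (\<i> * of_int k) ^ j * (\<integral>x. f x * expi (- k) x \<partial>circ)"
    by (simp flip: power_mult_distrib mult.assoc)
  finally show ?thesis by (simp add: fourier_altdef mult.commute)
qed

section \<open>Truncation of the nonlinear term of the exact solution\<close>

lemma wt_power_le: "n \<le> m \<Longrightarrow> wt k ^ m \<le> wt k ^ n"
  by (intro power_decreasing) auto

lemma abs_mult_wt_le: "\<bar>of_int k\<bar> * wt k \<le> 1"
  by (simp add: wt_def field_simps)

lemma norm_trig_poly_le:
  assumes "\<And>k. cmod (c k) \<le> A * (wt k)\<^sup>2"
  shows "cmod (trig_poly N c x) \<le> 3 * A"
proof -
  have A: "0 \<le> A" using assms[of 0] by (auto simp: wt_def intro: order_trans[OF norm_ge_zero])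
  have "cmod (trig_poly N c x) \<le> (\<Sum>k = - int N..int N. A * (wt k)\<^sup>2)"
    unfolding trig_poly_def by (rule sum_norm_le) (simp add: norm_mult assms)
  also have "\<dots> = A * (\<Sum>k = - int N..int N. (wt k)\<^sup>2)" by (simp add: sum_distrib_left)
  also have "\<dots> \<le> A * 3" using A by (intro mult_left_mono sum_wt_square) auto
  finally show ?thesis by simp
qed

lemma norm_mult_diff_le:
  fixes a b p q :: complex
  assumes "cmod (a - p) \<le> \<alpha>" "cmod b \<le> \<beta>" "cmod p \<le> \<gamma>" "cmod (b - q) \<le> \<delta>"
  shows "cmod (a * b - p * q) \<le> \<alpha> * \<beta> + \<gamma> * \<delta>"
proof -
  have nonneg: "0 \<le> \<alpha>" "0 \<le> \<beta>" "0 \<le> \<gamma>" "0 \<le> \<delta>"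
    using assms by (auto intro: order_trans[OF norm_ge_zero])
  have "a * b - p * q = (a - p) * b + p * (b - q)" by (simp add: algebra_simps)
  also have "cmod \<dots> \<le> \<alpha> * \<beta> + \<gamma> * \<delta>"
    using nonneg assms by (intro norm_triangle_mono) (auto simp: norm_mult intro!: mult_mono)
  finally show ?thesis .
qed

text \<open>Replacing \<open>u\<close> and \<open>ux\<close> by their partial sums \<open>p\<close>
  and \<open>q\<close> makes the product a finite convolution. The uniform cost is of order M^(3-r):
  one power goes into the derivative, two into summing the tail. The constant is 27 = 3 * 6 + 3 *
  3.\<close>

lemma fourier_advection_truncation:
  assumes u: "u \<in> L2" and ux: "weak_deriv 1 u ux" and r: "r \<ge> 4"
    and c: "\<And>k. cmod (fourier u k) \<le> A * wt k ^ r"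
  shows "cmod (fourier (\<lambda>x. u x * ux x) k - \<i> * of_int k / 2 * conv M (fourier u) (fourier u) k)
    \<le> 27 * A\<^sup>2 * wt (int M) ^ (r - 3)"
proof -
  have A: "0 \<le> A" using c[of 0] by (auto simp: wt_def intro: order_trans[OF norm_ge_zero])
  define p q where "p = trig_poly M (fourier u)" and "q = trig_poly M (fourier ux)"
  have ux_L2: "ux \<in> L2" using ux by (simp add: weak_deriv_def)
  have cx: "fourier ux k = \<i> * of_int k * fourier u k" for k
    using fourier_weak_deriv[OF ux, of k] by simp
  have cx_le: "cmod (fourier ux k) \<le> A * wt k ^ (r - 1)" for k
  proof -
    have "cmod (fourier ux k) = \<bar>of_int k\<bar> * cmod (fourier u k)" by (simp add: cx norm_mult)
    also have "\<dots> \<le> \<bar>of_int k\<bar> * (A * wt k ^ r)" using c by (intro mult_left_mono) auto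
    also have "\<dots> = (\<bar>of_int k\<bar> * wt k) * (A * wt k ^ (r - 1))"
      using r by (simp add: power_eq_if)
    also have "\<dots> \<le> 1 * (A * wt k ^ (r - 1))"
      using A abs_mult_wt_le by (intro mult_right_mono) auto
    finally show ?thesis by simp
  qed
  have "dx p = q"
    unfolding p_def q_def dx_trig_poly cx[abs_def] ..
  have w_le: "wt (int M) ^ n \<le> 1" for n by (intro power_le_one) auto
  have le1: "AE x in circ. cmod (u x - p x) \<le> 3 * A * wt (int M) ^ (r - 3)"
  proof -
    have "AE x in circ. cmod (u x - p x) \<le> 3 * A * wt (int M) ^ (r - 2)"
      unfolding p_def
    proof (rule trig_poly_approx[OF integrable_L2[OF u]])
      have "r - 2 + 2 = r" using r by simp
      then show "cmod (fourier u k) \<le> A * wt k ^ (r - 2 + 2)" for k using c by presburger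
    qed (use r in auto)
    moreover have "3 * A * wt (int M) ^ (r - 2) \<le> 3 * A * wt (int M) ^ (r - 3)"
      using A by (intro mult_left_mono wt_power_le) auto
    ultimately show ?thesis by (auto elim: eventually_mono)
  qed
  have le2: "AE x in circ. cmod (ux x - q x) \<le> 3 * A * wt (int M) ^ (r - 3)"
    unfolding q_def
  proof (rule trig_poly_approx[OF integrable_L2[OF ux_L2]])
    have "r - 3 + 2 = r - 1" using r by simp
    then show "cmod (fourier ux k) \<le> A * wt k ^ (r - 3 + 2)" for k using cx_le by presburger
  qed (use r in auto)
  have p_le: "cmod (p x) \<le> 3 * A" for x
    unfolding p_def using A r
    by (intro norm_trig_poly_le order_trans[OF c] mult_left_mono wt_power_le) auto
  have q_le: "cmod (q x) \<le> 3 * A" for x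
    unfolding q_def using A r
    by (intro norm_trig_poly_le order_trans[OF cx_le] mult_left_mono wt_power_le) auto
  have prod: "AE x in circ. cmod (u x * ux x - p x * q x) \<le> 27 * A\<^sup>2 * wt (int M) ^ (r - 3)"
    using le1 le2
  proof eventually_elim
    case (elim x)
    have "3 * A * wt (int M) ^ (r - 3) \<le> 3 * A * 1"
      using A w_le by (intro mult_left_mono) auto
    \<comment> \<open>Half of this comes from the partial sum \<open>q\<close>, half from the
      tail.\<close>
    then have "cmod (ux x) \<le> 6 * A"
      using norm_triangle_sub[of "ux x" "q x"] q_le[of x] elim by linarith
    then have "cmod (u x * ux x - p x * q x) \<le> 3 * A * wt (int M) ^ (r - 3) * (6 * A) + 3 * A * (3 * A * wt (int M) ^ (r - 3))"
      using elim p_le by (intro norm_mult_diff_le)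
    then show ?case by (simp add: power2_eq_square algebra_simps)
  qed
  have int: "integrable circ (\<lambda>x. u x * ux x)" "integrable circ (\<lambda>x. p x * q x)"
    using u ux_L2 by (auto simp: p_def q_def intro!: integrable_L2_mult trig_poly_L2)
  have "fourier (\<lambda>x. u x * ux x) k - \<i> * of_int k / 2 * conv M (fourier u) (fourier u) k
      = fourier (\<lambda>x. u x * ux x) k - fourier (\<lambda>x. p x * q x) k"
    using fourier_advection_trig_poly[of M "fourier u" k] unfolding p_def[symmetric] \<open>dx p = q\<close> by simp
  also have "\<dots> = fourier (\<lambda>x. u x * ux x - p x * q x) k"
    by (rule fourier_diff[OF int, symmetric])
  also have "cmod \<dots> \<le> 27 * A\<^sup>2 * wt (int M) ^ (r - 3)"
    using A int by (intro norm_fourier_le[OF prod]) auto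
  finally show ?thesis .
qed

text \<open>\<open>T\<close> comes from continuity in H^r at time 0: up to \<open>T\<close> the
  solution stays within distance 1 of its initial value. The cutoff \<open>M\<close> stays free,
  with \<open>T\<close> and \<open>A\<close> independent of it, since it will later depend on
  \<open>N\<close>.\<close>

lemma kawahara_coeffs:
  assumes sol: "kawahara_solution r u0 u" and r: "r \<ge> 5"
    and u0: "integrable circ u0"
  obtains T A where "T > 0" "A \<ge> 0"
    and "\<And>t. t \<in> {0..T} \<Longrightarrow> u t \<in> L2"
    and "\<And>t. t \<in> {0..T} \<Longrightarrow> hermitian (fourier (u t))"
    and "\<And>k. fourier (u 0) k = fourier u0 k"
    and "\<And>t k. t \<in> {0..T} \<Longrightarrow> cmod (fourier (u t) k) \<le> A * wt k ^ r"
    and "\<And>t D. t \<in> {0..T} \<Longrightarrow> finite D \<Longrightarrow> (\<Sum>k\<in>D. Hweight r k * (cmod (fourier (u t) k))\<^sup>2) \<le> A\<^sup>2"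
    and "\<And>t k M. t \<in> {0..T} \<Longrightarrow> \<exists>\<rho>. ((\<lambda>t. fourier (u t) k) has_vector_derivative
          kaw M (fourier (u t)) k + \<rho>) (at t within {0..}) \<and> cmod \<rho> \<le> 27 * A\<^sup>2 * wt (int M) ^ (r - 3)"
proof -
  obtain ut where rv: "\<And>t. t \<ge> 0 \<Longrightarrow> real_valued (u t)" and cont: "cont_H r u"
    and init: "AE x in circ. u 0 x = u0 x"
    and ut: "cont_H (r - 5) ut" "time_deriv_H (r - 5) u ut"
    and eq: "\<And>t. t \<ge> 0 \<Longrightarrow> \<exists>ux uxxx uxxxxx.
           weak_deriv 1 (u t) ux \<and> weak_deriv 3 (u t) uxxx \<and> weak_deriv 5 (u t) uxxxxx \<and>
           (AE x in circ. ut t x + u t x * ux x + uxxx x - uxxxxx x = 0)"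
    using sol unfolding kawahara_solution_def by blast
  have uH: "u t \<in> Hspace r" if "t \<ge> 0" for t using cont that by (simp add: cont_H_def)
  have utH: "ut t \<in> Hspace (r - 5)" if "t \<ge> 0" for t using ut that by (simp add: cont_H_def)
  \<comment> \<open>From |x + y|^2 <= 2 |x|^2 + 2 |y|^2, with an increment of norm less than 1 added
    to the initial value.\<close>
  define B where "B = sqrt (2 + 2 * (Hnorm r (u 0))\<^sup>2)"
  have B: "B \<ge> 0" "B\<^sup>2 = 2 + 2 * (Hnorm r (u 0))\<^sup>2" by (auto simp: B_def)
  have "((\<lambda>s. Hnorm r (\<lambda>x. u s x - u 0 x)) \<longlongrightarrow> 0) (at 0 within {0..})"
    using cont by (simp add: cont_H_def)
  then have "\<forall>\<^sub>F s in at 0 within {0..}. Hnorm r (\<lambda>x. u s x - u 0 x) < 1"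
    by (rule order_tendstoD) simp
  then obtain d where d: "d > 0" "\<And>s. s \<in> {0..} \<Longrightarrow> s \<noteq> 0 \<Longrightarrow> dist s 0 < d \<Longrightarrow> Hnorm r (\<lambda>x. u s x - u 0 x) < 1"
    unfolding eventually_at by blast
  define T where "T = d / 2"
  have T: "T > 0" using d by (simp add: T_def)
  have sumB: "(\<Sum>k\<in>D. Hweight r k * (cmod (fourier (u t) k))\<^sup>2) \<le> B\<^sup>2"
    if t: "t \<in> {0..T}" and D: "finite D" for t D
  proof (cases "t = 0")
    case True
    have "(\<Sum>k\<in>D. Hweight r k * (cmod (fourier (u 0) k))\<^sup>2) \<le> (Hnorm r (u 0))\<^sup>2"
      by (rule sum_le_Hnorm[OF uH D]) simp
    also have "\<dots> \<le> B\<^sup>2" unfolding B(2) by (rule add_increasing) auto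
    finally show ?thesis unfolding True .
  next
    case False
    have "Hnorm r (\<lambda>x. u t x - u 0 x) < 1"
      using t False d(1) by (intro d(2)) (simp_all add: T_def dist_real_def)
    then have le1: "(Hnorm r (\<lambda>x. u t x - u 0 x))\<^sup>2 \<le> 1\<^sup>2"
      by (intro power_mono) auto
    have H: "(\<lambda>x. u t x - u 0 x) \<in> Hspace r" "u t \<in> Hspace r" "u 0 \<in> Hspace r"
      using t by (auto intro!: Hspace_diff uH)
    have "fourier (u t) k = fourier (\<lambda>x. u t x - u 0 x) k + fourier (u 0) k" for k
      using H by (simp add: fourier_diff integrable_L2 Hspace_imp_L2)
    then have *: "(cmod (fourier (u t) k))\<^sup>2 \<le> 2 * (cmod (fourier (\<lambda>x. u t x - u 0 x) k))\<^sup>2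
        + 2 * (cmod (fourier (u 0) k))\<^sup>2" for k
      using norm_add_square_le[of "fourier (\<lambda>x. u t x - u 0 x) k" "fourier (u 0) k"] by presburger
    have "(\<Sum>k\<in>D. Hweight r k * (cmod (fourier (u t) k))\<^sup>2)
        \<le> (\<Sum>k\<in>D. Hweight r k * (2 * (cmod (fourier (\<lambda>x. u t x - u 0 x) k))\<^sup>2 + 2 * (cmod (fourier (u 0) k))\<^sup>2))"
      by (intro sum_mono mult_left_mono *) simp
    also have "\<dots> = 2 * (\<Sum>k\<in>D. Hweight r k * (cmod (fourier (\<lambda>x. u t x - u 0 x) k))\<^sup>2)
        + 2 * (\<Sum>k\<in>D. Hweight r k * (cmod (fourier (u 0) k))\<^sup>2)"
      by (simp add: sum_distrib_left sum.distrib algebra_simps)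
    also have "\<dots> \<le> 2 * (Hnorm r (\<lambda>x. u t x - u 0 x))\<^sup>2 + 2 * (Hnorm r (u 0))\<^sup>2"
      using H D by (intro add_mono mult_left_mono sum_le_Hnorm) auto
    also have "\<dots> \<le> 2 * 1\<^sup>2 + 2 * (Hnorm r (u 0))\<^sup>2"
      by (intro add_mono mult_left_mono le1) auto
    also have "\<dots> = B\<^sup>2" unfolding B(2) by simp
    finally show ?thesis .
  qed
  \<comment> \<open>The factor 2^r converts the Sobolev weight to \<open>wt\<close>, by ((1 + |k|) /
    2)^2 <= 1 + k^2.\<close>
  define A where "A = 2 ^ r * B"
  have A: "A \<ge> 0" using B by (simp add: A_def)
  have "B \<le> A" using B one_le_power[of "2::real" r] by (simp add: A_def mult_le_cancel_right1)
  have decay: "cmod (fourier (u t) k) \<le> A * wt k ^ r" if t: "t \<in> {0..T}" for t k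
  proof -
    define y where "y = (1 + \<bar>real_of_int k\<bar>) / 2"
    have y: "y > 0" by (simp add: y_def)
    have "(y\<^sup>2) ^ r * (cmod (fourier (u t) k))\<^sup>2 \<le> Hweight r k * (cmod (fourier (u t) k))\<^sup>2"
    proof (intro mult_right_mono power_mono)
      have "2 * \<bar>real_of_int k\<bar> \<le> 1 + (real_of_int k)\<^sup>2"
        using sum_squares_bound[of 1 "\<bar>real_of_int k\<bar>"] by simp
      moreover have "y\<^sup>2 = (1 + 2 * \<bar>real_of_int k\<bar> + (real_of_int k)\<^sup>2) / 4"
        by (simp add: y_def power_divide power2_sum)
      ultimately have "4 * y\<^sup>2 \<le> 2 * (1 + (real_of_int k)\<^sup>2)" by argo
      also have "\<dots> \<le> 4 * (1 + (real_of_int k)\<^sup>2)" by simp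
      finally show "y\<^sup>2 \<le> 1 + (real_of_int k)\<^sup>2" by (rule mult_left_le_imp_le) simp
    qed auto
    also have "\<dots> \<le> B\<^sup>2"
      using sumB[OF t, of "{k}"] by simp
    also have "(y\<^sup>2) ^ r * (cmod (fourier (u t) k))\<^sup>2 = (y ^ r * cmod (fourier (u t) k))\<^sup>2"
      by (simp only: power_mult_distrib power_mult[of y 2 r, symmetric] power_mult[of y r 2, symmetric] mult.commute[of r 2])
    finally have "y ^ r * cmod (fourier (u t) k) \<le> B"
      using B(1) by (rule power2_le_imp_le)
    then have "inverse y ^ r * (y ^ r * cmod (fourier (u t) k)) \<le> inverse y ^ r * B"
      using y by (intro mult_left_mono) auto
    also have "inverse y ^ r * (y ^ r * cmod (fourier (u t) k)) = cmod (fourier (u t) k)"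
      using y by (simp flip: mult.assoc power_mult_distrib)
    also have "inverse y = 2 * wt k" by (simp add: y_def wt_def)
    finally show ?thesis by (simp add: A_def power_mult_distrib mult_ac)
  qed
  have evol: "\<exists>\<rho>. ((\<lambda>t. fourier (u t) k) has_vector_derivative
          kaw M (fourier (u t)) k + \<rho>) (at t within {0..}) \<and> cmod \<rho> \<le> 27 * A\<^sup>2 * wt (int M) ^ (r - 3)"
    if t: "t \<in> {0..T}" for t k M
  proof -
    have t0: "t \<ge> 0" using t by simp
    obtain ux uxxx uxxxxx where wd: "weak_deriv 1 (u t) ux" "weak_deriv 3 (u t) uxxx" "weak_deriv 5 (u t) uxxxxx"
      and ae: "AE x in circ. ut t x + u t x * ux x + uxxx x - uxxxxx x = 0"
      using eq[OF t0] by blast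
    have L2: "u t \<in> L2" "ux \<in> L2" "uxxx \<in> L2" "uxxxxx \<in> L2" "ut t \<in> L2"
      using wd utH[OF t0] by (auto simp: weak_deriv_def Hspace_imp_L2)
    note int = integrable_L2[OF L2(3)] integrable_L2[OF L2(4)] integrable_L2[OF L2(5)]
      integrable_L2_mult[OF L2(1,2)]
    have "fourier (\<lambda>x. ut t x + u t x * ux x + uxxx x - uxxxxx x) k = fourier (\<lambda>x. 0) k"
      using int by (intro fourier_cong_AE ae) auto
    then have "fourier (ut t) k + fourier (\<lambda>x. u t x * ux x) k + fourier uxxx k - fourier uxxxxx k = 0"
      using int by (simp add: fourier_add fourier_diff fourier_altdef[of "\<lambda>x. 0"])
    moreover have "fourier uxxx k = - (\<i> * of_int (k ^ 3) * fourier (u t) k)"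
      "fourier uxxxxx k = \<i> * of_int (k ^ 5) * fourier (u t) k"
    proof -
      have "\<i> ^ 3 = - \<i>" "\<i> ^ 5 = \<i>" by (simp_all add: eval_nat_numeral)
      then show "fourier uxxx k = - (\<i> * of_int (k ^ 3) * fourier (u t) k)"
        "fourier uxxxxx k = \<i> * of_int (k ^ 5) * fourier (u t) k"
        by (simp_all add: fourier_weak_deriv[OF wd(2)] fourier_weak_deriv[OF wd(3)] power_mult_distrib)
    qed
    moreover have "x = z - y - w" if "x + y + w - z = 0" for x y w z :: complex
      using that by algebra
    ultimately have "fourier (ut t) k = \<i> * of_int (k ^ 5) * fourier (u t) k
        - fourier (\<lambda>x. u t x * ux x) k - (- (\<i> * of_int (k ^ 3) * fourier (u t) k))"
      by metis
    then have ut_eq: "fourier (ut t) k = kaw M (fourier (u t)) k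
        + - (fourier (\<lambda>x. u t x * ux x) k - \<i> * of_int k / 2 * conv M (fourier (u t)) (fourier (u t)) k)"
      by (simp add: kaw_def omega_def algebra_simps del: of_int_power)
    have "((\<lambda>t. fourier (u t) k) has_vector_derivative fourier (ut t) k) (at t within {0..})"
      by (rule fourier_time_derivative[OF ut(2) Hspace_antimono[OF uH] utH t0]) auto
    moreover have "cmod (fourier (\<lambda>x. u t x * ux x) k - \<i> * of_int k / 2 * conv M (fourier (u t)) (fourier (u t)) k)
        \<le> 27 * A\<^sup>2 * wt (int M) ^ (r - 3)"
      using r by (intro fourier_advection_truncation[OF L2(1) wd(1)] decay t) auto
    ultimately show ?thesis
      unfolding ut_eq by (intro exI conjI) (assumption, simp only: norm_minus_cancel)
  qed
  have 1: "u t \<in> L2" if "t \<in> {0..T}" for t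
    using uH that by (auto intro: Hspace_imp_L2)
  have 2: "hermitian (fourier (u t))" if "t \<in> {0..T}" for t
    using rv[of t] that fourier_real_valued unfolding hermitian_def by auto
  have 3: "fourier (u 0) k = fourier u0 k" for k
    using uH[of 0] u0 by (intro fourier_cong_AE init) (auto intro: L2_imp_measurable Hspace_imp_L2)
  have 4: "(\<Sum>k\<in>D. Hweight r k * (cmod (fourier (u t) k))\<^sup>2) \<le> A\<^sup>2" if "t \<in> {0..T}" "finite D" for t D
    using sumB[OF that] power_mono[OF \<open>B \<le> A\<close> B(1), of 2] by linarith
  show ?thesis
    by (rule that) (fact T A 1 2 3 decay 4 evol)+
qed

section \<open>The normal form correction\<close>

text \<open>The three-wave resonance function: relative to mode k, the product of free waves with
  indices j and k - j oscillates with this frequency, up to sign.\<close>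

definition phase :: "int \<Rightarrow> int \<Rightarrow> real" where
  "phase k j = omega k - omega j - omega (k - j)"

text \<open>The interactions (j, k - j) that feed mode \<open>k\<close> at cutoff \<open>M\<close>
  but are missing from the scheme with cutoff \<open>N\<close>.\<close>

definition high :: "nat \<Rightarrow> nat \<Rightarrow> int \<Rightarrow> int set" where
  "high N M k = modes M k - modes N k"

text \<open>The quotient is \<open>0\<close> for \<open>k = 0\<close>, where the phase vanishes as well; this is harmless because
  the mean is conserved.\<close>

definition corrector :: "nat \<Rightarrow> nat \<Rightarrow> (int \<Rightarrow> complex) \<Rightarrow> int \<Rightarrow> complex" where
  "corrector N M c k = - (\<Sum>j\<in>high N M k. of_real (of_int k / phase k j) * (c j * c (k - j))) / 2"

lemma finite_high [simp]: "finite (high N M k)"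
  by (simp add: high_def)

text \<open>With b = k - j: (j+b)^3 - j^3 - b^3 = 3jb(j+b) and (j+b)^5 - j^5 - b^5 =
  5jb(j+b)(j^2+jb+b^2).\<close>

lemma phase_factor:
  "phase k j = of_int (k * j * (k - j) * (3 + 5 * (j ^ 2 + j * (k - j) + (k - j) ^ 2)))"
proof -
  define b where "b = k - j"
  have k: "k = j + b" by (simp add: b_def)
  have "(j + b) ^ 3 + (j + b) ^ 5 - (j ^ 3 + j ^ 5) - (b ^ 3 + b ^ 5)
      = (j + b) * j * b * (3 + 5 * (j ^ 2 + j * b + b ^ 2))"
    by (simp add: eval_nat_numeral algebra_simps)
  then show ?thesis
    unfolding phase_def omega_def of_int_diff[symmetric] by (simp add: k)
qed

lemma phase_minus: "phase (- k) (- j) = - phase k j"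
  using omega_minus[of "k - j"] by (simp add: phase_def)

text \<open>If one of j and k - j were 0, the other would be \<open>k\<close>, which is at most
  \<open>N\<close> in modulus, and the pair would already be present at cutoff
  \<open>N\<close>.\<close>

lemma high_cases:
  assumes "\<bar>k\<bar> \<le> int N" "j \<in> high N M k"
  shows "j \<noteq> 0" "k - j \<noteq> 0" "int N < \<bar>j\<bar> \<or> int N < \<bar>k - j\<bar>" "\<bar>j\<bar> \<le> int M" "\<bar>k - j\<bar> \<le> int M"
  using assms by (auto simp: high_def modes_def)

text \<open>The numerator cancels the factor \<open>k\<close> of the phase, and completing the
  square shows j^2 + jb + b^2 to be at least 3/4 of the larger square, hence of N^2. The factors |j|
  and |k - j| are kept to absorb a derivative in the residual.\<close>

lemma phase_lower_bound:
  assumes k: "\<bar>k\<bar> \<le> int N" and j: "j \<in> high N M k" and N: "N \<ge> 1"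
  shows "\<bar>of_int k / phase k j\<bar> \<le> (1 / real N)\<^sup>2 / (\<bar>of_int j\<bar> * \<bar>of_int (k - j)\<bar>)"
proof (cases "k = 0")
  case False
  define b where "b = k - j"
  define P where "P = 3 + 5 * (j ^ 2 + j * b + b ^ 2)"
  have nz: "j \<noteq> 0" "b \<noteq> 0" using high_cases[OF k j] by (auto simp: b_def)
  have "int N ^ 2 \<le> j ^ 2 \<or> int N ^ 2 \<le> b ^ 2"
    using high_cases(3)[OF k j] by (auto simp: b_def abs_le_square_iff[symmetric])
  moreover have "4 * (j ^ 2 + j * b + b ^ 2) = 3 * j ^ 2 + (j + 2 * b) ^ 2"
    "4 * (j ^ 2 + j * b + b ^ 2) = 3 * b ^ 2 + (2 * j + b) ^ 2"
    by (simp_all add: power2_eq_square algebra_simps)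
  moreover have "0 \<le> (j + 2 * b) ^ 2" "0 \<le> (2 * j + b) ^ 2" by auto
  ultimately have "3 * int N ^ 2 \<le> 4 * (j ^ 2 + j * b + b ^ 2)" by linarith
  then have P: "int N ^ 2 \<le> P" unfolding P_def using zero_le_power2[of "int N"] by linarith
  have "int N ^ 2 > 0" using N by simp
  then have P0: "P > 0" using P by linarith
  have P': "(real N)\<^sup>2 \<le> of_int P"
    using P by (metis of_int_le_iff of_int_of_nat_eq of_int_power)
  have "phase k j = of_int k * of_int j * of_int b * of_int P"
    by (simp add: phase_factor b_def P_def)
  then have "\<bar>of_int k / phase k j\<bar> = 1 / (\<bar>of_int j\<bar> * \<bar>of_int b\<bar> * of_int P)"
    using False P0 by (simp add: abs_mult abs_divide)
  also have "\<dots> \<le> 1 / (\<bar>of_int j\<bar> * \<bar>of_int b\<bar> * (real N)\<^sup>2)"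
    using nz P' N P0 by (intro divide_left_mono mult_left_mono mult_pos_pos) auto
  finally show ?thesis by (simp add: b_def power_divide mult_ac)
qed simp

lemma high_wt_le:
  assumes "\<bar>k\<bar> \<le> int N" "j \<in> high N M k"
  shows "wt j \<le> wt (int N) \<or> wt (k - j) \<le> wt (int N)"
  using high_cases(3)[OF assms]
proof
  assume "int N < \<bar>j\<bar>"
  then have "wt j \<le> wt (int N)" by (intro wt_antimono) simp
  then show ?thesis ..
next
  assume "int N < \<bar>k - j\<bar>"
  then have "wt (k - j) \<le> wt (int N)" by (intro wt_antimono) simp
  then show ?thesis ..
qed

section \<open>Sums of products of decay weights\<close>

lemma sum_wt_square_shift:
  assumes "finite F"
  shows "(\<Sum>j\<in>F. (wt (k - j))\<^sup>2) \<le> 3"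
proof -
  have "(\<Sum>j\<in>F. (wt (k - j))\<^sup>2) = (\<Sum>j\<in>(\<lambda>j. k - j) ` F. (wt j)\<^sup>2)"
    by (subst sum.reindex) (auto simp: inj_on_def)
  also have "\<dots> \<le> 3" using assms by (intro sum_wt_square) auto
  finally show ?thesis .
qed

lemma sum_wt_power: "finite F \<Longrightarrow> r \<ge> 2 \<Longrightarrow> (\<Sum>j\<in>F. wt j ^ r) \<le> 3"
  by (rule order_trans[OF sum_mono sum_wt_square]) (auto intro: wt_power_le)

lemma sum_wt_power_shift: "finite F \<Longrightarrow> r \<ge> 2 \<Longrightarrow> (\<Sum>j\<in>F. wt (k - j) ^ r) \<le> 3"
  by (rule order_trans[OF sum_mono sum_wt_square_shift]) (auto intro: wt_power_le)

text \<open>In each term one weight is at most \<open>w\<close> and is pulled out while the other is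
  summed, whence 6 = 3 + 3. The choice w = \<open>wt (int N)\<close> measures high pairs; w =
  \<open>2 * wt k\<close> gives the decay of convolutions.\<close>

lemma sum_wt_product:
  assumes le: "\<And>j. j \<in> F \<Longrightarrow> wt j \<le> w \<or> wt (k - j) \<le> w" and "finite F" "r \<ge> 2" "w \<ge> 0"
  shows "(\<Sum>j\<in>F. wt j ^ r * wt (k - j) ^ r) \<le> 6 * w ^ r"
proof -
  have "(\<Sum>j\<in>F. wt j ^ r * wt (k - j) ^ r) \<le> (\<Sum>j\<in>F. w ^ r * (wt j ^ r + wt (k - j) ^ r))"
  proof (rule sum_mono)
    fix j assume "j \<in> F"
    then consider "wt j \<le> w" | "wt (k - j) \<le> w" using le by blast
    then show "wt j ^ r * wt (k - j) ^ r \<le> w ^ r * (wt j ^ r + wt (k - j) ^ r)"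
    proof cases
      case 1
      then have "wt j ^ r * wt (k - j) ^ r \<le> w ^ r * wt (k - j) ^ r"
        by (intro mult_right_mono power_mono) auto
      then show ?thesis using \<open>w \<ge> 0\<close> by (simp add: distrib_left add_increasing)
    next
      case 2
      then have "wt j ^ r * wt (k - j) ^ r \<le> wt j ^ r * w ^ r"
        by (intro mult_left_mono power_mono) auto
      then show ?thesis using \<open>w \<ge> 0\<close> by (simp add: distrib_left add_increasing2 mult.commute)
    qed
  qed
  also have "\<dots> = w ^ r * ((\<Sum>j\<in>F. wt j ^ r) + (\<Sum>j\<in>F. wt (k - j) ^ r))"
    by (simp add: sum_distrib_left sum.distrib distrib_left)
  also have "\<dots> \<le> w ^ r * (3 + 3)"
    using assms by (intro mult_left_mono add_mono sum_wt_power sum_wt_power_shift) auto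
  finally show ?thesis by simp
qed

text \<open>At least one of j and k - j is about |k|/2 or larger, so one weight is at most
  \<open>2 * wt k\<close>. The decay rate survives the quadratic nonlinearity up to a
  constant.\<close>

lemma conv_decay:
  assumes c: "\<And>k. cmod (c k) \<le> A * wt k ^ r" and r: "r \<ge> 2" and A: "A \<ge> 0"
  shows "cmod (conv M c c k) \<le> 6 * 2 ^ r * A\<^sup>2 * wt k ^ r"
proof -
  have "cmod (conv M c c k) \<le> (\<Sum>j\<in>modes M k. A\<^sup>2 * (wt j ^ r * wt (k - j) ^ r))"
    unfolding conv_modes
  proof (rule sum_norm_le)
    fix j
    have "cmod (c j * c (k - j)) \<le> (A * wt j ^ r) * (A * wt (k - j) ^ r)"
      unfolding norm_mult using A by (intro mult_mono c) auto
    then show "cmod (c j * c (k - j)) \<le> A\<^sup>2 * (wt j ^ r * wt (k - j) ^ r)"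
      by (simp add: power2_eq_square mult_ac)
  qed
  also have "\<dots> = A\<^sup>2 * (\<Sum>j\<in>modes M k. wt j ^ r * wt (k - j) ^ r)"
    by (simp add: sum_distrib_left)
  also have "(\<Sum>j\<in>modes M k. wt j ^ r * wt (k - j) ^ r) \<le> 6 * (2 * wt k) ^ r"
  proof (rule sum_wt_product)
    fix j
    have "\<bar>k\<bar> \<le> 2 * \<bar>j\<bar> + 1 \<or> \<bar>k\<bar> \<le> 2 * \<bar>k - j\<bar> + 1" by arith
    then have "\<bar>real_of_int k\<bar> \<le> 2 * \<bar>of_int j\<bar> + 1 \<or> \<bar>real_of_int k\<bar> \<le> 2 * \<bar>of_int (k - j)\<bar> + 1"
      by linarith
    then show "wt j \<le> 2 * wt k \<or> wt (k - j) \<le> 2 * wt k"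
      unfolding wt_def by (auto simp: field_simps)
  qed (use r in auto)
  also have "A\<^sup>2 * (6 * (2 * wt k) ^ r) = 6 * 2 ^ r * A\<^sup>2 * wt k ^ r"
    by (simp add: power_mult_distrib)
  finally show ?thesis using A by (simp add: mult_left_mono)
qed

text \<open>Numerator and phase both change sign under (k, j) -> (-k, -j), so their real quotient is
  even.\<close>

lemma corrector_hermitian:
  assumes "hermitian c"
  shows "hermitian (corrector N M c)"
  unfolding hermitian_def
proof
  fix k
  have "(\<Sum>j\<in>high N M (- k). of_real (of_int (- k) / phase (- k) j) * (c j * c (- k - j)))
     = (\<Sum>j\<in>high N M k. of_real (of_int (- k) / phase (- k) (- j)) * (c (- j) * c (- (k - j))))"
    by (rule sum.reindex_bij_witness[of _ uminus uminus]) (auto simp: high_def modes_def)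
  also have "\<dots> = cnj (\<Sum>j\<in>high N M k. of_real (of_int k / phase k j) * (c j * c (k - j)))"
    unfolding phase_minus hermitianD[OF assms] cnj_sum by simp
  finally show "corrector N M c (- k) = cnj (corrector N M c k)"
    by (simp add: corrector_def)
qed

lemma corrector_bound:
  assumes c: "\<And>k. cmod (c k) \<le> A * wt k ^ r" and r: "r \<ge> 2" and A: "A \<ge> 0"
    and k: "\<bar>k\<bar> \<le> int N" and N: "N \<ge> 1"
  shows "cmod (corrector N M c k) \<le> 3 * A\<^sup>2 * (1 / real N)\<^sup>2 * wt (int N) ^ r"
proof -
  let ?h = "1 / real N"
  have "cmod (\<Sum>j\<in>high N M k. of_real (of_int k / phase k j) * (c j * c (k - j)))
      \<le> (\<Sum>j\<in>high N M k. ?h\<^sup>2 * A\<^sup>2 * (wt j ^ r * wt (k - j) ^ r))"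
  proof (rule sum_norm_le)
    fix j assume j: "j \<in> high N M k"
    have "1 \<le> \<bar>real_of_int j\<bar>" "1 \<le> \<bar>real_of_int (k - j)\<bar>"
      using high_cases(1,2)[OF k j] by linarith+
    then have "1 * 1 \<le> \<bar>real_of_int j\<bar> * \<bar>real_of_int (k - j)\<bar>"
      by (intro mult_mono) auto
    then have "?h\<^sup>2 / (\<bar>real_of_int j\<bar> * \<bar>real_of_int (k - j)\<bar>) \<le> ?h\<^sup>2 / 1"
      by (intro divide_left_mono) auto
    then have ph: "\<bar>of_int k / phase k j\<bar> \<le> ?h\<^sup>2"
      using phase_lower_bound[OF k j N] by simp
    have "cmod (of_real (of_int k / phase k j) * (c j * c (k - j)))
        = \<bar>of_int k / phase k j\<bar> * (cmod (c j) * cmod (c (k - j)))"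
      by (simp only: norm_mult norm_of_real real_norm_def)
    also have "\<dots> \<le> ?h\<^sup>2 * ((A * wt j ^ r) * (A * wt (k - j) ^ r))"
      using A by (intro mult_mono ph c) auto
    finally show "cmod (of_real (of_int k / phase k j) * (c j * c (k - j))) \<le> ?h\<^sup>2 * A\<^sup>2 * (wt j ^ r * wt (k - j) ^ r)"
      by (simp add: power2_eq_square mult_ac)
  qed
  also have "\<dots> = ?h\<^sup>2 * A\<^sup>2 * (\<Sum>j\<in>high N M k. wt j ^ r * wt (k - j) ^ r)"
    by (simp add: sum_distrib_left)
  also have "\<dots> \<le> ?h\<^sup>2 * A\<^sup>2 * (6 * wt (int N) ^ r)"
    using r by (intro mult_left_mono sum_wt_product high_wt_le[OF k]) auto
  finally show ?thesis by (simp add: corrector_def norm_divide mult_ac)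
qed

text \<open>The derivative of the quadratic map \<open>corrector\<close> at \<open>c\<close> in
  direction \<open>n\<close>, where \<open>n\<close> will be the time derivative of \<open>c\<close>
  without the linear flow.\<close>

definition corrector_residual :: "nat \<Rightarrow> nat \<Rightarrow> (int \<Rightarrow> complex) \<Rightarrow> (int \<Rightarrow> complex) \<Rightarrow> int \<Rightarrow> complex" where
  "corrector_residual N M c n k =
     - (\<Sum>j\<in>high N M k. of_real (of_int k / phase k j) * (n j * c (k - j) + c j * n (k - j))) / 2"

text \<open>The linear flow multiplies each product by i (omega j + omega (k - j)) = i (omega k -
  phase k j). The first part is the linear flow of the corrector; in the second the phase cancels
  the denominator and leaves exactly the interactions missing at cutoff \<open>N\<close>.\<close>

lemma corrector_derivative:
  assumes der: "\<And>j. \<bar>j\<bar> \<le> int M \<Longrightarrow> ((\<lambda>t. c t j) has_vector_derivative \<i> * omega j * c t j + n j) (at t within S)"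
    and k: "\<bar>k\<bar> \<le> int N" and "N \<le> M" "N \<ge> 1"
  shows "((\<lambda>t. corrector N M (c t) k) has_vector_derivative \<i> * omega k * corrector N M (c t) k
     + \<i> * of_int k / 2 * (conv M (c t) (c t) k - conv N (c t) (c t) k)
     + corrector_residual N M (c t) n k) (at t within S)"
proof -
  let ?w = "\<lambda>j. complex_of_real (of_int k / phase k j)"
  let ?d = "\<lambda>j. c t j * (\<i> * omega (k - j) * c t (k - j) + n (k - j)) + (\<i> * omega j * c t j + n j) * c t (k - j)"
  have "((\<lambda>t. corrector N M (c t) k) has_vector_derivative
      - (\<Sum>j\<in>high N M k. ?w j * ?d j) / 2) (at t within S)"
    unfolding corrector_def
    by (intro has_vector_derivative_divide has_vector_derivative_minus has_vector_derivative_sum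
        has_vector_derivative_mult_right has_vector_derivative_mult der high_cases[OF k])
  moreover have alg: "w * (x * (\<i> * b * y + m) + (\<i> * a * x + l) * y)
      = \<i> * W * (w * (x * y)) - \<i> * K * (x * y) + w * (l * y + x * m)"
    if "w * p = K" "a + b = W - p" for w x y a b l m p K W :: complex
  proof -
    have b: "b = W - p - a" using that(2) by (simp add: algebra_simps)
    show ?thesis unfolding that(1)[symmetric] b by (simp add: algebra_simps)
  qed
  have "?w j * ?d j = \<i> * omega k * (?w j * (c t j * c t (k - j))) - \<i> * of_int k * (c t j * c t (k - j))
      + ?w j * (n j * c t (k - j) + c t j * n (k - j))" if j: "j \<in> high N M k" for j
  proof -
    have "of_int k / phase k j * phase k j = of_int k"
    proof (cases "k = 0")
      case False
      have "phase k j \<noteq> 0"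
      proof
        assume 0: "phase k j = 0"
        \<comment> \<open>Twice the quadratic form in the phase is j^2 + (k-j)^2 + k^2, so the last
          factor of the phase is positive.\<close>
        have half: "0 \<le> Q" if "2 * Q = S" "0 \<le> S" for Q S :: int
          using that by linarith
        have "0 \<le> j ^ 2 + j * (k - j) + (k - j) ^ 2"
          by (rule half[of _ "j ^ 2 + (k - j) ^ 2 + k ^ 2"]) (simp add: power2_eq_square algebra_simps, simp)
        then show False
          using 0 high_cases(1,2)[OF k j] False unfolding phase_factor of_int_eq_0_iff by auto
      qed
      then show ?thesis by simp
    qed simp
    then have "?w j * of_real (phase k j) = of_int k"
      by (metis of_real_mult of_real_of_int_eq)
    moreover have "complex_of_real (omega j) + omega (k - j) = omega k - complex_of_real (phase k j)"
      unfolding of_real_add[symmetric] of_real_diff[symmetric] by (simp add: phase_def)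
    ultimately show ?thesis by (intro alg)
  qed
  then have "(\<Sum>j\<in>high N M k. ?w j * ?d j) = \<i> * omega k * (\<Sum>j\<in>high N M k. ?w j * (c t j * c t (k - j)))
      - \<i> * of_int k * (\<Sum>j\<in>high N M k. c t j * c t (k - j))
      + (\<Sum>j\<in>high N M k. ?w j * (n j * c t (k - j) + c t j * n (k - j)))"
    by (simp add: sum.distrib sum_subtractf sum_distrib_left)
  moreover have "(\<Sum>j\<in>high N M k. c t j * c t (k - j)) = conv M (c t) (c t) k - conv N (c t) (c t) k"
    unfolding conv_modes high_def using \<open>N \<le> M\<close>
    by (intro sum_diff finite_modes) (auto simp: modes_def)
  moreover have "- (a * S1 - b * S2 + S3) / 2 = a * (- S1 / 2) + b / 2 * S2 + - S3 / 2" for a b S1 S2 S3 :: complex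
    by (simp add: field_simps)
  ultimately show ?thesis
    by (simp only: corrector_def corrector_residual_def)
qed

text \<open>\<open>n\<close> carries a derivative, that is, a factor |j| or |k - j|. As both indices
  are nonzero, either factor is at most |j| |k - j|, which the bound on the phase quotient
  cancels.\<close>

lemma corrector_residual_bound:
  assumes c: "\<And>k. cmod (c k) \<le> A * wt k ^ r" and r: "r \<ge> 2" and A: "A \<ge> 0"
    and n: "\<And>j. \<bar>j\<bar> \<le> int M \<Longrightarrow> cmod (n j) \<le> \<bar>of_int j\<bar> * (D * wt j ^ r) + \<beta>" and D: "D \<ge> 0" "\<beta> \<ge> 0"
    and k: "\<bar>k\<bar> \<le> int N" and N: "N \<ge> 1"
  shows "cmod (corrector_residual N M c n k) \<le> (1 / real N)\<^sup>2 * (6 * A * D * wt (int N) ^ r + 3 * A * \<beta>)"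
proof -
  let ?h = "1 / real N"
  have "cmod (\<Sum>j\<in>high N M k. of_real (of_int k / phase k j) * (n j * c (k - j) + c j * n (k - j)))
      \<le> (\<Sum>j\<in>high N M k. ?h\<^sup>2 * (2 * A * D * (wt j ^ r * wt (k - j) ^ r) + A * \<beta> * (wt j ^ r + wt (k - j) ^ r)))"
  proof (rule sum_norm_le)
    fix j assume j: "j \<in> high N M k"
    define x y where "x = \<bar>real_of_int j\<bar>" and "y = \<bar>real_of_int (k - j)\<bar>"
    have x: "1 \<le> x" and y: "1 \<le> y"
      using high_cases(1,2)[OF k j] unfolding x_def y_def by linarith+
    have jk: "cmod (n j) \<le> x * y * (D * wt j ^ r + \<beta>)" "cmod (n (k - j)) \<le> x * y * (D * wt (k - j) ^ r + \<beta>)"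
    proof -
      have xy: "x * 1 \<le> x * y" "1 * y \<le> x * y" "1 * 1 \<le> x * y"
        using x y by (intro mult_mono; simp)+
      have w: "0 \<le> D * wt i ^ r" for i using D by simp
      have "cmod (n j) \<le> x * (D * wt j ^ r) + 1 * \<beta>"
        using n[OF high_cases(4)[OF k j]] by (simp add: x_def)
      also have "\<dots> \<le> x * y * (D * wt j ^ r) + x * y * \<beta>"
        using xy w D by (intro add_mono mult_right_mono) auto
      finally show "cmod (n j) \<le> x * y * (D * wt j ^ r + \<beta>)" by (simp add: distrib_left)
      have "cmod (n (k - j)) \<le> y * (D * wt (k - j) ^ r) + 1 * \<beta>"
        using n[OF high_cases(5)[OF k j]] by (simp add: y_def)
      also have "\<dots> \<le> x * y * (D * wt (k - j) ^ r) + x * y * \<beta>"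
        using xy w D by (intro add_mono mult_right_mono) auto
      finally show "cmod (n (k - j)) \<le> x * y * (D * wt (k - j) ^ r + \<beta>)" by (simp add: distrib_left)
    qed
    let ?E = "(D * wt j ^ r + \<beta>) * (A * wt (k - j) ^ r) + (A * wt j ^ r) * (D * wt (k - j) ^ r + \<beta>)"
    have "cmod (n j * c (k - j) + c j * n (k - j))
        \<le> x * y * (D * wt j ^ r + \<beta>) * (A * wt (k - j) ^ r) + (A * wt j ^ r) * (x * y * (D * wt (k - j) ^ r + \<beta>))"
      using x y A D by (intro norm_triangle_mono) (auto simp: norm_mult intro!: mult_mono jk c)
    also have "\<dots> = x * y * ?E" by (simp add: algebra_simps)
    finally have le: "cmod (n j * c (k - j) + c j * n (k - j)) \<le> x * y * ?E" .
    have "cmod (of_real (of_int k / phase k j) * (n j * c (k - j) + c j * n (k - j)))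
        = \<bar>of_int k / phase k j\<bar> * cmod (n j * c (k - j) + c j * n (k - j))"
      by (simp only: norm_mult norm_of_real real_norm_def)
    also have "\<dots> \<le> ?h\<^sup>2 / (x * y) * (x * y * ?E)"
      using x y phase_lower_bound[OF k j N] by (intro mult_mono le) (auto simp: x_def y_def)
    also have "\<dots> = ?h\<^sup>2 * ?E" using x y by simp
    also have "?E = 2 * A * D * (wt j ^ r * wt (k - j) ^ r) + A * \<beta> * (wt j ^ r + wt (k - j) ^ r)"
      by (simp add: algebra_simps)
    finally show "cmod (of_real (of_int k / phase k j) * (n j * c (k - j) + c j * n (k - j)))
        \<le> ?h\<^sup>2 * (2 * A * D * (wt j ^ r * wt (k - j) ^ r) + A * \<beta> * (wt j ^ r + wt (k - j) ^ r))" .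
  qed
  also have "\<dots> = ?h\<^sup>2 * (2 * A * D * (\<Sum>j\<in>high N M k. wt j ^ r * wt (k - j) ^ r)
      + A * \<beta> * ((\<Sum>j\<in>high N M k. wt j ^ r) + (\<Sum>j\<in>high N M k. wt (k - j) ^ r)))"
    by (simp add: sum_distrib_left[symmetric] sum.distrib)
  also have "\<dots> \<le> ?h\<^sup>2 * (2 * A * D * (6 * wt (int N) ^ r) + A * \<beta> * (3 + 3))"
    using r A D
    by (intro mult_left_mono add_mono sum_wt_product sum_wt_power sum_wt_power_shift high_wt_le[OF k]) auto
  finally show ?thesis
    by (simp add: corrector_residual_def norm_divide algebra_simps)
qed

lemma norm_conv_le:
  assumes "\<And>j. \<bar>j\<bar> \<le> int N \<Longrightarrow> cmod (b j) \<le> \<tau>" "\<tau> \<ge> 0"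
  shows "cmod (conv N a b k) \<le> (\<Sum>j = - int N..int N. cmod (a j)) * \<tau>"
proof -
  have "cmod (conv N a b k) \<le> (\<Sum>j\<in>modes N k. cmod (a j) * \<tau>)"
    unfolding conv_modes
    by (rule sum_norm_le) (auto simp: norm_mult modes_def intro!: mult_left_mono assms)
  also have "\<dots> \<le> (\<Sum>j = - int N..int N. cmod (a j) * \<tau>)"
    using modes_subset assms(2) by (intro sum_mono2) auto
  finally show ?thesis by (simp add: sum_distrib_right)
qed

text \<open>There are 2N + 1 <= 3 N^2 modes; the extra factor 1/N in the pointwise bound, once
  squared, pays for them.\<close>

lemma energy_pointwise_bound:
  assumes "\<And>k. \<bar>k\<bar> \<le> int N \<Longrightarrow> cmod (a k) \<le> D * (1 / real N) ^ (r + 1)" and N: "N \<ge> 1"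
  shows "energy N a \<le> 3 * D\<^sup>2 * (1 / real N) ^ (2 * r)"
proof -
  let ?h = "1 / real N"
  have "energy N a \<le> (\<Sum>k = - int N..int N. (D * ?h ^ (r + 1))\<^sup>2)"
    unfolding energy_def by (intro sum_mono power_mono assms) auto
  also have "\<dots> = (2 * real N + 1) * (D\<^sup>2 * (?h\<^sup>2 * ?h ^ (2 * r)))"
  proof -
    have "(D * ?h ^ (r + 1))\<^sup>2 = D\<^sup>2 * (?h\<^sup>2 * ?h ^ (2 * r))"
      unfolding power_mult_distrib power_mult[symmetric] power_add[symmetric] by (simp add: algebra_simps)
    then show ?thesis by (simp add: nat_add_distrib)
  qed
  also have "\<dots> \<le> (3 * (real N)\<^sup>2) * (D\<^sup>2 * (?h\<^sup>2 * ?h ^ (2 * r)))"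
  proof (intro mult_right_mono)
    have "1 \<le> real N" using N by simp
    moreover have "real N * 1 \<le> real N * real N" using N by (intro mult_left_mono) auto
    ultimately show "2 * real N + 1 \<le> 3 * (real N)\<^sup>2" unfolding power2_eq_square by linarith
  qed auto
  also have "\<dots> = 3 * D\<^sup>2 * ?h ^ (2 * r)"
    using N by (simp add: power_divide)
  finally show ?thesis .
qed

lemma energy_add_le: "energy N (\<lambda>k. a k + b k) \<le> 2 * energy N a + 2 * energy N b"
  unfolding energy_def sum_distrib_left sum.distrib[symmetric]
  by (intro sum_mono norm_add_square_le)

section \<open>The error estimate\<close>

text \<open>The three summands stem from the interactions of the corrector with itself and the
  solution, from the truncation residual, and from the residual of the corrector.\<close>

definition forcing_const :: "nat \<Rightarrow> real \<Rightarrow> real \<Rightarrow> real" where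
  "forcing_const r A B = (9 * A\<^sup>2 + 6 * A) * (3 / 2 * A\<^sup>2) + B + (18 * 2 ^ r * A ^ 3 + 3 * A * B)"

text \<open>27 A^4 bounds the energy of the corrector in units of N^(-2r). It occurs once as initial
  error subject to growth and once when the corrector is added back.\<close>

definition error_const :: "nat \<Rightarrow> real \<Rightarrow> real \<Rightarrow> real \<Rightarrow> real" where
  "error_const r A B T = 2 * ((27 * A ^ 4 + 3 * (forcing_const r A B)\<^sup>2 * T) * exp ((3 * A + 9 * A\<^sup>2 + 1) * T))
     + 2 * (27 * A ^ 4)"

lemma wt_of_nat_le: "0 < M \<Longrightarrow> wt (int M) \<le> 1 / real M"
  by (auto simp: wt_def intro!: divide_left_mono)

lemma galerkin_coeff_error:
  fixes a c :: "real \<Rightarrow> int \<Rightarrow> complex"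
  assumes r: "r \<ge> 5" and A: "A \<ge> 0" and B: "B \<ge> 0" and N: "N \<ge> 1" and M: "M = N ^ 4"
    and c_herm: "\<And>t. t \<in> {0..T} \<Longrightarrow> hermitian (c t)"
    and c: "\<And>t k. t \<in> {0..T} \<Longrightarrow> cmod (c t k) \<le> A * wt k ^ r"
    and c_der: "\<And>t k. t \<in> {0..T} \<Longrightarrow> \<exists>\<rho>. ((\<lambda>t. c t k) has_vector_derivative kaw M (c t) k + \<rho>) (at t within {0..})
        \<and> cmod \<rho> \<le> B * wt (int M) ^ (r - 3)"
    and a_herm: "\<And>t. t \<ge> 0 \<Longrightarrow> hermitian (a t)"
    and a_der: "\<And>t k. t \<ge> 0 \<Longrightarrow> \<bar>k\<bar> \<le> int N \<Longrightarrow>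
      ((\<lambda>t. a t k) has_vector_derivative kaw N (a t) k) (at t within {0..})"
    and init: "\<And>k. \<bar>k\<bar> \<le> int N \<Longrightarrow> a 0 k = c 0 k"
    and t: "t \<in> {0..T}"
  shows "energy N (\<lambda>k. a t k - c t k) \<le> error_const r A B T * (1 / real N) ^ (2 * r)"
proof -
  define h where "h = 1 / real N"
  have h: "0 < h" "h \<le> 1" "real N * h = 1" using N by (auto simp: h_def)
  have h_pow: "h ^ m \<le> h ^ n" if "n \<le> m" for m n
    using h that by (intro power_decreasing) auto
  have wN: "wt (int N) \<le> h" using N unfolding h_def by (intro wt_of_nat_le) simp
  have wNr: "wt (int N) ^ r \<le> h ^ r" by (intro power_mono wN) simp
  have "N \<le> M" using N by (simp add: M self_le_power)
  have "wt (int M) \<le> h ^ 4"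
  proof -
    have "wt (int M) \<le> 1 / real M" using N by (intro wt_of_nat_le) (simp add: M)
    then show ?thesis by (simp add: M h_def power_divide)
  qed
  then have "wt (int M) ^ (r - 3) \<le> (h ^ 4) ^ (r - 3)" by (intro power_mono) auto
  \<comment> \<open>The exponents compare as 4(r - 3) >= r + 1, by r >= 5.\<close>
  also have "\<dots> \<le> h ^ (r + 1)"
    unfolding power_mult[symmetric] using r by (intro h_pow) simp
  finally have wM: "wt (int M) ^ (r - 3) \<le> h ^ (r + 1)" .
  have "\<forall>s k. \<exists>\<rho>. s \<in> {0..T} \<longrightarrow> ((\<lambda>t. c t k) has_vector_derivative kaw M (c s) k + \<rho>) (at s within {0..})
        \<and> cmod \<rho> \<le> B * wt (int M) ^ (r - 3)"
    using c_der by blast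
  then obtain \<rho> where \<rho>: "\<And>s k. s \<in> {0..T} \<Longrightarrow> ((\<lambda>t. c t k) has_vector_derivative kaw M (c s) k + \<rho> s k) (at s within {0..})"
    and \<rho>_bound: "\<And>s k. s \<in> {0..T} \<Longrightarrow> cmod (\<rho> s k) \<le> B * wt (int M) ^ (r - 3)"
    by metis
  have \<rho>_le: "cmod (\<rho> s k) \<le> B * h ^ (r + 1)" if "s \<in> {0..T}" for s k
    using \<rho>_bound[OF that, of k] mult_left_mono[OF wM B] by linarith
  \<comment> \<open>The time derivative of \<open>c\<close> without its linear flow; up to one
    derivative and a small remainder it decays like \<open>c\<close>.\<close>
  define n where "n s k = - (\<i> * of_int k / 2 * conv M (c s) (c s) k) + \<rho> s k" for s k
  have c_der': "((\<lambda>t. c t k) has_vector_derivative \<i> * omega k * c s k + n s k) (at s within {0..})" if "s \<in> {0..T}" for s k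
    using \<rho>[OF that, of k] by (simp add: n_def kaw_def algebra_simps)
  have n_le: "cmod (n s k) \<le> \<bar>of_int k\<bar> * (3 * 2 ^ r * A\<^sup>2 * wt k ^ r) + B * h ^ (r + 1)" if s: "s \<in> {0..T}" for s k
  proof -
    have "cmod (- (\<i> * of_int k / 2 * conv M (c s) (c s) k)) = \<bar>of_int k\<bar> / 2 * cmod (conv M (c s) (c s) k)"
      by (simp add: norm_mult norm_divide)
    also have "\<dots> \<le> \<bar>of_int k\<bar> / 2 * (6 * 2 ^ r * A\<^sup>2 * wt k ^ r)"
      using r by (intro mult_left_mono conv_decay c s A) auto
    also have "\<dots> = \<bar>of_int k\<bar> * (3 * 2 ^ r * A\<^sup>2 * wt k ^ r)" by simp
    finally show ?thesis
      unfolding n_def by (rule norm_triangle_mono) (rule \<rho>_le[OF s])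
  qed
  define \<theta> where "\<theta> s = corrector N M (c s)" for s
  define R where "R s = corrector_residual N M (c s) (n s)" for s
  define \<tau> where "\<tau> = 3 * A\<^sup>2 * h ^ (r + 2)"
  have \<tau>: "\<tau> \<ge> 0" using h by (simp add: \<tau>_def)
  have \<theta>_herm: "hermitian (\<theta> s)" if "s \<in> {0..T}" for s
    unfolding \<theta>_def by (rule corrector_hermitian[OF c_herm[OF that]])
  have \<theta>_le: "cmod (\<theta> s k) \<le> \<tau>" if s: "s \<in> {0..T}" and k: "\<bar>k\<bar> \<le> int N" for s k
  proof -
    have "cmod (\<theta> s k) \<le> 3 * A\<^sup>2 * h\<^sup>2 * wt (int N) ^ r"
      unfolding \<theta>_def h_def using r by (intro corrector_bound c s A k N) auto
    also have "\<dots> \<le> 3 * A\<^sup>2 * h\<^sup>2 * h ^ r" using h by (intro mult_left_mono wNr) auto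
    finally show ?thesis by (simp add: \<tau>_def power_add power2_eq_square mult_ac)
  qed
  have R_le: "cmod (R s k) \<le> (18 * 2 ^ r * A ^ 3 + 3 * A * B) * h ^ (r + 1)" if s: "s \<in> {0..T}" and k: "\<bar>k\<bar> \<le> int N" for s k
  proof -
    have "cmod (R s k) \<le> h\<^sup>2 * (6 * A * (3 * 2 ^ r * A\<^sup>2) * wt (int N) ^ r + 3 * A * (B * h ^ (r + 1)))"
      unfolding R_def h_def using r A B
      by (intro corrector_residual_bound c s k N n_le[OF s, unfolded h_def]) auto
    also have "\<dots> \<le> h\<^sup>2 * (6 * A * (3 * 2 ^ r * A\<^sup>2) * h ^ r + 3 * A * (B * h ^ r))"
      using A B h by (intro mult_left_mono add_mono wNr h_pow) auto
    also have "\<dots> = (18 * 2 ^ r * A ^ 3 + 3 * A * B) * h ^ (r + 2)"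
      by (simp add: power_add algebra_simps power2_eq_square power3_eq_cube)
    also have "\<dots> \<le> (18 * 2 ^ r * A ^ 3 + 3 * A * B) * h ^ (r + 1)"
      using A B by (intro mult_left_mono h_pow) auto
    finally show ?thesis .
  qed
  \<comment> \<open>What still drives the corrected error after the forcing by high pairs has been
    cancelled; each part is of order h^(r+1).\<close>
  define f where "f s k = - (\<i> * of_int k / 2 * (conv N (\<theta> s) (\<theta> s) k + 2 * conv N (c s) (\<theta> s) k)) - \<rho> s k - R s k" for s k
  have sum_c: "(\<Sum>j = - int N..int N. cmod (c s j)) \<le> 3 * A" if s: "s \<in> {0..T}" for s
  proof -
    have "(\<Sum>j = - int N..int N. cmod (c s j)) \<le> (\<Sum>j = - int N..int N. A * wt j ^ r)"
      by (intro sum_mono c s)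
    also have "\<dots> = A * (\<Sum>j = - int N..int N. wt j ^ r)" by (simp add: sum_distrib_left)
    also have "\<dots> \<le> A * 3" using r A by (intro mult_left_mono sum_wt_power) auto
    finally show ?thesis by simp
  qed
  have N_h: "(2 * real N + 1) * real N * h ^ (r + 2) \<le> 3 * h ^ r"
  proof -
    have "2 * real N + 1 \<le> 3 * real N" using N by simp
    then have "(2 * real N + 1) * real N * h ^ (r + 2) \<le> 3 * real N * real N * h ^ (r + 2)"
      using h by (intro mult_right_mono) auto
    also have "\<dots> = 3 * (real N * h) * (real N * h) * h ^ r" by (simp add: power_add power2_eq_square)
    finally show ?thesis by (simp add: h)
  qed
  have h_le1: "h ^ m \<le> 1" for m using h by (intro power_le_one) auto
  have sum_k\<theta>: "(\<Sum>j = - int N..int N. real N * cmod (\<theta> s j)) \<le> 9 * A\<^sup>2" if s: "s \<in> {0..T}" for s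
  proof -
    have "(\<Sum>j = - int N..int N. real N * cmod (\<theta> s j)) \<le> (\<Sum>j = - int N..int N. real N * \<tau>)"
      by (intro sum_mono mult_left_mono \<theta>_le s) auto
    also have "\<dots> = 3 * A\<^sup>2 * ((2 * real N + 1) * real N * h ^ (r + 2))"
      by (simp add: \<tau>_def nat_add_distrib mult_ac)
    also have "\<dots> \<le> 3 * A\<^sup>2 * (3 * h ^ r)" by (intro mult_left_mono N_h) auto
    also have "\<dots> \<le> 3 * A\<^sup>2 * (3 * 1)" by (intro mult_left_mono h_le1) auto
    finally show ?thesis by simp
  qed
  have sum_\<theta>: "(\<Sum>j = - int N..int N. cmod (\<theta> s j)) \<le> 9 * A\<^sup>2" if s: "s \<in> {0..T}" for s
  proof (rule order_trans[OF sum_mono sum_k\<theta>[OF s]])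
    show "cmod (\<theta> s j) \<le> real N * cmod (\<theta> s j)" for j
      using N by (simp add: mult_le_cancel_right1)
  qed
  have f_le: "cmod (f s k) \<le> forcing_const r A B * h ^ (r + 1)" if s: "s \<in> {0..T}" and k: "\<bar>k\<bar> \<le> int N" for s k
  proof -
    have "cmod (conv N (\<theta> s) (\<theta> s) k + 2 * conv N (c s) (\<theta> s) k) \<le> 9 * A\<^sup>2 * \<tau> + 2 * (3 * A * \<tau>)"
    proof (rule norm_triangle_mono)
      have "cmod (conv N (\<theta> s) (\<theta> s) k) \<le> (\<Sum>j = - int N..int N. cmod (\<theta> s j)) * \<tau>"
        by (rule norm_conv_le) (use \<theta>_le[OF s] \<tau> in auto)
      also have "\<dots> \<le> 9 * A\<^sup>2 * \<tau>" by (intro mult_right_mono sum_\<theta>[OF s] \<tau>)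
      finally show "cmod (conv N (\<theta> s) (\<theta> s) k) \<le> 9 * A\<^sup>2 * \<tau>" .
      have "cmod (conv N (c s) (\<theta> s) k) \<le> (\<Sum>j = - int N..int N. cmod (c s j)) * \<tau>"
        by (rule norm_conv_le) (use \<theta>_le[OF s] \<tau> in auto)
      also have "\<dots> \<le> 3 * A * \<tau>" by (intro mult_right_mono sum_c[OF s] \<tau>)
      finally show "cmod (2 * conv N (c s) (\<theta> s) k) \<le> 2 * (3 * A * \<tau>)" by (simp add: norm_mult)
    qed
    then have "\<bar>of_int k\<bar> / 2 * cmod (conv N (\<theta> s) (\<theta> s) k + 2 * conv N (c s) (\<theta> s) k)
        \<le> real N / 2 * (9 * A\<^sup>2 * \<tau> + 2 * (3 * A * \<tau>))"
      using k by (intro mult_mono divide_right_mono) auto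
    also have "\<dots> = (9 * A\<^sup>2 + 6 * A) * (3 / 2 * A\<^sup>2) * ((real N * h) * h ^ (r + 1))"
      by (simp add: \<tau>_def algebra_simps)
    finally have 1: "cmod (- (\<i> * of_int k / 2 * (conv N (\<theta> s) (\<theta> s) k + 2 * conv N (c s) (\<theta> s) k)))
        \<le> (9 * A\<^sup>2 + 6 * A) * (3 / 2 * A\<^sup>2) * h ^ (r + 1)"
      by (simp add: norm_mult norm_divide h)
    have "cmod (f s k) \<le> (9 * A\<^sup>2 + 6 * A) * (3 / 2 * A\<^sup>2) * h ^ (r + 1) + B * h ^ (r + 1)
        + (18 * 2 ^ r * A ^ 3 + 3 * A * B) * h ^ (r + 1)"
      unfolding f_def
      by (intro order_trans[OF norm_triangle_ineq4] add_mono 1 \<rho>_le R_le s k)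
    then show ?thesis by (simp add: forcing_const_def distrib_right)
  qed
  define \<epsilon> where "\<epsilon> s k = a s k - c s k - \<theta> s k" for s k
  define q where "q s k = \<theta> s k + c s k" for s k
  have \<epsilon>_herm: "hermitian (\<epsilon> s)" if s: "s \<in> {0..T}" for s
  proof -
    have "hermitian (a s)" using s by (intro a_herm) simp
    then show ?thesis
      using c_herm[OF s] \<theta>_herm[OF s] by (simp add: hermitian_def \<epsilon>_def)
  qed
  have q_herm: "hermitian (q s)" if s: "s \<in> {0..T}" for s
    using c_herm[OF s] \<theta>_herm[OF s] by (simp add: hermitian_def q_def)
  \<comment> \<open>Independent of \<open>N\<close>: the first term is due to the solution, whose
    decay pays for the factor |k|, the second to the corrector, whose size h^(r+2) outweighs (2N +
    1) N.\<close>
  define Q where "Q = 3 * A + 9 * A\<^sup>2"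
  have Q: "(\<Sum>k = - int N..int N. \<bar>of_int k\<bar> * cmod (q s k)) \<le> Q" if s: "s \<in> {0..T}" for s
  proof -
    have "(\<Sum>k = - int N..int N. \<bar>of_int k\<bar> * cmod (q s k))
        \<le> (\<Sum>k = - int N..int N. A * wt k ^ 2 + real N * cmod (\<theta> s k))"
    proof (rule sum_mono)
      fix k assume k: "k \<in> {- int N..int N}"
      have "\<bar>of_int k\<bar> * cmod (c s k) \<le> \<bar>of_int k\<bar> * (A * wt k ^ 3)"
        using r A by (intro mult_left_mono order_trans[OF c[OF s]] wt_power_le) auto
      also have "\<dots> = (\<bar>of_int k\<bar> * wt k) * (A * wt k ^ 2)" by (simp add: power2_eq_square power3_eq_cube)
      also have "\<dots> \<le> 1 * (A * wt k ^ 2)" using A by (intro mult_right_mono abs_mult_wt_le) auto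
      finally have "\<bar>of_int k\<bar> * cmod (c s k) \<le> A * wt k ^ 2" by simp
      moreover have "\<bar>of_int k\<bar> * cmod (\<theta> s k) \<le> real N * cmod (\<theta> s k)"
        using k by (intro mult_right_mono) auto
      moreover have "\<bar>of_int k\<bar> * cmod (q s k) \<le> \<bar>of_int k\<bar> * (cmod (\<theta> s k) + cmod (c s k))"
        unfolding q_def by (intro mult_left_mono norm_triangle_ineq) auto
      ultimately show "\<bar>of_int k\<bar> * cmod (q s k) \<le> A * wt k ^ 2 + real N * cmod (\<theta> s k)"
        by (simp add: distrib_left)
    qed
    also have "\<dots> = A * (\<Sum>k = - int N..int N. wt k ^ 2) + (\<Sum>k = - int N..int N. real N * cmod (\<theta> s k))"
      by (simp add: sum.distrib sum_distrib_left)
    also have "\<dots> \<le> A * 3 + 9 * A\<^sup>2"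
      using A by (intro add_mono mult_left_mono sum_wt_square sum_k\<theta> s) auto
    finally show ?thesis by (simp add: Q_def)
  qed
  have "0 \<le> Q" using A by (simp add: Q_def)
  define \<epsilon>' where "\<epsilon>' s k = \<i> * omega k * \<epsilon> s k
      - \<i> * of_int k / 2 * (conv N (\<epsilon> s) (\<epsilon> s) k + 2 * conv N (q s) (\<epsilon> s) k) + f s k" for s k
  have \<epsilon>_der: "((\<lambda>t. \<epsilon> t k) has_vector_derivative \<epsilon>' s k) (at s within {0..})"
    if s: "s \<in> {0..T}" and k: "\<bar>k\<bar> \<le> int N" for s k
  proof -
    have "((\<lambda>t. \<epsilon> t k) has_vector_derivative kaw N (a s) k - (kaw M (c s) k + \<rho> s k)
        - (\<i> * omega k * \<theta> s k + \<i> * of_int k / 2 * (conv M (c s) (c s) k - conv N (c s) (c s) k) + R s k))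
        (at s within {0..})"
      unfolding \<epsilon>_def \<theta>_def R_def using s k
      by (intro has_vector_derivative_diff a_der \<rho> corrector_derivative c_der' \<open>N \<le> M\<close> N) auto
    moreover have "kaw N (a s) k - kaw N (c s) k
        = \<i> * omega k * (\<epsilon> s k + \<theta> s k) - \<i> * of_int k / 2 * (conv N (\<lambda>k. \<epsilon> s k + \<theta> s k) (\<lambda>k. \<epsilon> s k + \<theta> s k) k
           + 2 * conv N (c s) (\<lambda>k. \<epsilon> s k + \<theta> s k) k)"
      using kaw_diff[of N "c s" "\<lambda>k. \<epsilon> s k + \<theta> s k" k] by (simp add: \<epsilon>_def)
    \<comment> \<open>The difference of \<open>conv M\<close> and \<open>conv N\<close> in the
      derivative of the corrector cancels the discrepancy between \<open>kaw M\<close> and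
      \<open>kaw N\<close>. In the expansion around \<open>c\<close>, terms free of \<epsilon> go
      into \<open>f\<close>, and terms mixing \<epsilon> with \<theta> turn \<open>c\<close> into
      \<open>q\<close>.\<close>
    then have "kaw N (a s) k - (kaw M (c s) k + \<rho> s k)
        - (\<i> * omega k * \<theta> s k + \<i> * of_int k / 2 * (conv M (c s) (c s) k - conv N (c s) (c s) k) + R s k) = \<epsilon>' s k"
      unfolding \<epsilon>'_def f_def q_def conv_add_left conv_add_right conv_commute[of N "\<epsilon> s" "\<theta> s"]
      by (simp add: kaw_def[of M] kaw_def[of N "c s"] algebra_simps)
    ultimately show ?thesis by simp
  qed
  have \<theta>_energy: "energy N (\<theta> s) \<le> 27 * A ^ 4 * h ^ (2 * r)" if s: "s \<in> {0..T}" for s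
  proof -
    have "energy N (\<theta> s) \<le> 3 * (3 * A\<^sup>2)\<^sup>2 * (1 / real N) ^ (2 * r)"
    proof (rule energy_pointwise_bound[OF _ N])
      fix k assume k: "\<bar>k\<bar> \<le> int N"
      have "\<tau> \<le> 3 * A\<^sup>2 * h ^ (r + 1)" unfolding \<tau>_def by (intro mult_left_mono h_pow) auto
      then show "cmod (\<theta> s k) \<le> 3 * A\<^sup>2 * (1 / real N) ^ (r + 1)"
        using \<theta>_le[OF s k] by (simp add: h_def)
    qed
    then show ?thesis by (simp add: power_mult_distrib h_def flip: power_mult)
  qed
  have "energy N (\<epsilon> t) \<le> (energy N (\<epsilon> 0) + (3 * (forcing_const r A B)\<^sup>2 * h ^ (2 * r)) * t) * exp ((Q + 1) * t)"
  proof (rule gronwall)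
    show "((\<lambda>t. energy N (\<epsilon> t)) has_real_derivative
        (\<Sum>k = - int N..int N. 2 * Re (cnj (\<epsilon> s k) * \<epsilon>' s k))) (at s within {0..})" if "s \<in> {0..T}" for s
      using that by (intro energy_has_real_derivative \<epsilon>_der) auto
    show "(\<Sum>k = - int N..int N. 2 * Re (cnj (\<epsilon> s k) * \<epsilon>' s k))
        \<le> (Q + 1) * energy N (\<epsilon> s) + 3 * (forcing_const r A B)\<^sup>2 * h ^ (2 * r)" if s: "s \<in> {0..T}" for s
    proof -
      have "energy N (f s) \<le> 3 * (forcing_const r A B)\<^sup>2 * (1 / real N) ^ (2 * r)"
        by (rule energy_pointwise_bound[OF _ N]) (use f_le[OF s] in \<open>simp add: h_def\<close>)
      then show ?thesis
        using energy_rate_bound[OF \<epsilon>_herm[OF s] q_herm[OF s] Q[OF s], where f = "f s"]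
        unfolding \<epsilon>'_def h_def by linarith
    qed
  qed (use t h \<open>0 \<le> Q\<close> in auto)
  also have "\<dots> \<le> (27 * A ^ 4 * h ^ (2 * r) + (3 * (forcing_const r A B)\<^sup>2 * h ^ (2 * r)) * T) * exp ((Q + 1) * T)"
  proof (intro mult_mono add_mono)
    \<comment> \<open>Initially the uncorrected error vanishes, so \<epsilon> starts as minus the
      corrector.\<close>
    have "energy N (\<epsilon> 0) = energy N (\<theta> 0)"
      unfolding energy_def by (intro sum.cong refl) (auto simp: \<epsilon>_def init)
    then show "energy N (\<epsilon> 0) \<le> 27 * A ^ 4 * h ^ (2 * r)" using \<theta>_energy[of 0] t by simp
    show "exp ((Q + 1) * t) \<le> exp ((Q + 1) * T)"
      using t \<open>0 \<le> Q\<close> by (simp add: mult_left_mono)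
  qed (use t h A in auto)
  finally have \<epsilon>_energy: "energy N (\<epsilon> t)
      \<le> (27 * A ^ 4 + 3 * (forcing_const r A B)\<^sup>2 * T) * exp ((Q + 1) * T) * h ^ (2 * r)"
    by (simp add: algebra_simps)
  have "energy N (\<lambda>k. a t k - c t k) = energy N (\<lambda>k. \<epsilon> t k + \<theta> t k)"
    by (simp add: \<epsilon>_def)
  also have "\<dots> \<le> 2 * energy N (\<epsilon> t) + 2 * energy N (\<theta> t)"
    by (rule energy_add_le)
  also have "\<dots> \<le> 2 * ((27 * A ^ 4 + 3 * (forcing_const r A B)\<^sup>2 * T) * exp ((Q + 1) * T) * h ^ (2 * r))
      + 2 * (27 * A ^ 4 * h ^ (2 * r))"
    by (intro add_mono mult_left_mono \<epsilon>_energy \<theta>_energy t) auto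
  also have "\<dots> = error_const r A B T * h ^ (2 * r)"
    by (simp add: error_const_def Q_def algebra_simps)
  finally show ?thesis by (simp add: h_def)
qed

section \<open>From coefficients to the L2 norm\<close>

lemma l2_norm_square: "(l2_norm f)\<^sup>2 = (\<integral>x. (cmod (f x))\<^sup>2 \<partial>circ)"
proof -
  have "l2_inner f f = (\<integral>x. complex_of_real ((cmod (f x))\<^sup>2) \<partial>circ)"
    unfolding l2_inner_def complex_norm_square ..
  also have "\<dots> = complex_of_real (\<integral>x. (cmod (f x))\<^sup>2 \<partial>circ)"
    by (rule integral_complex_of_real)
  finally have "Re (l2_inner f f) = (\<integral>x. (cmod (f x))\<^sup>2 \<partial>circ)" by simp
  moreover have "0 \<le> (\<integral>x. (cmod (f x))\<^sup>2 \<partial>circ)" by simp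
  ultimately show ?thesis by (simp add: l2_norm_def)
qed

text \<open>Beyond M = N^4 the uniform approximation is good enough, up to \<open>N\<close> the
  coefficient error is given, and in between the Sobolev sum yields the full rate, which pointwise
  decay would miss by N^(1/2). The 10 is 9 from the first range plus 1 from the last.\<close>

lemma l2_norm_diff_trig_poly_bound:
  assumes f: "f \<in> L2" and r: "r \<ge> 3" and A: "A \<ge> 0" and N: "N \<ge> 1"
    and decay: "\<And>k. cmod (fourier f k) \<le> A * wt k ^ r"
    and sobolev: "\<And>D. finite D \<Longrightarrow> (\<Sum>k\<in>D. Hweight r k * (cmod (fourier f k))\<^sup>2) \<le> A\<^sup>2"
    and close: "energy N (\<lambda>k. b k - fourier f k) \<le> E * (1 / real N) ^ (2 * r)"
  shows "(l2_norm (\<lambda>x. f x - trig_poly N b x))\<^sup>2 \<le> 4 * pi * (10 * A\<^sup>2 + E) * (1 / real N) ^ (2 * r)"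
proof -
  define h where "h = 1 / real N"
  have h: "0 < h" "h \<le> 1" using N by (auto simp: h_def)
  define M where "M = N ^ 4"
  have "N \<le> M" using N by (simp add: M_def self_le_power)
  define d where "d k = fourier f k - (if \<bar>k\<bar> \<le> int N then b k else 0)" for k
  have split: "f x - trig_poly N b x = (f x - trig_poly M (fourier f) x) + trig_poly M d x" for x
    unfolding trig_poly_extend[OF \<open>N \<le> M\<close>, of b] d_def trig_poly_diff[symmetric] by simp
  have "wt (int M) \<le> h ^ 4"
  proof -
    have "wt (int M) \<le> 1 / real M" using N by (intro wt_of_nat_le) (simp add: M_def)
    then show ?thesis by (simp add: M_def h_def power_divide)
  qed
  then have "wt (int M) ^ (r - 2) \<le> (h ^ 4) ^ (r - 2)" by (intro power_mono) auto
  also have "\<dots> \<le> h ^ r"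
    unfolding power_mult[symmetric] using r h by (intro power_decreasing) auto
  finally have wM: "3 * A * wt (int M) ^ (r - 2) \<le> 3 * A * h ^ r"
    using A by (intro mult_left_mono) auto
  have ae: "AE x in circ. cmod (f x - trig_poly M (fourier f) x) \<le> 3 * A * wt (int M) ^ (r - 2)"
  proof (rule trig_poly_approx[OF integrable_L2[OF f]])
    have "r - 2 + 2 = r" using r by simp
    then show "cmod (fourier f k) \<le> A * wt k ^ (r - 2 + 2)" for k using decay by presburger
  qed (use r in auto)
  have energy_d: "energy M d \<le> (E + A\<^sup>2) * h ^ (2 * r)"
  proof -
    define D where "D = {- int M..int M} - {- int N..int N}"
    have "energy M d = (\<Sum>k\<in>D. (cmod (d k))\<^sup>2) + (\<Sum>k = - int N..int N. (cmod (d k))\<^sup>2)"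
      unfolding energy_def D_def using \<open>N \<le> M\<close> by (intro sum.subset_diff) auto
    also have "(\<Sum>k = - int N..int N. (cmod (d k))\<^sup>2) = energy N (\<lambda>k. b k - fourier f k)"
      unfolding energy_def by (intro sum.cong refl) (auto simp: d_def norm_minus_commute)
    also have "(\<Sum>k\<in>D. (cmod (d k))\<^sup>2) \<le> (\<Sum>k\<in>D. h ^ (2 * r) * (Hweight r k * (cmod (fourier f k))\<^sup>2))"
    proof (rule sum_mono)
      fix k assume k: "k \<in> D"
      then have "real N \<le> \<bar>real_of_int k\<bar>" "\<not> \<bar>k\<bar> \<le> int N" by (auto simp: D_def)
      then have "(real N)\<^sup>2 \<le> (real_of_int k)\<^sup>2" by (simp add: abs_le_square_iff[symmetric])
      then have "((real N)\<^sup>2) ^ r \<le> Hweight r k" by (intro power_mono) auto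
      then have "h ^ (2 * r) * ((real N)\<^sup>2) ^ r \<le> h ^ (2 * r) * Hweight r k"
        using h by (intro mult_left_mono) auto
      moreover have "h ^ (2 * r) * ((real N)\<^sup>2) ^ r = 1"
        using N by (simp add: h_def power_divide power_mult)
      ultimately have "1 * (cmod (fourier f k))\<^sup>2 \<le> h ^ (2 * r) * Hweight r k * (cmod (fourier f k))\<^sup>2"
        by (intro mult_right_mono) auto
      then show "(cmod (d k))\<^sup>2 \<le> h ^ (2 * r) * (Hweight r k * (cmod (fourier f k))\<^sup>2)"
        using \<open>\<not> \<bar>k\<bar> \<le> int N\<close> by (simp add: d_def mult.assoc)
    qed
    also have "\<dots> = h ^ (2 * r) * (\<Sum>k\<in>D. Hweight r k * (cmod (fourier f k))\<^sup>2)"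
      by (simp add: sum_distrib_left)
    also have "\<dots> \<le> h ^ (2 * r) * A\<^sup>2"
      using h by (intro mult_left_mono sobolev) (auto simp: D_def)
    finally show ?thesis using close by (simp add: h_def algebra_simps)
  qed
  have "(l2_norm (\<lambda>x. f x - trig_poly N b x))\<^sup>2
      \<le> (\<integral>x. 2 * (3 * A * h ^ r)\<^sup>2 + 2 * (cmod (trig_poly M d x))\<^sup>2 \<partial>circ)"
    unfolding l2_norm_square
  proof (rule integral_mono_AE)
    show "integrable circ (\<lambda>x. (cmod (f x - trig_poly N b x))\<^sup>2)"
      using L2_diff[OF f trig_poly_L2] by (simp add: L2_def)
    show "integrable circ (\<lambda>x. 2 * (3 * A * h ^ r)\<^sup>2 + 2 * (cmod (trig_poly M d x))\<^sup>2)"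
      by (intro integrable_circ_continuous continuous_intros)
    show "AE x in circ. (cmod (f x - trig_poly N b x))\<^sup>2 \<le> 2 * (3 * A * h ^ r)\<^sup>2 + 2 * (cmod (trig_poly M d x))\<^sup>2"
      using ae
    proof eventually_elim
      case (elim x)
      then have "(cmod (f x - trig_poly M (fourier f) x))\<^sup>2 \<le> (3 * A * h ^ r)\<^sup>2"
        using wM by (intro power_mono) auto
      then show ?case
        using norm_add_square_le[of "f x - trig_poly M (fourier f) x" "trig_poly M d x"]
        unfolding split by linarith
    qed
  qed
  also have "\<dots> = (\<integral>x. 2 * (3 * A * h ^ r)\<^sup>2 \<partial>circ) + (\<integral>x. 2 * (cmod (trig_poly M d x))\<^sup>2 \<partial>circ)"
    by (intro Bochner_Integration.integral_add integrable_circ_continuous continuous_intros)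
  also have "\<dots> = 2 * pi * (2 * (3 * A * h ^ r)\<^sup>2) + 2 * (2 * pi * energy M d)"
    unfolding lebesgue_integral_const measure_circ
    by (simp add: integral_norm_trig_poly energy_def)
  also have "\<dots> \<le> 2 * pi * (2 * (3 * A * h ^ r)\<^sup>2) + 2 * (2 * pi * ((E + A\<^sup>2) * h ^ (2 * r)))"
    by (intro add_left_mono mult_left_mono energy_d) auto
  also have "\<dots> = 4 * pi * (10 * A\<^sup>2 + E) * h ^ (2 * r)"
  proof -
    have "(3 * A * h ^ r)\<^sup>2 = 9 * A\<^sup>2 * h ^ (2 * r)"
      by (simp add: power_mult_distrib mult.commute[of 2 r] power_mult)
    then show ?thesis by (simp add: algebra_simps)
  qed
  finally show ?thesis by (simp add: h_def)
qed

theorem theorem3p1: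
  fixes r :: nat and u0 :: "real \<Rightarrow> complex"
  assumes "r \<ge> 5" and "u0 \<in> Hspace r" and "real_valued u0"
  shows "(\<forall>N::nat. N \<ge> 1 \<longrightarrow>
            (\<exists>U. galerkin_solution N u0 U \<and>
                 (\<forall>V. galerkin_solution N u0 V \<longrightarrow> (\<forall>t\<ge>0. V t = U t)))) \<and>
         (\<forall>u. kawahara_solution r u0 u \<longrightarrow>
            (\<exists>T C :: real. T > 0 \<and> C > 0 \<and>
               (\<forall>N::nat. N \<ge> 1 \<longrightarrow>
                  (\<forall>U. galerkin_solution N u0 U \<longrightarrow>
                     (\<forall>t\<in>{0..T}. l2_norm (\<lambda>x. u t x - U t x) \<le> C / real N ^ r)))))"
proof (intro conjI allI impI)
  have u0: "integrable circ u0"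
    using assms(2) by (intro integrable_L2 Hspace_imp_L2)
  fix N :: nat assume "N \<ge> 1"
  obtain U where U: "galerkin_solution N u0 U"
    using galerkin_exists[OF u0 assms(3)] by blast
  then show "\<exists>U. galerkin_solution N u0 U \<and> (\<forall>V. galerkin_solution N u0 V \<longrightarrow> (\<forall>t\<ge>0. V t = U t))"
    using galerkin_unique[OF _ U u0] by blast
next
  have u0: "integrable circ u0"
    using assms(2) by (intro integrable_L2 Hspace_imp_L2)
  fix u assume sol: "kawahara_solution r u0 u"
  obtain T A where T: "T > 0" and A: "A \<ge> 0"
    and u: "\<And>t. t \<in> {0..T} \<Longrightarrow> u t \<in> L2"
    and herm: "\<And>t. t \<in> {0..T} \<Longrightarrow> hermitian (fourier (u t))"
    and init: "\<And>k. fourier (u 0) k = fourier u0 k"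
    and decay: "\<And>t k. t \<in> {0..T} \<Longrightarrow> cmod (fourier (u t) k) \<le> A * wt k ^ r"
    and sobolev: "\<And>t D. t \<in> {0..T} \<Longrightarrow> finite D \<Longrightarrow> (\<Sum>k\<in>D. Hweight r k * (cmod (fourier (u t) k))\<^sup>2) \<le> A\<^sup>2"
    and evol: "\<And>t k M. t \<in> {0..T} \<Longrightarrow> \<exists>\<rho>. ((\<lambda>t. fourier (u t) k) has_vector_derivative
          kaw M (fourier (u t)) k + \<rho>) (at t within {0..}) \<and> cmod \<rho> \<le> 27 * A\<^sup>2 * wt (int M) ^ (r - 3)"
    using kawahara_coeffs[OF sol assms(1) u0] by blast
  define E where "E = error_const r A (27 * A\<^sup>2) T"
  \<comment> \<open>The summand 1 keeps \<open>C\<close> positive even when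
    \<open>A = 0\<close>.\<close>
  define C where "C = sqrt (4 * pi * (10 * A\<^sup>2 + E)) + 1"
  have "0 \<le> E" using T A by (simp add: E_def error_const_def)
  have "l2_norm (\<lambda>x. u t x - U t x) \<le> C / real N ^ r"
    if N: "N \<ge> 1" and U: "galerkin_solution N u0 U" and t: "t \<in> {0..T}" for N U t
  proof -
    obtain a where a: "\<And>t. t \<ge> 0 \<Longrightarrow> U t = trig_poly N (a t)" "\<And>t. t \<ge> 0 \<Longrightarrow> hermitian (a t)"
        "\<And>k. \<bar>k\<bar> \<le> int N \<Longrightarrow> a 0 k = fourier u0 k"
        "\<And>t k. t \<ge> 0 \<Longrightarrow> \<bar>k\<bar> \<le> int N \<Longrightarrow>
          ((\<lambda>t. a t k) has_vector_derivative kaw N (a t) k) (at t within {0..})"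
      using galerkin_solution_coeffs[OF U u0] by blast
    have "energy N (\<lambda>k. a t k - fourier (u t) k) \<le> E * (1 / real N) ^ (2 * r)"
      unfolding E_def
    proof (rule galerkin_coeff_error[where c = "\<lambda>t. fourier (u t)" and a = a])
      show "\<exists>\<rho>. ((\<lambda>t. fourier (u t) k) has_vector_derivative kaw (N ^ 4) (fourier (u t)) k + \<rho>) (at t within {0..})
          \<and> cmod \<rho> \<le> 27 * A\<^sup>2 * wt (int (N ^ 4)) ^ (r - 3)" if "t \<in> {0..T}" for t k
        using that by (rule evol)
    qed (use assms(1) A N herm decay a init t in auto)
    then have "(l2_norm (\<lambda>x. u t x - trig_poly N (a t) x))\<^sup>2 \<le> 4 * pi * (10 * A\<^sup>2 + E) * (1 / real N) ^ (2 * r)"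
      using assms(1) by (intro l2_norm_diff_trig_poly_bound u decay sobolev A N t) auto
    also have "\<dots> = (sqrt (4 * pi * (10 * A\<^sup>2 + E)) / real N ^ r)\<^sup>2"
      using \<open>0 \<le> E\<close> by (simp add: power_divide mult.commute[of 2 r] power_mult)
    finally have "l2_norm (\<lambda>x. u t x - trig_poly N (a t) x) \<le> sqrt (4 * pi * (10 * A\<^sup>2 + E)) / real N ^ r"
      by (rule power2_le_imp_le) (use \<open>0 \<le> E\<close> in auto)
    also have "\<dots> \<le> C / real N ^ r"
      by (intro divide_right_mono) (auto simp: C_def)
    finally show ?thesis using a(1)[of t] t by simp
  qed
  moreover have "C > 0" using \<open>0 \<le> E\<close> by (simp add: C_def add_nonneg_pos)
  ultimately show "\<exists>T C :: real. T > 0 \<and> C > 0 \<and> (\<forall>N::nat. N \<ge> 1 \<longrightarrow>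
      (\<forall>U. galerkin_solution N u0 U \<longrightarrow> (\<forall>t\<in>{0..T}. l2_norm (\<lambda>x. u t x - U t x) \<le> C / real N ^ r)))"
    using T by blast
qed

end
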